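(* Let $(M,\lambda)$ be a Liouville $\sigma$-sector (possibly with corners). Suppose a diffeomorphism $\psi:M\to M$ satisfies $$\psi^*\lambda=\lambda+df$$ for some compactly supported function $f:M\to\mathbb R$. Then $\psi$ is an automorphism of the structure of Liouville $\sigma$-sectors.
   Context: A Liouville manifold (with boundary and corners) $(M,\lambda)$ is a smooth manifold with corners with a one-form $\lambda$ such that $\omega=d\lambda$ is symplectic, with Liouville vector field $Z$ defined by $Z\rfloor d\lambda=\lambda$, and cylindrical near infinity, i.e. outside a compact set the flow of $Z$ identifies $M$ with a half $S_0\times[0,\infty)_s$ of the symplectization of a contact-type hypersurface $S_0$, $Z=\partial/\partial s$. $\partial_\infty M\cong S_0$ is the contact manifold of asymptotic rays of $Z$. A hypersurface of a contact manifold is convex if there is a contact vector field, defined near it, transverse to it. Diffeomorphisms of manifolds with corners preserve the strata and their dimensions; equalities of forms are understood stratawise. For a coisotropic submanifold $Y\subset M$ with inclusion $\iota_Y$: $\mathcal D_Y=\ker\iota_Y^*\omega$, $\mathcal N_Y$ is the leaf space of the null foliation with the quotient topology, $\pi_Y:Y\to\mathcal N_Y$ the leaf map. $\sigma$-sectorial hypersurface: a cooriented hypersurface $H$ whose completion $\overline H$ has topological boundary $(\partial_\infty M\cap\overline H)\cup(\overline H\cap\partial M)$, such that $Z$ is tangent to $H$ near infinity, $\partial_\infty M\cap H$ is convex in $\partial_\infty M$, and $\pi_H:H\to\mathcal N_H$ has a continuous section and fibers homeomorphic to $\mathbb R$. Transverse coisotropic collection: cooriented hypersurfaces $H_1,\dots,H_m$,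 $Z$-invariant near infinity, intersecting transversely, with all pairwise intersections coisotropic. $(M,\lambda)$ is a Liouville $\sigma$-sector (with corners) if at each sectorial corner $\delta$ of $\partial M$ the corner can be written $C_\delta=H_{\delta,1}\cap\cdots\cap H_{\delta,m}$ for a transverse coisotropic collection of $\sigma$-sectorial hypersurfaces such that the fibers of $\pi_{C_\delta}:C_\delta\to\mathcal N_{C_\delta}$ are contractible. Two Liouville $\sigma$-sectors $(M,\lambda)$ and $(M',\lambda')$ are isomorphic if there exists a diffeomorphism $\psi:M\to M'$ (of manifolds with corners) with $\psi^*\lambda'=\lambda+df$ for some compactly supported $f:M\to\mathbb R$. A structure of Liouville $\sigma$-sectors is an isomorphism class of Liouville $\sigma$-sectors. That $\psi:M\to M$ is an automorphism of the structure means that $(M,\psi^*\lambda)=(M,\lambda+df)$ and $(M,\lambda)$ define the same structure of Liouville $\sigma$-sectors: with $\psi$ carrying the $\sigma$-sectorial hypersurfaces $H_{\delta,i}$ and transverse coisotropic collections defining the corners to ones of the same kind. *)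

theory Defs
  imports "HOL-Analysis.Analysis"
begin

section \<open>Smooth maps between subsets of Euclidean spaces\<close>

fun Ck_open :: "nat \<Rightarrow> 'a::euclidean_space set \<Rightarrow> ('a \<Rightarrow> 'b::real_normed_vector) \<Rightarrow> bool" where
  "Ck_open 0 U f \<longleftrightarrow> continuous_on U f"
| "Ck_open (Suc k) U f \<longleftrightarrow> (\<forall>x\<in>U. f differentiable (at x)) \<and>
     (\<forall>v. Ck_open k U (\<lambda>x. frechet_derivative f (at x) v))"

definition smooth_on :: "'a::euclidean_space set \<Rightarrow> ('a \<Rightarrow> 'b::real_normed_vector) \<Rightarrow> bool" where
  "smooth_on S f \<longleftrightarrow>
     (\<forall>x\<in>S. \<exists>U g. open U \<and> x \<in> U \<and> (\<forall>k. Ck_open k U g) \<and> (\<forall>y\<in>S \<inter> U. g y = f y))"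


section \<open>Manifolds with corners\<close>

text \<open>A chart is a pair of a domain and a coordinate map (the values of the latter outside the
  domain are irrelevant), with values in the quadrant of all vectors with nonnegative coordinates.
  Charts into products of half-lines and lines are covered: such a chart is, near every
  point and up to a translation, a chart into the quadrant. The dimension is \<open>DIM('e)\<close>.\<close>

type_synonym ('a, 'e) chart = "'a set \<times> ('a \<Rightarrow> 'e)"

record ('a, 'e) cmfd =
  mtop :: "'a topology"
  atlas :: "('a, 'e) chart set"

definition quadrant :: "'e::euclidean_space set" where
  "quadrant = {x. \<forall>b\<in>Basis. 0 \<le> x \<bullet> b}"

definition pt :: "('a, 'e) chart \<Rightarrow> 'e \<Rightarrow> 'a" where
  "pt c = inv_into (fst c) (snd c)"

definition cimage :: "('a, 'e) chart \<Rightarrow> 'a set \<Rightarrow> 'e set" where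
  "cimage c S = snd c ` (fst c \<inter> S)"

definition is_chart :: "'a topology \<Rightarrow> ('a, 'e::euclidean_space) chart \<Rightarrow> bool" where
  "is_chart X c \<longleftrightarrow> openin X (fst c) \<and>
     openin (top_of_set quadrant) (cimage c UNIV) \<and>
     homeomorphic_map (subtopology X (fst c)) (top_of_set (cimage c UNIV)) (snd c)"

definition compatible :: "('a, 'e::euclidean_space) chart \<Rightarrow> ('a, 'e) chart \<Rightarrow> bool" where
  "compatible c c' \<longleftrightarrow>
     smooth_on (cimage c (fst c')) (snd c' \<circ> pt c) \<and> smooth_on (cimage c' (fst c)) (snd c \<circ> pt c')"

text \<open>The atlas is required to be maximal.\<close>

definition manifold_with_corners :: "('a, 'e::euclidean_space) cmfd \<Rightarrow> bool" where
  "manifold_with_corners M \<longleftrightarrow>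
     Hausdorff_space (mtop M) \<and> second_countable (mtop M) \<and>
     topspace (mtop M) = \<Union> (fst ` atlas M) \<and>
     atlas M = {c. is_chart (mtop M) c \<and> (\<forall>c'\<in>atlas M. compatible c c')}"

definition charts_at :: "('a, 'e) cmfd \<Rightarrow> 'a \<Rightarrow> ('a, 'e) chart set" where
  "charts_at M p = {c \<in> atlas M. p \<in> fst c}"

text \<open>Points where exactly \<open>k\<close> coordinates vanish: the stratum of codimension \<open>k\<close>.\<close>

definition stratum :: "('a, 'e::euclidean_space) cmfd \<Rightarrow> nat \<Rightarrow> 'a set" where
  "stratum M k = {p. \<exists>c\<in>charts_at M p. card {b\<in>Basis. snd c p \<bullet> b = 0} = k}"

definition smooth_map :: "('a, 'e::euclidean_space) cmfd \<Rightarrow> ('b, 'f::euclidean_space) cmfd \<Rightarrow> ('a \<Rightarrow> 'b) \<Rightarrow> bool" where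
  "smooth_map M N F \<longleftrightarrow> continuous_map (mtop M) (mtop N) F \<and>
     (\<forall>c\<in>atlas M. \<forall>c'\<in>atlas N. smooth_on (cimage c (F -` fst c')) (snd c' \<circ> F \<circ> pt c))"

definition diffeomorphism :: "('a, 'e::euclidean_space) cmfd \<Rightarrow> ('b, 'e) cmfd \<Rightarrow> ('a \<Rightarrow> 'b) \<Rightarrow> bool" where
  "diffeomorphism M N F \<longleftrightarrow>
     homeomorphic_map (mtop M) (mtop N) F \<and> smooth_map M N F \<and>
     smooth_map N M (inv_into (topspace (mtop M)) F) \<and>
     (\<forall>k. F ` stratum M k = stratum N k)"

definition smooth_fun :: "('a, 'e::euclidean_space) cmfd \<Rightarrow> ('a \<Rightarrow> real) \<Rightarrow> bool" where
  "smooth_fun M f \<longleftrightarrow> (\<forall>c\<in>atlas M. smooth_on (cimage c UNIV) (f \<circ> pt c))"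

definition compactly_supported :: "('a, 'e) cmfd \<Rightarrow> ('a \<Rightarrow> real) \<Rightarrow> bool" where
  "compactly_supported M f \<longleftrightarrow>
     compactin (mtop M) (mtop M closure_of {p \<in> topspace (mtop M). f p \<noteq> 0})"


section \<open>Vector fields and differential forms\<close>

text \<open>Tensor fields are given by their components in all charts, subject to the usual
  transformation laws: \<open>V c x\<close> is the coordinate vector of \<open>V\<close>, and \<open>\<theta> c x v\<close> the value of
  \<open>\<theta>\<close> on the coordinate vector \<open>v\<close>, in the chart \<open>c\<close> at the point with coordinates \<open>x\<close>. The
  values for \<open>x\<close> outside the image of \<open>c\<close> are irrelevant. All derivatives are taken
  relative to relatively open subsets of the quadrant, where they are unique.\<close>

type_synonym ('a, 'e) vfield = "('a, 'e) chart \<Rightarrow> 'e \<Rightarrow> 'e"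
type_synonym ('a, 'e) form1 = "('a, 'e) chart \<Rightarrow> 'e \<Rightarrow> 'e \<Rightarrow> real"

text \<open>The derivative at \<open>x\<close> of the coordinate expression of \<open>F\<close> in the charts \<open>c\<close> and \<open>c'\<close>.\<close>

definition dmap :: "('a, 'e::euclidean_space) chart \<Rightarrow> ('b, 'f::euclidean_space) chart \<Rightarrow> ('a \<Rightarrow> 'b) \<Rightarrow> 'e \<Rightarrow> 'e \<Rightarrow> 'f" where
  "dmap c c' F x =
     frechet_derivative (snd c' \<circ> F \<circ> pt c) (at x within cimage c (F -` fst c'))"

definition dchart :: "('a, 'e::euclidean_space) chart \<Rightarrow> ('e \<Rightarrow> 'b::real_normed_vector) \<Rightarrow> 'e \<Rightarrow> 'e \<Rightarrow> 'b" where
  "dchart c g x = frechet_derivative g (at x within cimage c UNIV)"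

definition one_form :: "('a, 'e::euclidean_space) cmfd \<Rightarrow> ('a, 'e) form1 \<Rightarrow> bool" where
  "one_form M \<theta> \<longleftrightarrow>
     (\<forall>c\<in>atlas M. (\<forall>x\<in>cimage c UNIV. linear (\<theta> c x)) \<and>
                  (\<forall>v. smooth_on (cimage c UNIV) (\<lambda>x. \<theta> c x v))) \<and>
     (\<forall>p. \<forall>c\<in>charts_at M p. \<forall>c'\<in>charts_at M p. \<forall>v.
        \<theta> c (snd c p) v = \<theta> c' (snd c' p) (dmap c c' id (snd c p) v))"

text \<open>Equality of one-forms stratum by stratum: a vector is tangent to the stratum through
  \<open>p\<close> iff its components vanish wherever the coordinates of \<open>p\<close> do.\<close>

definition form_eq :: "('a, 'e::euclidean_space) cmfd \<Rightarrow> ('a, 'e) form1 \<Rightarrow> ('a, 'e) form1 \<Rightarrow> bool" where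
  "form_eq M \<alpha> \<beta> \<longleftrightarrow> (\<forall>p. \<forall>c\<in>charts_at M p. \<forall>v.
     (\<forall>b\<in>Basis. snd c p \<bullet> b = 0 \<longrightarrow> v \<bullet> b = 0) \<longrightarrow> \<alpha> c (snd c p) v = \<beta> c (snd c p) v)"

definition form_plus :: "('a, 'e) form1 \<Rightarrow> ('a, 'e) form1 \<Rightarrow> ('a, 'e) form1" where
  "form_plus \<alpha> \<beta> = (\<lambda>c x v. \<alpha> c x v + \<beta> c x v)"

definition dfun :: "('a \<Rightarrow> real) \<Rightarrow> ('a, 'e::euclidean_space) form1" where
  "dfun f = (\<lambda>c x v. dchart c (f \<circ> pt c) x v)"

text \<open>\<open>d\<theta>(u,v) = u(\<theta>(v)) - v(\<theta>(u))\<close> for constant coordinate fields \<open>u\<close>, \<open>v\<close>.\<close>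

definition dform :: "('a, 'e::euclidean_space) form1 \<Rightarrow> ('a, 'e) chart \<Rightarrow> 'e \<Rightarrow> 'e \<Rightarrow> 'e \<Rightarrow> real" where
  "dform \<theta> c x u v = dchart c (\<lambda>y. \<theta> c y v) x u - dchart c (\<lambda>y. \<theta> c y u) x v"

text \<open>The chart around the image point may be chosen arbitrarily, by the transformation law.\<close>

definition pullback :: "('b, 'e::euclidean_space) cmfd \<Rightarrow> ('a \<Rightarrow> 'b) \<Rightarrow> ('b, 'e) form1 \<Rightarrow> ('a, 'e) form1" where
  "pullback N F \<mu> = (\<lambda>c x v.
     let c' = (SOME c'. c' \<in> charts_at N (F (pt c x)))
     in \<mu> c' (snd c' (F (pt c x))) (dmap c c' F x v))"

definition symplectic :: "('a, 'e::euclidean_space) cmfd \<Rightarrow> ('a, 'e) form1 \<Rightarrow> bool" where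
  "symplectic M \<theta> \<longleftrightarrow> (\<forall>c\<in>atlas M. \<forall>x\<in>cimage c UNIV. \<forall>u.
     (\<forall>v. dform \<theta> c x u v = 0) \<longrightarrow> u = 0)"

definition vector_field_on :: "('a, 'e::euclidean_space) cmfd \<Rightarrow> 'a set \<Rightarrow> ('a, 'e) vfield \<Rightarrow> bool" where
  "vector_field_on M S V \<longleftrightarrow>
     (\<forall>c\<in>atlas M. smooth_on (cimage c S) (V c)) \<and>
     (\<forall>p\<in>S. \<forall>c\<in>charts_at M p. \<forall>c'\<in>charts_at M p.
        V c' (snd c' p) = dmap c c' id (snd c p) (V c (snd c p)))"

text \<open>In index notation, the \<open>j\<close>th component is \<open>V\<^sup>i \<partial>\<^sub>i \<theta>\<^sub>j + \<theta>\<^sub>i \<partial>\<^sub>j V\<^sup>i\<close>.\<close>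

definition lie_form :: "('a, 'e::euclidean_space) vfield \<Rightarrow> ('a, 'e) form1 \<Rightarrow> ('a, 'e) form1" where
  "lie_form V \<theta> = (\<lambda>c x w.
     dchart c (\<lambda>y. \<theta> c y w) x (V c x) + \<theta> c x (dchart c (V c) x w))"

definition liouville_field :: "('a, 'e::euclidean_space) form1 \<Rightarrow> ('a, 'e) vfield" where
  "liouville_field \<theta> = (\<lambda>c x. THE z. \<forall>v. dform \<theta> c x z v = \<theta> c x v)"


section \<open>Submanifolds\<close>

text \<open>\<open>Y\<close> is given near \<open>p\<close> by fixing the coordinates in \<open>B\<close> and, if \<open>Y\<close> has edges of its own,
  by bounding those in \<open>C\<close> from below.\<close>

definition local_model :: "('a, 'e::euclidean_space) cmfd \<Rightarrow> 'a set \<Rightarrow> 'a \<Rightarrow> ('a, 'e) chart \<Rightarrow> 'e set \<Rightarrow> 'e set \<Rightarrow> bool" where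
  "local_model M Y p c B C \<longleftrightarrow> c \<in> charts_at M p \<and> B \<subseteq> Basis \<and> C \<subseteq> Basis - B \<and>
     cimage c Y = {x \<in> cimage c UNIV. (\<forall>b\<in>B. x \<bullet> b = snd c p \<bullet> b) \<and> (\<forall>b\<in>C. snd c p \<bullet> b \<le> x \<bullet> b)}"

definition submanifold :: "('a, 'e::euclidean_space) cmfd \<Rightarrow> nat \<Rightarrow> 'a set \<Rightarrow> bool" where
  "submanifold M k Y \<longleftrightarrow> Y \<subseteq> topspace (mtop M) \<and>
     (\<forall>p\<in>Y. \<exists>c B C. card B = k \<and> local_model M Y p c B C)"

definition sub_boundary :: "('a, 'e::euclidean_space) cmfd \<Rightarrow> 'a set \<Rightarrow> 'a set" where
  "sub_boundary M Y = {p\<in>Y. \<exists>c B C. local_model M Y p c B C \<and>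
     (C \<noteq> {} \<or> (\<exists>b\<in>Basis - B. snd c p \<bullet> b = 0))}"

text \<open>The part of \<open>Y \<inter> \<partial>M\<close> on the boundary faces of \<open>M\<close> that do not contain \<open>Y\<close> locally. If
  \<open>Y\<close> is not contained in \<open>\<partial>M\<close> anywhere, this is \<open>Y \<inter> \<partial>M\<close>; if \<open>Y\<close> is itself a boundary face,
  this is its intersection with the other faces.\<close>

definition meets_boundary :: "('a, 'e::euclidean_space) cmfd \<Rightarrow> 'a set \<Rightarrow> 'a set" where
  "meets_boundary M Y = {p\<in>Y. \<exists>c B C. local_model M Y p c B C \<and> (\<exists>b\<in>Basis - B. snd c p \<bullet> b = 0)}"

text \<open>A hypersurface whose only boundary, apart from the one at infinity, is where it meets
  \<open>\<partial>M\<close>.\<close>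

definition proper_hypersurface :: "('a, 'e::euclidean_space) cmfd \<Rightarrow> 'a set \<Rightarrow> bool" where
  "proper_hypersurface M H \<longleftrightarrow> submanifold M 1 H \<and> closedin (mtop M) H \<and>
     sub_boundary M H = meets_boundary M H"

text \<open>The tangent space at \<open>p\<close> in the chart \<open>c\<close>, spanned by the initial velocities of curves
  in \<open>Y\<close> (which at an edge of \<open>Y\<close> form only a cone).\<close>

definition tspace :: "'a set \<Rightarrow> ('a, 'e::euclidean_space) chart \<Rightarrow> 'a \<Rightarrow> 'e set" where
  "tspace Y c p = span {v. \<exists>\<gamma>::real \<Rightarrow> 'a. \<gamma> 0 = p \<and> \<gamma> ` {0..1} \<subseteq> Y \<inter> fst c \<and>
     ((snd c \<circ> \<gamma>) has_vector_derivative v) (at 0 within {0..1})}"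

definition coorientable :: "('a, 'e::euclidean_space) cmfd \<Rightarrow> 'a set \<Rightarrow> bool" where
  "coorientable M H \<longleftrightarrow> (\<exists>\<nu>. vector_field_on M H \<nu> \<and>
     (\<forall>p\<in>H. \<forall>c\<in>charts_at M p. \<nu> c (snd c p) \<notin> tspace H c p))"

definition tangent_near_infinity :: "('a, 'e::euclidean_space) cmfd \<Rightarrow> ('a, 'e) vfield \<Rightarrow> 'a set \<Rightarrow> bool" where
  "tangent_near_infinity M Z H \<longleftrightarrow> (\<exists>K. compactin (mtop M) K \<and>
     (\<forall>p\<in>H - K. \<forall>c\<in>charts_at M p. Z c (snd c p) \<in> tspace H c p))"


section \<open>Coisotropic submanifolds and their null foliations\<close>

definition coisotropic :: "('a, 'e::euclidean_space) cmfd \<Rightarrow> ('a, 'e) form1 \<Rightarrow> nat \<Rightarrow> 'a set \<Rightarrow> bool" where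
  "coisotropic M \<theta> k Y \<longleftrightarrow> submanifold M k Y \<and>
     (\<forall>p\<in>Y. \<forall>c\<in>charts_at M p.
        {u. \<forall>w\<in>tspace Y c p. dform \<theta> c (snd c p) u w = 0} \<subseteq> tspace Y c p)"

definition null_space :: "('a, 'e::euclidean_space) form1 \<Rightarrow> 'a set \<Rightarrow> ('a, 'e) chart \<Rightarrow> 'a \<Rightarrow> 'e set" where
  "null_space \<theta> Y c p = {u\<in>tspace Y c p. \<forall>w\<in>tspace Y c p. dform \<theta> c (snd c p) u w = 0}"

definition null_curve :: "('a, 'e::euclidean_space) cmfd \<Rightarrow> ('a, 'e) form1 \<Rightarrow> 'a set \<Rightarrow> (real \<Rightarrow> 'a) \<Rightarrow> bool" where
  "null_curve M \<theta> Y \<gamma> \<longleftrightarrow> continuous_map (top_of_set {0..1}) (subtopology (mtop M) Y) \<gamma> \<and>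
     (\<forall>c\<in>atlas M. smooth_on {t\<in>{0..1}. \<gamma> t \<in> fst c} (snd c \<circ> \<gamma>)) \<and>
     (\<forall>t\<in>{0..1}. \<forall>c\<in>charts_at M (\<gamma> t).
        vector_derivative (snd c \<circ> \<gamma>) (at t within {0..1}) \<in> null_space \<theta> Y c (\<gamma> t))"

text \<open>The leaf through \<open>p\<close>: the points reached by piecewise smooth curves tangent to the null
  distribution.\<close>

definition null_leaf :: "('a, 'e::euclidean_space) cmfd \<Rightarrow> ('a, 'e) form1 \<Rightarrow> 'a set \<Rightarrow> 'a \<Rightarrow> 'a set" where
  "null_leaf M \<theta> Y p =
     {q. (\<lambda>x y. \<exists>\<gamma>. null_curve M \<theta> Y \<gamma> \<and> \<gamma> 0 = x \<and> \<gamma> 1 = y)\<^sup>*\<^sup>* p q}"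

definition leaves :: "('a, 'e::euclidean_space) cmfd \<Rightarrow> ('a, 'e) form1 \<Rightarrow> 'a set \<Rightarrow> 'a set set" where
  "leaves M \<theta> Y = null_leaf M \<theta> Y ` Y"

text \<open>The points of \<open>\<N>\<^sub>Y\<close> are the leaves, and \<open>\<pi>\<^sub>Y\<close> is \<open>null_leaf M \<theta> Y\<close>, whose fibre over a
  leaf is that leaf; the topology is the quotient topology.\<close>

definition leaf_space :: "('a, 'e::euclidean_space) cmfd \<Rightarrow> ('a, 'e) form1 \<Rightarrow> 'a set \<Rightarrow> 'a set topology" where
  "leaf_space M \<theta> Y = topology (\<lambda>\<U>. \<U> \<subseteq> leaves M \<theta> Y \<and>
     openin (subtopology (mtop M) Y) {p\<in>Y. null_leaf M \<theta> Y p \<in> \<U>})"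

lemma openin_leaf_space:
  "openin (leaf_space M \<theta> Y) \<U> \<longleftrightarrow> \<U> \<subseteq> leaves M \<theta> Y \<and>
     openin (subtopology (mtop M) Y) {p\<in>Y. null_leaf M \<theta> Y p \<in> \<U>}"
proof -
  let ?T = "subtopology (mtop M) Y" and ?l = "null_leaf M \<theta> Y"
  have "istopology (\<lambda>\<U>. \<U> \<subseteq> leaves M \<theta> Y \<and> openin ?T {p\<in>Y. ?l p \<in> \<U>})"
    unfolding istopology_def
  proof (intro conjI allI impI; (elim conjE)?)
    fix S T assume "S \<subseteq> leaves M \<theta> Y" "openin ?T {p\<in>Y. ?l p \<in> S}" "openin ?T {p\<in>Y. ?l p \<in> T}"
    moreover have "{p\<in>Y. ?l p \<in> S \<inter> T} = {p\<in>Y. ?l p \<in> S} \<inter> {p\<in>Y. ?l p \<in> T}" by auto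
    ultimately show "openin ?T {p\<in>Y. ?l p \<in> S \<inter> T}" by (simp add: openin_Int)
  next
    fix \<K> assume "\<forall>K\<in>\<K>. K \<subseteq> leaves M \<theta> Y \<and> openin ?T {p\<in>Y. ?l p \<in> K}"
    moreover have "{p\<in>Y. ?l p \<in> \<Union>\<K>} = \<Union> ((\<lambda>K. {p\<in>Y. ?l p \<in> K}) ` \<K>)" by auto
    ultimately show "openin ?T {p\<in>Y. ?l p \<in> \<Union>\<K>}" by (auto intro!: openin_Union)
  qed auto
  then show ?thesis
    by (simp add: leaf_space_def)
qed

definition has_continuous_section :: "('a, 'e::euclidean_space) cmfd \<Rightarrow> ('a, 'e) form1 \<Rightarrow> 'a set \<Rightarrow> bool" where
  "has_continuous_section M \<theta> Y \<longleftrightarrow>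
     (\<exists>\<sigma>. continuous_map (leaf_space M \<theta> Y) (subtopology (mtop M) Y) \<sigma> \<and>
          (\<forall>L\<in>leaves M \<theta> Y. null_leaf M \<theta> Y (\<sigma> L) = L))"


section \<open>Liouville manifolds and their contact boundary at infinity\<close>

text \<open>\<open>S\<close> is a contact-type hypersurface (transverse to the Liouville field \<open>Z\<close>), \<open>\<Phi> p t\<close> is the
  time \<open>t\<close> flow of \<open>Z\<close> starting at \<open>p \<in> S\<close>, and \<open>\<Phi>\<close> is a diffeomorphism of \<open>S \<times> [0,\<infty>)\<close> onto
  its image, which is closed; the complement of the image of \<open>S \<times> (0,\<infty>)\<close> is compact. As \<open>Z\<close> rescales \<open>\<theta>\<close>, the
  pullback of \<open>\<theta>\<close> by \<open>\<Phi>\<close> is then \<open>exp t\<close> times the restriction of \<open>\<theta>\<close> to \<open>S\<close>.\<close>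

definition cylindrical_end :: "('a, 'e::euclidean_space) cmfd \<Rightarrow> ('a, 'e) form1 \<Rightarrow> 'a set \<Rightarrow> ('a \<Rightarrow> real \<Rightarrow> 'a) \<Rightarrow> bool" where
  "cylindrical_end M \<theta> S \<Phi> \<longleftrightarrow>
     proper_hypersurface M S \<and>
     (\<forall>p\<in>S. \<forall>c\<in>charts_at M p. liouville_field \<theta> c (snd c p) \<notin> tspace S c p) \<and>
     (\<forall>p\<in>S. \<Phi> p 0 = p) \<and>
     (\<forall>p\<in>S. \<forall>t\<ge>0. \<forall>c\<in>charts_at M (\<Phi> p t).
        ((\<lambda>s. snd c (\<Phi> p s)) has_vector_derivative liouville_field \<theta> c (snd c (\<Phi> p t)))
          (at t within {0..})) \<and>
     embedding_map (prod_topology (subtopology (mtop M) S) (top_of_set {0..})) (mtop M)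
       (\<lambda>(p, t). \<Phi> p t) \<and>
     closedin (mtop M) {\<Phi> p t |p t. p \<in> S \<and> 0 \<le> t} \<and>
     (\<forall>c\<in>atlas M. \<forall>c'\<in>atlas M.
        smooth_on {(x, t). x \<in> cimage c S \<and> 0 \<le> t \<and> \<Phi> (pt c x) t \<in> fst c'}
          (\<lambda>(x, t). snd c' (\<Phi> (pt c x) t))) \<and>
     (\<exists>\<pi> s. (\<forall>p\<in>S. \<forall>t\<ge>0. \<pi> (\<Phi> p t) = p \<and> s (\<Phi> p t) = t) \<and>
        (\<forall>c\<in>atlas M. \<forall>c'\<in>atlas M.
           smooth_on (cimage c {q. \<exists>p\<in>S \<inter> fst c'. \<exists>t\<ge>0. q = \<Phi> p t})
             (\<lambda>x. (snd c' (\<pi> (pt c x)), s (pt c x) :: real)))) \<and>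
     compactin (mtop M) (topspace (mtop M) - {\<Phi> p t |p t. p \<in> S \<and> 0 < t})"

definition liouville_manifold :: "('a, 'e::euclidean_space) cmfd \<Rightarrow> ('a, 'e) form1 \<Rightarrow> bool" where
  "liouville_manifold M \<theta> \<longleftrightarrow> manifold_with_corners M \<and> one_form M \<theta> \<and> symplectic M \<theta> \<and>
     (\<exists>S \<Phi>. cylindrical_end M \<theta> S \<Phi>)"

text \<open>Vector fields on \<open>S\<close> are represented by extensions to open subsets of \<open>M\<close>, which exist
  as \<open>S\<close> is embedded. Since \<open>V\<close> is tangent to \<open>S\<close>, \<open>L\<^sub>V \<theta>\<close> evaluated on vectors tangent to \<open>S\<close> is the
  Lie derivative of the restriction of \<open>\<theta>\<close> to \<open>S\<close>, independently of the extension.\<close>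

definition contact_field_on :: "('a, 'e::euclidean_space) cmfd \<Rightarrow> ('a, 'e) form1 \<Rightarrow> 'a set \<Rightarrow> 'a set \<Rightarrow> ('a, 'e) vfield \<Rightarrow> bool" where
  "contact_field_on M \<theta> S W V \<longleftrightarrow> openin (mtop M) W \<and> vector_field_on M W V \<and>
     (\<forall>p\<in>S \<inter> W. \<forall>c\<in>charts_at M p. V c (snd c p) \<in> tspace S c p) \<and>
     (\<exists>g::'a \<Rightarrow> real. \<forall>p\<in>S \<inter> W. \<forall>c\<in>charts_at M p. \<forall>w\<in>tspace S c p.
        lie_form V \<theta> c (snd c p) w = g p * \<theta> c (snd c p) w)"

text \<open>\<open>\<Gamma>\<close> is a convex hypersurface of the contact manifold \<open>S\<close> with contact form \<open>\<theta>\<close>; it has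
  codimension 2 in \<open>M\<close>.\<close>

definition convex_hypersurface :: "('a, 'e::euclidean_space) cmfd \<Rightarrow> ('a, 'e) form1 \<Rightarrow> 'a set \<Rightarrow> 'a set \<Rightarrow> bool" where
  "convex_hypersurface M \<theta> S \<Gamma> \<longleftrightarrow> \<Gamma> \<subseteq> S \<and> submanifold M 2 \<Gamma> \<and>
     (\<exists>W V. \<Gamma> \<subseteq> W \<and> contact_field_on M \<theta> S W V \<and>
        (\<forall>p\<in>\<Gamma>. \<forall>c\<in>charts_at M p. V c (snd c p) \<notin> tspace \<Gamma> c p))"

text \<open>Points of \<open>\<partial>\<^sub>\<infinity>M\<close> are asymptotic rays \<open>t \<mapsto> \<Phi> p t\<close>, and \<open>\<partial>\<^sub>\<infinity>M \<inter> H\<close> consists of those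
  eventually contained in \<open>H\<close>. Following the rays identifies \<open>\<partial>\<^sub>\<infinity>M\<close> with every level
  \<open>\<Phi> (S \<times> {t})\<close>, compatibly with the contact structures.\<close>

definition rays_in :: "'a set \<Rightarrow> ('a \<Rightarrow> real \<Rightarrow> 'a) \<Rightarrow> 'a set \<Rightarrow> 'a set" where
  "rays_in S \<Phi> H = {p\<in>S. \<exists>t\<^sub>0\<ge>0. \<forall>t\<ge>t\<^sub>0. \<Phi> p t \<in> H}"

definition convex_at_infinity :: "('a, 'e::euclidean_space) cmfd \<Rightarrow> ('a, 'e) form1 \<Rightarrow> 'a set \<Rightarrow> bool" where
  "convex_at_infinity M \<theta> H \<longleftrightarrow> (\<exists>S \<Phi>. cylindrical_end M \<theta> S \<Phi> \<and>
     (\<forall>t\<ge>0. convex_hypersurface M \<theta> ((\<lambda>p. \<Phi> p t) ` S) ((\<lambda>p. \<Phi> p t) ` rays_in S \<Phi> H)))"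


section \<open>Liouville sectors\<close>

definition sigma_sectorial :: "('a, 'e::euclidean_space) cmfd \<Rightarrow> ('a, 'e) form1 \<Rightarrow> 'a set \<Rightarrow> bool" where
  "sigma_sectorial M \<theta> H \<longleftrightarrow> proper_hypersurface M H \<and> coorientable M H \<and>
     tangent_near_infinity M (liouville_field \<theta>) H \<and>
     convex_at_infinity M \<theta> H \<and>
     has_continuous_section M \<theta> H \<and>
     (\<forall>L\<in>leaves M \<theta> H. subtopology (mtop M) L homeomorphic_space euclideanreal)"

definition transverse_coisotropic :: "('a, 'e::euclidean_space) cmfd \<Rightarrow> ('a, 'e) form1 \<Rightarrow> nat \<Rightarrow> (nat \<Rightarrow> 'a set) \<Rightarrow> bool" where
  "transverse_coisotropic M \<theta> m H \<longleftrightarrow>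
     (\<forall>i<m. submanifold M 1 (H i) \<and> coorientable M (H i) \<and>
            tangent_near_infinity M (liouville_field \<theta>) (H i)) \<and>
     (\<forall>I\<subseteq>{..<m}. \<forall>p\<in>topspace (mtop M) \<inter> (\<Inter>i\<in>I. H i). \<forall>c\<in>charts_at M p.
        dim (\<Inter>i\<in>I. tspace (H i) c p) + card I = DIM('e)) \<and>
     (\<forall>i<m. \<forall>j<m. i \<noteq> j \<longrightarrow> coisotropic M \<theta> 2 (H i \<inter> H j))"

text \<open>The corner \<open>C\<close> of codimension \<open>m\<close> is the closure of a union of components of the stratum.
  An intersection of boundary faces need not be connected.\<close>

definition corner :: "('a, 'e::euclidean_space) cmfd \<Rightarrow> nat \<Rightarrow> 'a set \<Rightarrow> bool" where
  "corner M m C \<longleftrightarrow> (\<exists>\<D> \<subseteq> connected_components_of (subtopology (mtop M) (stratum M m)).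
     C = mtop M closure_of \<Union>\<D>)"

definition sectorial_corner :: "('a, 'e::euclidean_space) cmfd \<Rightarrow> ('a, 'e) form1 \<Rightarrow> nat \<Rightarrow> (nat \<Rightarrow> 'a set) \<Rightarrow> 'a set \<Rightarrow> bool" where
  "sectorial_corner M \<theta> m H C \<longleftrightarrow> m \<ge> 1 \<and> corner M m C \<and> C = (\<Inter>i<m. H i) \<and>
     transverse_coisotropic M \<theta> m H \<and> (\<forall>i<m. sigma_sectorial M \<theta> (H i)) \<and>
     (\<forall>L\<in>leaves M \<theta> C. contractible_space (subtopology (mtop M) L))"

text \<open>For \<open>m = 1\<close> the corners are the smooth boundary faces.\<close>

definition sigma_sector :: "('a, 'e::euclidean_space) cmfd \<Rightarrow> ('a, 'e) form1 \<Rightarrow> bool" where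
  "sigma_sector M \<theta> \<longleftrightarrow> liouville_manifold M \<theta> \<and>
     (\<forall>m\<ge>1. \<forall>\<delta>\<in>connected_components_of (subtopology (mtop M) (stratum M m)).
        \<exists>H C. \<delta> \<subseteq> C \<and> sectorial_corner M \<theta> m H C)"

definition sector_isomorphic ::
  "('a, 'e::euclidean_space) cmfd \<Rightarrow> ('a, 'e) form1 \<Rightarrow> ('b, 'e) cmfd \<Rightarrow> ('b, 'e) form1 \<Rightarrow> bool" where
  "sector_isomorphic M \<theta> M' \<theta>' \<longleftrightarrow> (\<exists>\<psi> f. diffeomorphism M M' \<psi> \<and> smooth_fun M f \<and>
     compactly_supported M f \<and> form_eq M (pullback M' \<psi> \<theta>') (form_plus \<theta> (dfun f)))"

text \<open>The isomorphism class (within the given types of points and of coordinates).\<close>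

definition sector_structure ::
  "('a, 'e::euclidean_space) cmfd \<Rightarrow> ('a, 'e) form1 \<Rightarrow> (('a, 'e) cmfd \<times> ('a, 'e) form1) set" where
  "sector_structure M \<theta> = {(M', \<theta>'). sigma_sector M' \<theta>' \<and> sector_isomorphic M \<theta> M' \<theta>'}"

text \<open>The sectorial data of \<open>\<theta>\<close> as well as those of \<open>\<psi>\<^sup>*\<theta>\<close> are carried by \<open>\<psi>\<close> to sectorial data
  of \<open>\<theta>\<close>.\<close>

definition sector_automorphism ::
  "('a, 'e::euclidean_space) cmfd \<Rightarrow> ('a, 'e) form1 \<Rightarrow> ('a \<Rightarrow> 'a) \<Rightarrow> bool" where
  "sector_automorphism M \<theta> \<psi> \<longleftrightarrow> diffeomorphism M M \<psi> \<and>
     sigma_sector M (pullback M \<psi> \<theta>) \<and>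
     sector_structure M (pullback M \<psi> \<theta>) = sector_structure M \<theta> \<and>
     (\<forall>\<mu>\<in>{\<theta>, pullback M \<psi> \<theta>}.
        (\<forall>H. sigma_sectorial M \<mu> H \<longrightarrow> sigma_sectorial M \<theta> (\<psi> ` H)) \<and>
        (\<forall>m H. transverse_coisotropic M \<mu> m H \<longrightarrow> transverse_coisotropic M \<theta> m (\<lambda>i. \<psi> ` H i)) \<and>
        (\<forall>m H C. sectorial_corner M \<mu> m H C \<longrightarrow> sectorial_corner M \<theta> m (\<lambda>i. \<psi> ` H i) (\<psi> ` C)))"

end

theory Submission
  imports Defs
begin

text \<open>Extended by the identity off the manifold, \<open>\<psi>\<close> is a bijection and acts on charts by
  \<open>(U, x) \<mapsto> (\<psi>(U), x \<circ> \<psi>\<inverse>)\<close>; as the atlas is maximal, this permutes the atlas. A form and its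
  pullback have the same components in corresponding charts, hence everything defined from
  \<open>\<psi>\<^sup>*\<theta>\<close> in charts is carried by \<open>\<psi>\<close> to the same object for \<open>\<theta>\<close>. It remains to
  compare \<open>\<theta>\<close> with \<open>\<psi>\<^sup>*\<theta>\<close>, which is \<open>\<theta> + df\<close> on all tangent vectors: the two
  agree on the dense open stratum and are continuous. Since \<open>d(df) = 0\<close>, the null foliations coincide, and
  the Liouville fields coincide outside the compact support of \<open>f\<close>. A cylindrical end
  of \<open>\<theta>\<close> on \<open>S\<close> becomes one of \<open>\<theta> + df\<close> after replacing \<open>S\<close> by its image under the flow for a
  large time \<open>T\<close>; the chart formed by the coordinates of \<open>S\<close> and the time shows that this image
  is a hypersurface without edges in the interior of \<open>M\<close>.\<close>

section \<open>Smooth maps\<close>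

text \<open>Data of \<psi>^*\<theta> reach \<theta> by transport alone. Data of \<theta> do not:
  they must first be recognised as data of \<psi>^*\<theta>, and this perturbation step carries the
  mathematics. Convexity at infinity is the obstacle. It asks for an end along which the Liouville
  flow and, on every level, the contact condition refer to the form itself, while the end given for
  \<theta> may meet the support of f. Restarting the end later does not affect which rays lie in a
  hypersurface, but the new base must satisfy every clause of \<open>cylindrical_end\<close> again,
  among them that it has no edges except where it meets the faces of M. \<open>form_eq\<close>
  compares forms along the strata only, whereas Liouville fields and null spaces involve all tangent
  vectors; hence the passage to the limit at boundary points. Derivatives at such points are those
  of smooth extensions to open sets, where mixed second derivatives commute.\<close>

lemma frechet_derivative_at': "(f has_derivative D) (at x) \<Longrightarrow> frechet_derivative f (at x) = D"
  using frechet_derivative_at by metis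

lemma has_derivative_cong_open:
  assumes "open U" "x \<in> U" "\<And>y. y \<in> U \<Longrightarrow> f y = g y"
  shows "(f has_derivative D) (at x) \<longleftrightarrow> (g has_derivative D) (at x)"
  using has_derivative_transform_within_open[OF _ assms(1,2), of f D UNIV g]
    has_derivative_transform_within_open[OF _ assms(1,2), of g D UNIV f] assms(3) by metis

lemma Ck_open_cong:
  assumes "open U" "\<And>x. x \<in> U \<Longrightarrow> f x = g x"
  shows "Ck_open k U f \<longleftrightarrow> Ck_open k U g"
  using assms(2)
proof (induction k arbitrary: f g)
  case 0
  show ?case unfolding Ck_open.simps by (rule continuous_on_cong[OF refl 0])
next
  case (Suc k)
  note der = has_derivative_cong_open[OF assms(1) _ Suc.prems]
  have "f differentiable (at x) \<longleftrightarrow> g differentiable (at x)" if "x \<in> U" for x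
    unfolding differentiable_def using der[OF that] by simp
  moreover have "Ck_open k U (\<lambda>x. frechet_derivative f (at x) v) \<longleftrightarrow> Ck_open k U (\<lambda>x. frechet_derivative g (at x) v)" for v
  proof (rule Suc.IH)
    fix x assume "x \<in> U"
    then show "frechet_derivative f (at x) v = frechet_derivative g (at x) v"
      unfolding frechet_derivative_def using der by simp
  qed
  ultimately show ?case unfolding Ck_open.simps by blast
qed

lemma Ck_open_subset: "Ck_open k U f \<Longrightarrow> V \<subseteq> U \<Longrightarrow> Ck_open k V f"
  by (induction k arbitrary: f) (auto intro: continuous_on_subset)

lemma Ck_open_lower: "Ck_open (Suc k) U f \<Longrightarrow> Ck_open k U f"
proof (induction k arbitrary: f)
  case 0
  then show ?case
    by (auto intro!: continuous_at_imp_continuous_on differentiable_imp_continuous_within)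
next
  case (Suc k)
  from Suc.prems show ?case using Suc.IH by (metis Ck_open.simps(2))
qed

text \<open>\<open>Ck_open\<close> is defined through \<open>frechet_derivative\<close>; this form
  accepts any explicit derivative \<open>D\<close>. The closure properties below are then inductions
  that name the derivative by a rule of calculus and apply the hypothesis to it.\<close>

lemma Ck_open_SucI:
  assumes "open U" "\<And>x. x \<in> U \<Longrightarrow> (f has_derivative D x) (at x)" "\<And>v. Ck_open k U (\<lambda>x. D x v)"
  shows "Ck_open (Suc k) U f"
proof -
  have "f differentiable (at x)" if "x \<in> U" for x
    using assms(2)[OF that] unfolding differentiable_def by blast
  moreover have "Ck_open k U (\<lambda>x. frechet_derivative f (at x) v)" for v
    by (rule Ck_open_cong[OF assms(1), THEN iffD1, OF _ assms(3)])
      (simp add: frechet_derivative_at'[OF assms(2)])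
  ultimately show ?thesis by simp
qed

lemma Ck_open_SucD:
  assumes "Ck_open (Suc k) U f"
  shows "x \<in> U \<Longrightarrow> (f has_derivative frechet_derivative f (at x)) (at x)"
    and "Ck_open k U (\<lambda>x. frechet_derivative f (at x) v)"
proof -
  have "\<forall>x\<in>U. f differentiable (at x)" "\<forall>v. Ck_open k U (\<lambda>x. frechet_derivative f (at x) v)"
    using assms unfolding Ck_open.simps by blast+
  then show "x \<in> U \<Longrightarrow> (f has_derivative frechet_derivative f (at x)) (at x)"
    and "Ck_open k U (\<lambda>x. frechet_derivative f (at x) v)"
    unfolding frechet_derivative_works by blast+
qed

lemma Ck_open_linear_comp:
  assumes "bounded_linear h" "open U" "Ck_open k U f"
  shows "Ck_open k U (\<lambda>x. h (f x))"
  using assms(3)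
proof (induction k arbitrary: f)
  case 0
  then show ?case unfolding Ck_open.simps by (rule bounded_linear.continuous_on[OF assms(1)])
next
  case (Suc k)
  note f = Ck_open_SucD[OF Suc.prems]
  show ?case
    by (rule Ck_open_SucI[OF assms(2) bounded_linear.has_derivative[OF assms(1) f(1)] Suc.IH[OF f(2)]])
qed

lemma Ck_open_const: "Ck_open k U (\<lambda>x. c)"
proof (induction k arbitrary: c)
  case (Suc k)
  then show ?case by (simp add: frechet_derivative_const)
qed simp

lemma Ck_open_bounded_linear:
  assumes "open U" "bounded_linear h"
  shows "Ck_open k U h"
proof (cases k)
  case 0
  then show ?thesis using assms by (simp add: linear_continuous_on)
next
  case (Suc k)
  show ?thesis unfolding Suc
    by (rule Ck_open_SucI[OF assms(1) bounded_linear_imp_has_derivative[OF assms(2)] Ck_open_const])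
qed

lemma Ck_open_add:
  assumes "open U" "Ck_open k U f" "Ck_open k U g"
  shows "Ck_open k U (\<lambda>x. f x + g x)"
  using assms(2,3)
proof (induction k arbitrary: f g)
  case 0
  then show ?case unfolding Ck_open.simps by (rule continuous_on_add)
next
  case (Suc k)
  note f = Ck_open_SucD[OF Suc.prems(1)] and g = Ck_open_SucD[OF Suc.prems(2)]
  show ?case
    by (rule Ck_open_SucI[OF assms(1) has_derivative_add[OF f(1) g(1)] Suc.IH[OF f(2) g(2)]])
qed

text \<open>By the product rule the derivative is a sum of two terms of the same shape, each pairing
  one function with a derivative of the other. The induction is over both functions at once, and
  \<open>Ck_open_lower\<close> brings the undifferentiated one down to class
  \<open>k\<close>.\<close>

lemma Ck_open_bilinear:
  assumes "bounded_bilinear p" "open U" "Ck_open k U f" "Ck_open k U g"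
  shows "Ck_open k U (\<lambda>x. p (f x) (g x))"
  using assms(3,4)
proof (induction k arbitrary: f g)
  case 0
  then show ?case unfolding Ck_open.simps by (rule bounded_bilinear.continuous_on[OF assms(1)])
next
  case (Suc k)
  note f = Ck_open_SucD[OF Suc.prems(1)] and g = Ck_open_SucD[OF Suc.prems(2)]
  show ?case
  proof (rule Ck_open_SucI[OF assms(2)])
    show "((\<lambda>x. p (f x) (g x)) has_derivative (\<lambda>v. p (f x) (frechet_derivative g (at x) v)
        + p (frechet_derivative f (at x) v) (g x))) (at x)" if "x \<in> U" for x
      by (rule bounded_bilinear.FDERIV[OF assms(1) f(1)[OF that] g(1)[OF that]])
    show "Ck_open k U (\<lambda>x. p (f x) (frechet_derivative g (at x) v)
        + p (frechet_derivative f (at x) v) (g x))" for v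
    proof (rule Ck_open_add[OF assms(2)])
      show "Ck_open k U (\<lambda>x. p (f x) (frechet_derivative g (at x) v))"
        by (rule Suc.IH[OF Ck_open_lower[OF Suc.prems(1)] g(2)])
      show "Ck_open k U (\<lambda>x. p (frechet_derivative f (at x) v) (g x))"
        by (rule Suc.IH[OF f(2) Ck_open_lower[OF Suc.prems(2)]])
    qed
  qed
qed

lemma Ck_open_sum:
  assumes "open U" "finite I" "\<And>i. i \<in> I \<Longrightarrow> Ck_open k U (f i)"
  shows "Ck_open k U (\<lambda>x. \<Sum>i\<in>I. f i x)"
  using assms(2,3)
proof (induction I)
  case empty
  show ?case unfolding sum.empty by (rule Ck_open_const)
next
  case (insert i I)
  have "Ck_open k U (\<lambda>x. f i x + (\<Sum>i\<in>I. f i x))"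
    by (rule Ck_open_add[OF assms(1)]) (simp_all add: insert)
  then show ?case unfolding sum.insert[OF insert.hyps] .
qed

text \<open>In the chain rule \<open>?g' (f x) (?f' x v)\<close> both the base point and the
  direction vary with \<open>x\<close>, while the hypothesis controls \<open>?g'\<close> in fixed
  directions only. Expanding \<open>?f' x v\<close> in the basis gives a finite sum of products to
  which the induction applies.\<close>

lemma Ck_open_compose:
  fixes f :: "'a::euclidean_space \<Rightarrow> 'b::euclidean_space" and g :: "'b \<Rightarrow> 'c::real_normed_vector"
  assumes "open U" "open V" "f ` U \<subseteq> V" "Ck_open k U f" "Ck_open k V g"
  shows "Ck_open k U (\<lambda>x. g (f x))"
  using assms(4,5)
proof (induction k arbitrary: g)
  case 0
  then show ?case using assms(3) unfolding Ck_open.simps by (intro continuous_on_compose2[of V g U f])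
next
  case (Suc k)
  let ?f' = "\<lambda>x. frechet_derivative f (at x)" and ?g' = "\<lambda>y. frechet_derivative g (at y)"
  note f = Ck_open_SucD[OF Suc.prems(1)] and g = Ck_open_SucD[OF Suc.prems(2)]
  have fV: "f x \<in> V" if "x \<in> U" for x using that assms(3) by auto
  have expand: "(\<Sum>b\<in>Basis. (?f' x v \<bullet> b) *\<^sub>R ?g' (f x) b) = ?g' (f x) (?f' x v)" if "x \<in> U" for x v
  proof -
    interpret linear "?g' (f x)"
      using g(1)[OF fV[OF that]] by (rule has_derivative_linear)
    have "(\<Sum>b\<in>Basis. (?f' x v \<bullet> b) *\<^sub>R ?g' (f x) b) = ?g' (f x) (\<Sum>b\<in>Basis. (?f' x v \<bullet> b) *\<^sub>R b)"
      by (simp add: sum scale)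
    then show ?thesis by (simp only: euclidean_representation)
  qed
  have "Ck_open k U (\<lambda>x. \<Sum>b\<in>Basis. (?f' x v \<bullet> b) *\<^sub>R ?g' (f x) b)" for v
  proof (rule Ck_open_sum[OF assms(1) finite_Basis])
    fix b
    show "Ck_open k U (\<lambda>x. (?f' x v \<bullet> b) *\<^sub>R ?g' (f x) b)"
    proof (rule Ck_open_bilinear[OF bounded_bilinear_scaleR assms(1)])
      show "Ck_open k U (\<lambda>x. ?f' x v \<bullet> b)"
        by (rule Ck_open_linear_comp[OF bounded_linear_inner_left assms(1) f(2)])
      show "Ck_open k U (\<lambda>x. ?g' (f x) b)"
        by (rule Suc.IH[OF Ck_open_lower[OF Suc.prems(1)] g(2)])
    qed
  qed
  then have D: "Ck_open k U (\<lambda>x. ?g' (f x) (?f' x v))" for v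
    by (rule Ck_open_cong[OF assms(1), THEN iffD1, rotated]) (rule expand)
  show ?case
  proof (rule Ck_open_SucI[OF assms(1) _ D])
    fix x assume "x \<in> U"
    show "((\<lambda>x. g (f x)) has_derivative (\<lambda>v. ?g' (f x) (?f' x v))) (at x)"
      by (rule has_derivative_compose[OF f(1)[OF \<open>x \<in> U\<close>] g(1)[OF fV[OF \<open>x \<in> U\<close>]]])
  qed
qed

lemma Ck_open_Pair:
  assumes "open U" "Ck_open k U f" "Ck_open k U g"
  shows "Ck_open k U (\<lambda>x. (f x, g x))"
proof -
  have "Ck_open k U (\<lambda>x. (f x, 0) + (0, g x))"
    by (intro Ck_open_add Ck_open_linear_comp[where h = "\<lambda>y. (y, 0)"]
        Ck_open_linear_comp[where h = "\<lambda>y. (0, y)"] bounded_linear_Pair bounded_linear_ident bounded_linear_zero assms)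
  then show ?thesis by simp
qed

section \<open>Smooth functions on arbitrary subsets\<close>

lemma Ck_open_imp_smooth_on:
  assumes "open U" "S \<subseteq> U" "\<And>k. Ck_open k U f"
  shows "smooth_on S f"
  unfolding smooth_on_def
proof
  fix x assume "x \<in> S"
  then show "\<exists>U g. open U \<and> x \<in> U \<and> (\<forall>k. Ck_open k U g) \<and> (\<forall>y\<in>S \<inter> U. g y = f y)"
    using assms by (intro exI[of _ U] exI[of _ f]) auto
qed

lemma smooth_onE:
  assumes "smooth_on S f" "x \<in> S"
  obtains U g where "open U" "x \<in> U" "\<And>k. Ck_open k U g" "\<And>y. y \<in> S \<inter> U \<Longrightarrow> g y = f y"
  using assms(1)[unfolded smooth_on_def, rule_format, OF assms(2)]
  by (elim exE conjE) (rule that, assumption+, erule spec, erule (1) bspec)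

lemma smooth_onI:
  assumes "\<And>x. x \<in> S \<Longrightarrow> \<exists>U g. open U \<and> x \<in> U \<and> (\<forall>k. Ck_open k U g) \<and> (\<forall>y\<in>S \<inter> U. g y = f y)"
  shows "smooth_on S f"
  unfolding smooth_on_def by (rule ballI) (rule assms)

lemma smooth_on_subset:
  assumes "smooth_on S f" "T \<subseteq> S"
  shows "smooth_on T f"
proof (rule smooth_onI)
  fix x assume "x \<in> T"
  then obtain U g where "open U" "x \<in> U" "\<And>k. Ck_open k U g" "\<And>y. y \<in> S \<inter> U \<Longrightarrow> g y = f y"
    using smooth_onE[OF assms(1), of x] assms(2) by blast
  then show "\<exists>U g. open U \<and> x \<in> U \<and> (\<forall>k. Ck_open k U g) \<and> (\<forall>y\<in>T \<inter> U. g y = f y)"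
    using assms(2) by (intro exI[of _ U] exI[of _ g]) auto
qed

lemma smooth_on_cong: "(\<And>x. x \<in> S \<Longrightarrow> f x = g x) \<Longrightarrow> smooth_on S f \<longleftrightarrow> smooth_on S g"
  unfolding smooth_on_def by auto

lemma smooth_on_local:
  assumes "\<And>x. x \<in> S \<Longrightarrow> \<exists>U. open U \<and> x \<in> U \<and> smooth_on (S \<inter> U) f"
  shows "smooth_on S f"
proof (rule smooth_onI)
  fix x assume "x \<in> S"
  then obtain U where U: "open U" "x \<in> U" "smooth_on (S \<inter> U) f" using assms by blast
  then obtain V g where V: "open V" "x \<in> V" "\<And>k. Ck_open k V g" "\<And>y. y \<in> S \<inter> U \<inter> V \<Longrightarrow> g y = f y"
    using smooth_onE[OF U(3), of x] \<open>x \<in> S\<close> by blast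
  show "\<exists>U g. open U \<and> x \<in> U \<and> (\<forall>k. Ck_open k U g) \<and> (\<forall>y\<in>S \<inter> U. g y = f y)"
    using U V Ck_open_subset[OF V(3), of "U \<inter> V"]
    by (intro exI[of _ "U \<inter> V"] exI[of _ g]) auto
qed

lemma smooth_on_bounded_linear: "bounded_linear h \<Longrightarrow> smooth_on S h"
  by (rule Ck_open_imp_smooth_on[OF open_UNIV _ Ck_open_bounded_linear]) auto

lemma smooth_on_const: "smooth_on S (\<lambda>x. c)"
  by (rule Ck_open_imp_smooth_on[OF open_UNIV _ Ck_open_const]) auto

lemma smooth_on_Pair:
  assumes "smooth_on S f" "smooth_on S g"
  shows "smooth_on S (\<lambda>x. (f x, g x))"
proof (rule smooth_onI)
  fix x assume x: "x \<in> S"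
  obtain U f' where U: "open U" "x \<in> U" "\<And>k. Ck_open k U f'" "\<And>y. y \<in> S \<inter> U \<Longrightarrow> f' y = f y"
    using smooth_onE[OF assms(1) x] by blast
  obtain V g' where V: "open V" "x \<in> V" "\<And>k. Ck_open k V g'" "\<And>y. y \<in> S \<inter> V \<Longrightarrow> g' y = g y"
    using smooth_onE[OF assms(2) x] by blast
  have "Ck_open k (U \<inter> V) (\<lambda>x. (f' x, g' x))" for k
    by (intro Ck_open_Pair open_Int U V Ck_open_subset[OF U(3)] Ck_open_subset[OF V(3)]) auto
  then show "\<exists>U h. open U \<and> x \<in> U \<and> (\<forall>k. Ck_open k U h) \<and> (\<forall>y\<in>S \<inter> U. h y = (f y, g y))"
    using U V by (intro exI[of _ "U \<inter> V"] exI[of _ "\<lambda>x. (f' x, g' x)"]) auto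
qed

lemma smooth_on_compose:
  fixes f :: "'a::euclidean_space \<Rightarrow> 'b::euclidean_space" and g :: "'b \<Rightarrow> 'c::real_normed_vector"
  assumes "smooth_on S f" "smooth_on T g" "f ` S \<subseteq> T"
  shows "smooth_on S (\<lambda>x. g (f x))"
proof (rule smooth_onI)
  fix x assume x: "x \<in> S"
  obtain U f' where U: "open U" "x \<in> U" "\<And>k. Ck_open k U f'" "\<And>y. y \<in> S \<inter> U \<Longrightarrow> f' y = f y"
    using smooth_onE[OF assms(1) x] by blast
  have "f x \<in> T" using x assms(3) by auto
  then obtain V g' where V: "open V" "f x \<in> V" "\<And>k. Ck_open k V g'" "\<And>y. y \<in> T \<inter> V \<Longrightarrow> g' y = g y"
    using smooth_onE[OF assms(2)] by blast
  \<comment> \<open>The extension \<open>f'\<close> may leave the domain of \<open>g'\<close> away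
    from \<open>S\<close>, so the composite is formed on the part of \<open>U\<close> that
    \<open>f'\<close> maps into \<open>V\<close>.\<close>
  define W where "W = U \<inter> f' -` V"
  have "continuous_on U f'" using U(3)[of 0] unfolding Ck_open.simps .
  then have "open W" unfolding W_def using U(1) V(1) by (rule continuous_open_preimage)
  moreover have "x \<in> W" using x U V by (auto simp: W_def)
  moreover have "Ck_open k W (\<lambda>x. g' (f' x))" for k
    by (rule Ck_open_compose[OF \<open>open W\<close> V(1) _ Ck_open_subset[OF U(3)] V(3)]) (auto simp: W_def)
  moreover have "g' (f' y) = g (f y)" if "y \<in> S \<inter> W" for y
  proof -
    have "f' y = f y" "f' y \<in> V" "f y \<in> T" using that U(4) assms(3) by (auto simp: W_def)
    then show ?thesis using V(4)[of "f y"] by simp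
  qed
  ultimately show "\<exists>U h. open U \<and> x \<in> U \<and> (\<forall>k. Ck_open k U h) \<and> (\<forall>y\<in>S \<inter> U. h y = g (f y))"
    by (intro exI[of _ W] exI[of _ "\<lambda>x. g' (f' x)"]) auto
qed

lemma smooth_on_add:
  fixes f g :: "'a::euclidean_space \<Rightarrow> 'b::euclidean_space"
  assumes "smooth_on S f" "smooth_on S g"
  shows "smooth_on S (\<lambda>x. f x + g x)"
proof -
  have "bounded_linear (\<lambda>p::'b \<times> 'b. fst p + snd p)"
    by (intro bounded_linear_add bounded_linear_fst bounded_linear_snd)
  from smooth_on_compose[OF smooth_on_Pair[OF assms] smooth_on_bounded_linear[OF this] subset_UNIV]
  show ?thesis by simp
qed

text \<open>A single extension \<open>g\<close> supplies derivatives of \<open>f\<close> within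
  \<open>S\<close> at all nearby points of \<open>S\<close>, so these depend smoothly on the point.
  For general \<open>S\<close> they are not unique; in charts the shape of the quadrant makes them
  so.\<close>

lemma smooth_on_derivativeE:
  assumes "smooth_on S f" "x \<in> S"
  obtains U g where "open U" "x \<in> U" "\<And>k. Ck_open k U g" "\<And>y. y \<in> S \<inter> U \<Longrightarrow> g y = f y"
    "\<And>y. y \<in> U \<Longrightarrow> (g has_derivative frechet_derivative g (at y)) (at y)"
    "\<And>y. y \<in> S \<inter> U \<Longrightarrow> (f has_derivative frechet_derivative g (at y)) (at y within S)"
proof -
  obtain U g where U: "open U" "x \<in> U" "\<And>k. Ck_open k U g" "\<And>y. y \<in> S \<inter> U \<Longrightarrow> g y = f y"
    using smooth_onE[OF assms] by blast
  note g = Ck_open_SucD(1)[OF U(3)[of "Suc 0"]]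
  have f: "(f has_derivative frechet_derivative g (at y)) (at y within S)" if "y \<in> S \<inter> U" for y
  proof (rule has_derivative_transform_eventually)
    show "(g has_derivative frechet_derivative g (at y)) (at y within S)"
      by (rule has_derivative_at_withinI[OF g]) (use that in simp)
    show "\<forall>\<^sub>F z in at y within S. g z = f z"
      unfolding eventually_at_topological using U that by blast
    show "g y = f y" "y \<in> S" using U(4) that by auto
  qed
  show ?thesis by (rule that[OF U(1-3)]) (rule U(4) g f, assumption)+
qed

lemma smooth_on_imp_continuous_on:
  assumes "smooth_on S f"
  shows "continuous_on S f"
  unfolding continuous_on_eq_continuous_within
proof
  fix x assume x: "x \<in> S"
  obtain D where "(f has_derivative D) (at x within S)"
    by (rule smooth_on_derivativeE[OF assms x]) (use x in blast)
  then show "continuous (at x within S) f" by (rule has_derivative_continuous)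
qed

lemma has_derivative_within_cong:
  assumes "x \<in> S" "x \<in> U" "open U" "\<And>y. y \<in> S \<inter> U \<Longrightarrow> f y = g y"
  shows "(f has_derivative D) (at x within S) \<longleftrightarrow> (g has_derivative D) (at x within S)"
proof -
  have *: "(g has_derivative D) (at x within S)"
    if "(f has_derivative D) (at x within S)" "\<And>y. y \<in> S \<inter> U \<Longrightarrow> f y = g y" for f g
  proof (rule has_derivative_transform_eventually[OF that(1)])
    show "\<forall>\<^sub>F z in at x within S. f z = g z"
      unfolding eventually_at_topological using assms(2,3) that(2) by blast
  qed (use assms(1,2) that(2) in auto)
  show ?thesis using *[of f g] *[of g f] assms(4) by auto
qed

lemma frechet_derivative_within_cong:
  assumes "x \<in> S" "x \<in> U" "open U" "\<And>y. y \<in> S \<inter> U \<Longrightarrow> f y = g y"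
  shows "frechet_derivative f (at x within S) = frechet_derivative g (at x within S)"
proof -
  have "(f has_derivative D) (at x within S) \<longleftrightarrow> (g has_derivative D) (at x within S)" for D
    using assms by (rule has_derivative_within_cong)
  then show ?thesis by (simp add: frechet_derivative_def)
qed

text \<open>The mean value theorem is applied twice: to \<open>\<phi>\<close>, the increment in
  direction \<open>v\<close> as a function of the step in direction \<open>u\<close>, and then to
  the derivative in direction \<open>u\<close> along \<open>v\<close>. The second difference on the
  left is symmetric in \<open>u\<close> and \<open>v\<close>.\<close>

lemma mixed_difference_mean_value:
  fixes g :: "'a::real_normed_vector \<Rightarrow> real"
  assumes h: "0 < h"
    and sub: "\<And>s t. 0 \<le> s \<Longrightarrow> s \<le> h \<Longrightarrow> 0 \<le> t \<Longrightarrow> t \<le> h \<Longrightarrow> x + s *\<^sub>R u + t *\<^sub>R v \<in> U"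
    and g: "\<And>y. y \<in> U \<Longrightarrow> (g has_derivative D y) (at y)"
    and D: "\<And>y. y \<in> U \<Longrightarrow> ((\<lambda>y. D y u) has_derivative E y) (at y)"
  shows "\<exists>s t. 0 \<le> s \<and> s \<le> h \<and> 0 \<le> t \<and> t \<le> h \<and>
    g (x + h *\<^sub>R u + h *\<^sub>R v) - g (x + h *\<^sub>R u) - g (x + h *\<^sub>R v) + g x = h * h * E (x + s *\<^sub>R u + t *\<^sub>R v) v"
proof -
  have line: "((\<lambda>s. F (a + s *\<^sub>R w)) has_field_derivative L w) (at s)"
    if "(F has_derivative L) (at (a + s *\<^sub>R w))" for F :: "'a \<Rightarrow> real" and L a w s
  proof -
    have "((\<lambda>s. a + s *\<^sub>R w) has_derivative (\<lambda>r. r *\<^sub>R w)) (at s)"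
      by (auto intro!: derivative_eq_intros)
    from has_derivative_compose[OF this that]
    have "((\<lambda>s. F (a + s *\<^sub>R w)) has_derivative (\<lambda>r. L (r *\<^sub>R w))) (at s)" .
    moreover have "L (r *\<^sub>R w) = L w * r" for r
      using that by (simp add: has_derivative_bounded_linear bounded_linear.linear linear_scale mult.commute)
    ultimately show ?thesis by (simp add: has_field_derivative_def)
  qed
  define \<phi> where "\<phi> s = g (x + h *\<^sub>R v + s *\<^sub>R u) - g (x + s *\<^sub>R u)" for s
  have "(\<phi> has_field_derivative (D (x + h *\<^sub>R v + s *\<^sub>R u) u - D (x + s *\<^sub>R u) u)) (at s)"
    if "0 \<le> s" "s \<le> h" for s
    unfolding \<phi>_def using sub[OF that, of h] sub[OF that, of 0] h
    by (intro DERIV_diff line g) (auto simp: algebra_simps)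
  from MVT2[OF h this] obtain s where s: "0 < s" "s < h"
    "\<phi> h - \<phi> 0 = (h - 0) * (D (x + h *\<^sub>R v + s *\<^sub>R u) u - D (x + s *\<^sub>R u) u)" by auto
  have "((\<lambda>t. D (x + s *\<^sub>R u + t *\<^sub>R v) u) has_field_derivative E (x + s *\<^sub>R u + t *\<^sub>R v) v) (at t)"
    if "0 \<le> t" "t \<le> h" for t
    using sub[of s t] s that by (intro line[of "\<lambda>y. D y u"] D) auto
  from MVT2[OF h this] obtain t where t: "0 < t" "t < h"
    "D (x + s *\<^sub>R u + h *\<^sub>R v) u - D (x + s *\<^sub>R u + 0 *\<^sub>R v) u = (h - 0) * E (x + s *\<^sub>R u + t *\<^sub>R v) v" by auto
  have "\<phi> h - \<phi> 0 = h * h * E (x + s *\<^sub>R u + t *\<^sub>R v) v"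
    using s t by (simp add: algebra_simps)
  then show ?thesis
    using s t by (intro exI[of _ s] exI[of _ t]) (auto simp: \<phi>_def algebra_simps)
qed

text \<open>The second difference over a small parallelogram is \<open>h * h\<close> times a value
  of either mixed derivative at some point of it. By continuity both values tend to those at
  \<open>x\<close> as the parallelogram shrinks.\<close>

lemma second_derivative_symmetric:
  fixes g :: "'a::real_normed_vector \<Rightarrow> real"
  assumes U: "open U" "x \<in> U"
    and g: "\<And>y. y \<in> U \<Longrightarrow> (g has_derivative D y) (at y)"
    and Du: "\<And>y. y \<in> U \<Longrightarrow> ((\<lambda>y. D y u) has_derivative Eu y) (at y)"
    and Dv: "\<And>y. y \<in> U \<Longrightarrow> ((\<lambda>y. D y v) has_derivative Ev y) (at y)"
    and cont: "continuous_on U (\<lambda>y. Eu y v)" "continuous_on U (\<lambda>y. Ev y u)"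
  shows "Eu x v = Ev x u"
proof -
  \<comment> \<open>\<open>h * C\<close> bounds the distance from \<open>x\<close> to the points of
    the parallelogram with parameters up to \<open>h\<close>; the summand 1 makes the bound strict
    and \<open>C\<close> positive.\<close>
  define C where "C = norm u + norm v + 1"
  have C: "C > 0" unfolding C_def by (smt (verit) norm_ge_zero)
  have near: "dist (x + s *\<^sub>R u + t *\<^sub>R v) x < h * C"
    if "0 \<le> s" "s \<le> h" "0 \<le> t" "t \<le> h" "0 < h" for s t h
  proof -
    have "dist (x + s *\<^sub>R u + t *\<^sub>R v) x = norm (s *\<^sub>R u + t *\<^sub>R v)"
      by (simp add: dist_norm algebra_simps)
    also have "\<dots> \<le> s * norm u + t * norm v"
      using norm_triangle_ineq[of "s *\<^sub>R u" "t *\<^sub>R v"] that by simp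
    also have "\<dots> \<le> h * norm u + h * norm v"
      using that by (intro add_mono mult_right_mono) auto
    also have "\<dots> < h * C" using that by (simp add: C_def algebra_simps)
    finally show ?thesis .
  qed
  have "\<bar>Eu x v - Ev x u\<bar> < 2 * e" if e: "e > 0" for e
  proof -
    have "isCont (\<lambda>y. Eu y v) x" "isCont (\<lambda>y. Ev y u) x"
      using cont U by (simp_all add: continuous_on_eq_continuous_at)
    then obtain d1 d2 where d: "d1 > 0" "d2 > 0"
      "\<And>y. dist y x < d1 \<Longrightarrow> dist (Eu y v) (Eu x v) < e"
      "\<And>y. dist y x < d2 \<Longrightarrow> dist (Ev y u) (Ev x u) < e"
      using e unfolding continuous_at_eps_delta by blast
    obtain r where r: "r > 0" "ball x r \<subseteq> U" using U openE by blast
    \<comment> \<open>The choice makes \<open>h * C\<close> the least of the three radii: the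
      parallelogram lies in \<open>U\<close> and in both continuity neighbourhoods.\<close>
    define h where "h = min (min d1 d2) r / C"
    have h: "h > 0" "h * C \<le> d1" "h * C \<le> d2" "h * C \<le> r" using C d r by (auto simp: h_def)
    have inU: "x + s *\<^sub>R u + t *\<^sub>R v \<in> U" if "0 \<le> s" "s \<le> h" "0 \<le> t" "t \<le> h" for s t
      using near[OF that h(1)] h(4) r by (auto simp: dist_commute subset_eq)
    from mixed_difference_mean_value[OF h(1) inU g Du] obtain s t where st:
      "0 \<le> s" "s \<le> h" "0 \<le> t" "t \<le> h"
      "g (x + h *\<^sub>R u + h *\<^sub>R v) - g (x + h *\<^sub>R u) - g (x + h *\<^sub>R v) + g x = h * h * Eu (x + s *\<^sub>R u + t *\<^sub>R v) v"
      by blast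
    have inU': "x + s *\<^sub>R v + t *\<^sub>R u \<in> U" if "0 \<le> s" "s \<le> h" "0 \<le> t" "t \<le> h" for s t
      using inU[of t s] that by (simp add: algebra_simps)
    from mixed_difference_mean_value[OF h(1) inU' g Dv] obtain s' t' where st':
      "0 \<le> s'" "s' \<le> h" "0 \<le> t'" "t' \<le> h"
      "g (x + h *\<^sub>R v + h *\<^sub>R u) - g (x + h *\<^sub>R v) - g (x + h *\<^sub>R u) + g x = h * h * Ev (x + s' *\<^sub>R v + t' *\<^sub>R u) u"
      by blast
    have "h * h * Eu (x + s *\<^sub>R u + t *\<^sub>R v) v = h * h * Ev (x + t' *\<^sub>R u + s' *\<^sub>R v) u"
      using st(5) st'(5) by (simp add: algebra_simps)
    then have "Eu (x + s *\<^sub>R u + t *\<^sub>R v) v = Ev (x + t' *\<^sub>R u + s' *\<^sub>R v) u" using h(1) by simp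
    moreover have "dist (Eu (x + s *\<^sub>R u + t *\<^sub>R v) v) (Eu x v) < e"
      using near[of s h t] st h by (intro d(3)) auto
    moreover have "dist (Ev (x + t' *\<^sub>R u + s' *\<^sub>R v) u) (Ev x u) < e"
      using near[of t' h s'] st' h by (intro d(4)) auto
    ultimately show ?thesis by (simp add: dist_real_def)
  qed
  \<comment> \<open>With half the gap for \<open>e\<close>, the estimate says that the gap is less
    than itself unless it is zero.\<close>
  from this[of "\<bar>Eu x v - Ev x u\<bar> / 2"] show ?thesis by force
qed

section \<open>Charts and forms on manifolds with corners\<close>

text \<open>This is the accumulation condition under which derivatives within a set are unique. A
  positive step never leaves the quadrant, so points on the faces are no exception.\<close>

lemma quadrant_line_in:
  assumes "openin (top_of_set quadrant) A" "x \<in> A" "b \<in> Basis" "e > 0"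
  shows "\<exists>d. 0 < \<bar>d\<bar> \<and> \<bar>d\<bar> < e \<and> x + d *\<^sub>R b \<in> A"
proof -
  obtain T where T: "open T" "A = quadrant \<inter> T" using assms(1) by (auto simp: openin_open)
  then obtain r where r: "r > 0" "ball x r \<subseteq> T" using assms(2) by (meson Int_iff openE)
  define d where "d = min e r / 2"
  have d: "0 < d" "d < e" "d < r" using assms(4) r by (auto simp: d_def)
  have "x + d *\<^sub>R b \<in> T" using r d assms(3) by (auto simp: dist_norm subset_eq)
  moreover have "x + d *\<^sub>R b \<in> quadrant"
    using assms(2,3) T(2) d by (auto simp: quadrant_def inner_add_left inner_Basis)
  ultimately show ?thesis using d T(2) by (intro exI[of _ d]) auto
qed

lemma quadrant_derivative_unique:
  assumes "openin (top_of_set quadrant) A" "x \<in> A"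
    and "(f has_derivative D) (at x within A)" "(f has_derivative E) (at x within A)"
  shows "D = E"
  by (rule frechet_derivative_unique_within[OF assms(3,4)]) (rule quadrant_line_in[OF assms(1,2)])

lemma quadrant_frechet_derivative:
  assumes "openin (top_of_set quadrant) A" "x \<in> A" "(f has_derivative D) (at x within A)"
  shows "frechet_derivative f (at x within A) = D"
proof -
  have "f differentiable (at x within A)" using assms(3) by (rule differentiableI)
  then have "(f has_derivative frechet_derivative f (at x within A)) (at x within A)"
    by (simp only: frechet_derivative_works)
  from quadrant_derivative_unique[OF assms(1,2) this assms(3)] show ?thesis .
qed

text \<open>Adding a small positive multiple of \<open>One\<close> makes every coordinate positive,
  so \<open>x\<close> is a limit of points of \<open>A\<close> off all faces.\<close>

lemma quadrant_dense_interior_eq: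
  fixes f g :: "'e::euclidean_space \<Rightarrow> real"
  assumes A: "openin (top_of_set quadrant) A" "x \<in> A"
    and cont: "continuous_on A f" "continuous_on A g"
    and eq: "\<And>y. y \<in> A \<Longrightarrow> (\<forall>b\<in>Basis. y \<bullet> b \<noteq> 0) \<Longrightarrow> f y = g y"
  shows "f x = g x"
proof -
  obtain T where T: "open T" "A = quadrant \<inter> T" using A(1) by (auto simp: openin_open)
  define y where "y n = x + (1 / real (Suc n)) *\<^sub>R One" for n
  have lim: "y \<longlonglongrightarrow> x"
  proof -
    have "(\<lambda>n. x + (1 / real (Suc n)) *\<^sub>R One) \<longlonglongrightarrow> x + 0 *\<^sub>R One"
      by (intro tendsto_intros LIMSEQ_Suc[OF lim_1_over_n])
    then show ?thesis by (simp add: y_def[abs_def])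
  qed
  have yb: "y n \<bullet> b > 0" if "b \<in> Basis" for n b
  proof -
    have "x \<bullet> b \<ge> 0" using A T that by (auto simp: quadrant_def)
    then show ?thesis using that by (simp add: y_def inner_add_left add_nonneg_pos)
  qed
  have ev: "\<forall>\<^sub>F n in sequentially. y n \<in> A"
    using topological_tendstoD[OF lim T(1)] A T yb
    by (auto simp: quadrant_def less_imp_le elim!: eventually_mono)
  note lims = continuous_on_tendsto_compose[OF cont(1) lim A(2) ev] continuous_on_tendsto_compose[OF cont(2) lim A(2) ev]
  have "\<forall>\<^sub>F n in sequentially. f (y n) = g (y n)"
  proof (rule eventually_mono[OF ev])
    show "f (y n) = g (y n)" if "y n \<in> A" for n
      by (rule eq[OF that]) (metis less_irrefl yb)
  qed
  with lims(1) have "(\<lambda>n. g (y n)) \<longlonglongrightarrow> f x" by (rule Lim_transform_eventually)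
  then show ?thesis using lims(2) by (rule LIMSEQ_unique)
qed

lemma charts_atI: "c \<in> atlas M \<Longrightarrow> p \<in> fst c \<Longrightarrow> c \<in> charts_at M p"
  by (auto simp: charts_at_def)

lemma cimage_UNIV: "cimage c UNIV = snd c ` fst c"
  by (simp add: cimage_def)

lemma cimage_subset: "cimage c S \<subseteq> cimage c UNIV"
  by (auto simp: cimage_def)

lemma cimageI: "p \<in> fst c \<Longrightarrow> p \<in> S \<Longrightarrow> snd c p \<in> cimage c S"
  by (auto simp: cimage_def)

section \<open>The topology of a manifold with corners, seen in its charts\<close>

locale corner_manifold =
  fixes M :: "('a, 'e::euclidean_space) cmfd"
  assumes manifold: "manifold_with_corners M"
begin

lemma atlas_chart: "c \<in> atlas M \<Longrightarrow> is_chart (mtop M) c"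
  using manifold by (auto simp: manifold_with_corners_def)

lemma atlas_compatible: "c \<in> atlas M \<Longrightarrow> c' \<in> atlas M \<Longrightarrow> compatible c c'"
  using manifold unfolding manifold_with_corners_def by blast

lemma atlas_maximal: "is_chart (mtop M) c \<Longrightarrow> (\<And>c'. c' \<in> atlas M \<Longrightarrow> compatible c c') \<Longrightarrow> c \<in> atlas M"
  using manifold unfolding manifold_with_corners_def by blast

lemma Hausdorff: "Hausdorff_space (mtop M)"
  using manifold by (auto simp: manifold_with_corners_def)

lemma topspace_atlas: "topspace (mtop M) = \<Union> (fst ` atlas M)"
  using manifold by (auto simp: manifold_with_corners_def)

lemma open_domain: "c \<in> atlas M \<Longrightarrow> openin (mtop M) (fst c)"
  using atlas_chart by (auto simp: is_chart_def)

lemma domain_subset: "c \<in> atlas M \<Longrightarrow> fst c \<subseteq> topspace (mtop M)"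
  using open_domain openin_subset by blast

lemma chart_obtain:
  assumes "p \<in> topspace (mtop M)"
  obtains c where "c \<in> charts_at M p" "c \<in> atlas M" "p \<in> fst c"
  using assms topspace_atlas by (auto simp: charts_at_def)

lemma open_cimage: "c \<in> atlas M \<Longrightarrow> openin (top_of_set quadrant) (cimage c UNIV)"
  using atlas_chart by (auto simp: is_chart_def)

lemma homeo_chart:
  "c \<in> atlas M \<Longrightarrow> homeomorphic_map (subtopology (mtop M) (fst c)) (top_of_set (cimage c UNIV)) (snd c)"
  using atlas_chart by (auto simp: is_chart_def)

lemma inj_chart:
  assumes "c \<in> atlas M"
  shows "inj_on (snd c) (fst c)"
  using homeomorphic_imp_injective_map[OF homeo_chart[OF assms]] domain_subset[OF assms]
  by (simp add: Int_absorb1)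

lemma pt_snd: "c \<in> atlas M \<Longrightarrow> p \<in> fst c \<Longrightarrow> pt c (snd c p) = p"
  using inj_chart by (simp add: pt_def)

lemma pt_in: "x \<in> cimage c UNIV \<Longrightarrow> pt c x \<in> fst c"
  and snd_pt: "x \<in> cimage c UNIV \<Longrightarrow> snd c (pt c x) = x"
  unfolding cimage_UNIV pt_def by (auto intro: inv_into_into f_inv_into_f)

lemma cimage_iff: "c \<in> atlas M \<Longrightarrow> x \<in> cimage c S \<longleftrightarrow> x \<in> cimage c UNIV \<and> pt c x \<in> S"
  using pt_snd[of c] by (force simp: cimage_def)

lemma continuous_pt:
  assumes "c \<in> atlas M"
  shows "continuous_map (top_of_set (cimage c UNIV)) (subtopology (mtop M) (fst c)) (pt c)"
proof -
  obtain g where g: "homeomorphic_maps (subtopology (mtop M) (fst c)) (top_of_set (cimage c UNIV)) (snd c) g"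
    using homeo_chart[OF assms] homeomorphic_map_maps by blast
  then have "continuous_map (top_of_set (cimage c UNIV)) (subtopology (mtop M) (fst c)) g"
    by (simp add: homeomorphic_maps_def)
  moreover have "g x = pt c x" if "x \<in> topspace (top_of_set (cimage c UNIV))" for x
  proof -
    have "x \<in> cimage c UNIV" using that by simp
    moreover have "g (snd c p) = p" if "p \<in> fst c" for p
      using g that domain_subset[OF assms] unfolding homeomorphic_maps_def by auto
    ultimately show ?thesis using pt_in[of x c] snd_pt[of x c] by metis
  qed
  ultimately show ?thesis by (rule continuous_map_eq)
qed

lemma open_cimage_openin:
  assumes "c \<in> atlas M" "openin (mtop M) W"
  shows "openin (top_of_set (cimage c UNIV)) (cimage c W)"
proof -
  have "openin (top_of_set (cimage c UNIV)) {x \<in> topspace (top_of_set (cimage c UNIV)). pt c x \<in> fst c \<inter> W}"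
    by (rule openin_continuous_map_preimage[OF continuous_pt[OF assms(1)]])
      (use assms(2) in \<open>auto simp: openin_subtopology\<close>)
  moreover have "{x \<in> topspace (top_of_set (cimage c UNIV)). pt c x \<in> fst c \<inter> W} = cimage c W"
    using cimage_iff[OF assms(1), of _ W] pt_in[of _ c] by auto
  ultimately show ?thesis by simp
qed

text \<open>Turns an open set around \<open>p\<close> in the manifold into an open set of
  coordinates, which is the form of locality that derivatives within the chart image
  require.\<close>

lemma open_cimage_nbhd:
  assumes "c \<in> atlas M" "openin (mtop M) W" "p \<in> fst c" "p \<in> W"
  obtains U where "open U" "snd c p \<in> U" "\<And>x. x \<in> cimage c UNIV \<Longrightarrow> x \<in> U \<Longrightarrow> pt c x \<in> W"
proof -
  obtain U where U: "open U" "cimage c W = cimage c UNIV \<inter> U"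
    using open_cimage_openin[OF assms(1,2)] by (auto simp: openin_open)
  have "snd c p \<in> U" using U(2) cimageI[OF assms(3,4)] by auto
  moreover have "pt c x \<in> W" if "x \<in> cimage c UNIV" "x \<in> U" for x
    using U(2) that cimage_iff[OF assms(1), of x W] by auto
  ultimately show ?thesis by (rule that[OF U(1)])
qed

section \<open>Exact forms in charts\<close>

lemma dchart_eqI:
  assumes "c \<in> atlas M" "x \<in> cimage c UNIV" "(g has_derivative D) (at x within cimage c UNIV)"
  shows "dchart c g x = D"
  unfolding dchart_def using quadrant_frechet_derivative[OF open_cimage[OF assms(1)] assms(2,3)] .

text \<open>One extension \<open>g\<close> covers all chart points in \<open>U\<close>. Derivatives
  within the quadrant are unique, so \<open>df\<close> is the ordinary derivative of
  \<open>g\<close> there, faces included; questions about \<open>df\<close> become questions about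
  \<open>g\<close> on an open set.\<close>

lemma dfun_extension:
  assumes "smooth_fun M f" "c \<in> atlas M" "x \<in> cimage c UNIV"
  obtains U g where "open U" "x \<in> U" "\<And>k. Ck_open k U g"
    "\<And>y. y \<in> cimage c UNIV \<inter> U \<Longrightarrow> dfun f c y = frechet_derivative g (at y)"
proof -
  have sm: "smooth_on (cimage c UNIV) (f \<circ> pt c)" using assms by (auto simp: smooth_fun_def)
  obtain U g where U: "open U" "x \<in> U" "\<And>k. Ck_open k U g"
    and "\<And>y. y \<in> cimage c UNIV \<inter> U \<Longrightarrow> g y = (f \<circ> pt c) y"
    and "\<And>y. y \<in> U \<Longrightarrow> (g has_derivative frechet_derivative g (at y)) (at y)"
    and d: "\<And>y. y \<in> cimage c UNIV \<inter> U \<Longrightarrow>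
      ((f \<circ> pt c) has_derivative frechet_derivative g (at y)) (at y within cimage c UNIV)"
    by (rule smooth_on_derivativeE[OF sm assms(3)]) blast
  have "dfun f c y = frechet_derivative g (at y)" if "y \<in> cimage c UNIV \<inter> U" for y
    using dchart_eqI[OF assms(2) _ d[OF that]] that by (simp add: dfun_def)
  with U show ?thesis by (rule that)
qed

lemma smooth_dfun:
  assumes "smooth_fun M f" "c \<in> atlas M"
  shows "smooth_on (cimage c UNIV) (\<lambda>x. dfun f c x v)"
proof (rule smooth_on_local)
  fix x assume x: "x \<in> cimage c UNIV"
  obtain U g where U: "open U" "x \<in> U" "\<And>k. Ck_open k U g"
    "\<And>y. y \<in> cimage c UNIV \<inter> U \<Longrightarrow> dfun f c y = frechet_derivative g (at y)"
    by (rule dfun_extension[OF assms x]) blast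
  have "smooth_on U (\<lambda>y. frechet_derivative g (at y) v)"
    by (rule Ck_open_imp_smooth_on[OF U(1) subset_refl Ck_open_SucD(2)[OF U(3)]])
  then have "smooth_on (cimage c UNIV \<inter> U) (\<lambda>y. frechet_derivative g (at y) v)"
    by (rule smooth_on_subset) simp
  moreover have "smooth_on (cimage c UNIV \<inter> U) (\<lambda>y. dfun f c y v)
      \<longleftrightarrow> smooth_on (cimage c UNIV \<inter> U) (\<lambda>y. frechet_derivative g (at y) v)"
    by (rule smooth_on_cong) (simp add: U(4))
  ultimately show "\<exists>U. open U \<and> x \<in> U \<and> smooth_on (cimage c UNIV \<inter> U) (\<lambda>x. dfun f c x v)"
    using U(1,2) by blast
qed

text \<open>Both terms of the exterior derivative are mixed second derivatives of one smooth
  extension of the coordinate expression of \<open>f\<close>, and these commute. Since the extension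
  is defined on an open set, points on the faces are covered.\<close>

lemma dform_dfun:
  assumes "smooth_fun M f" "c \<in> atlas M" "x \<in> cimage c UNIV"
  shows "dform (dfun f) c x u v = 0"
proof -
  obtain U g where U: "open U" "x \<in> U" "\<And>k. Ck_open k U g"
    "\<And>y. y \<in> cimage c UNIV \<inter> U \<Longrightarrow> dfun f c y = frechet_derivative g (at y)"
    by (rule dfun_extension[OF assms]) blast
  let ?E = "\<lambda>w y. frechet_derivative (\<lambda>z. frechet_derivative g (at z) w) (at y)"
  have Ck: "Ck_open k U (\<lambda>z. frechet_derivative g (at z) w)" for k w
    by (rule Ck_open_SucD(2)[OF U(3)])
  have E: "((\<lambda>z. frechet_derivative g (at z) w) has_derivative ?E w y) (at y)" if "y \<in> U" for w y
    by (rule Ck_open_SucD(1)[OF Ck that])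
  have cont: "continuous_on U (\<lambda>y. ?E w y w')" for w w'
    using Ck_open_SucD(2)[OF Ck, of 0] by (simp only: Ck_open.simps)
  have "dchart c (\<lambda>y. dfun f c y w) x = ?E w x" for w
  proof -
    have "((\<lambda>z. frechet_derivative g (at z) w) has_derivative ?E w x) (at x within cimage c UNIV)"
      by (rule has_derivative_at_withinI[OF E[OF U(2)]])
    then have "((\<lambda>y. dfun f c y w) has_derivative ?E w x) (at x within cimage c UNIV)"
      by (rule has_derivative_within_cong[OF assms(3) U(2,1), THEN iffD1, rotated]) (simp add: U(4))
    then show ?thesis by (rule dchart_eqI[OF assms(2,3)])
  qed
  then show ?thesis
    using second_derivative_symmetric[OF U(1,2) Ck_open_SucD(1)[OF U(3)] E E cont cont, of u v]
    by (simp add: dform_def)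
qed

lemma smooth_form:
  "one_form M \<theta> \<Longrightarrow> c \<in> atlas M \<Longrightarrow> smooth_on (cimage c UNIV) (\<lambda>x. \<theta> c x v)"
  by (simp add: one_form_def)

lemma dform_cong:
  assumes "c \<in> atlas M" "x \<in> cimage c UNIV" "\<And>y. y \<in> cimage c UNIV \<Longrightarrow> \<mu> c y = \<theta> c y"
  shows "dform \<mu> c x = dform \<theta> c x"
proof -
  have "frechet_derivative (\<lambda>y. \<mu> c y w) (at x within cimage c UNIV) =
      frechet_derivative (\<lambda>y. \<theta> c y w) (at x within cimage c UNIV)" for w
    by (rule frechet_derivative_within_cong[OF assms(2) UNIV_I open_UNIV]) (simp add: assms(3))
  then show ?thesis by (simp add: dform_def[abs_def] dchart_def)
qed

lemma dform_plus_dfun: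
  assumes "one_form M \<theta>" "smooth_fun M f" "c \<in> atlas M" "x \<in> cimage c UNIV"
  shows "dform (form_plus \<theta> (dfun f)) c x = dform \<theta> c x"
proof (intro ext)
  fix u v
  have "dchart c (\<lambda>y. \<theta> c y w + dfun f c y w) x w'
      = dchart c (\<lambda>y. \<theta> c y w) x w' + dchart c (\<lambda>y. dfun f c y w) x w'" for w w'
  proof -
    obtain D where D: "((\<lambda>y. \<theta> c y w) has_derivative D) (at x within cimage c UNIV)"
      by (rule smooth_on_derivativeE[OF smooth_form[OF assms(1,3)] assms(4)]) (use assms(4) in blast)
    obtain E where E: "((\<lambda>y. dfun f c y w) has_derivative E) (at x within cimage c UNIV)"
      by (rule smooth_on_derivativeE[OF smooth_dfun[OF assms(2,3)] assms(4)]) (use assms(4) in blast)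
    show ?thesis
      using dchart_eqI[OF assms(3,4) D] dchart_eqI[OF assms(3,4) E]
        dchart_eqI[OF assms(3,4) has_derivative_add[OF D E]] by simp
  qed
  then show "dform (form_plus \<theta> (dfun f)) c x u v = dform \<theta> c x u v"
    using dform_dfun[OF assms(2-4), of u v] by (simp add: dform_def form_plus_def)
qed

end

section \<open>Transport by a permutation of the atlas\<close>

definition push :: "('a \<Rightarrow> 'a) \<Rightarrow> ('a, 'e) chart \<Rightarrow> ('a, 'e) chart" where
  "push \<psi> c = (\<psi> ` fst c, snd c \<circ> inv \<psi>)"

lemma push_inv:
  assumes "bij \<psi>"
  shows "push (inv \<psi>) (push \<psi> c) = c" "push \<psi> (push (inv \<psi>) c) = c"
proof -
  have "inv \<psi> ` \<psi> ` A = A" "\<psi> ` inv \<psi> ` A = A" for A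
    using assms by (simp_all add: image_comp bij_is_inj bij_is_surj surj_iff[THEN iffD1])
  moreover have "(f \<circ> inv \<psi>) \<circ> inv (inv \<psi>) = f" "(f \<circ> inv (inv \<psi>)) \<circ> inv \<psi> = f" for f :: "'a \<Rightarrow> 'b"
    using assms by (simp_all add: inv_inv_eq comp_assoc bij_is_inj bij_is_surj surj_iff[THEN iffD1])
  ultimately show "push (inv \<psi>) (push \<psi> c) = c" "push \<psi> (push (inv \<psi>) c) = c"
    by (simp_all add: push_def prod_eq_iff)
qed

text \<open>Requiring both \<open>\<psi>\<close> and its inverse to preserve the atlas makes
  \<open>push \<psi>\<close> a permutation of it. The hypotheses are symmetric, so every lemma is
  available for \<open>inv \<psi>\<close> as well, through \<open>inverse\<close>.\<close>

locale atlas_auto = corner_manifold M for M :: "('a, 'e::euclidean_space) cmfd" +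
  fixes \<psi> :: "'a \<Rightarrow> 'a"
  assumes bij: "bij \<psi>"
    and homeo: "homeomorphic_map (mtop M) (mtop M) \<psi>"
    and push_atlas: "c \<in> atlas M \<Longrightarrow> push \<psi> c \<in> atlas M"
    and push_inv_atlas: "c \<in> atlas M \<Longrightarrow> push (inv \<psi>) c \<in> atlas M"
begin

abbreviation "P \<equiv> push \<psi>"
abbreviation "Q \<equiv> push (inv \<psi>)"

lemma inv_simps [simp]: "inv \<psi> (\<psi> p) = p" "\<psi> (inv \<psi> p) = p" "\<psi> p = \<psi> q \<longleftrightarrow> p = q"
  "\<psi> p \<in> \<psi> ` A \<longleftrightarrow> p \<in> A" "inv \<psi> ` \<psi> ` A = A" "\<psi> ` inv \<psi> ` A = A"
  using bij by (auto simp: bij_is_inj bij_is_surj surj_f_inv_f inj_eq inj_image_mem_iff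
      image_comp surj_iff[THEN iffD1])

lemma push_simps [simp]: "Q (P c) = c" "P (Q c) = c" "fst (P c) = \<psi> ` fst c" "snd (P c) (\<psi> p) = snd c p"
  using push_inv[OF bij] by (simp_all add: push_def)

lemma snd_push_comp [simp]: "snd (P c) \<circ> (\<psi> \<circ> \<gamma>) = snd c \<circ> \<gamma>"
  by (simp add: fun_eq_iff)

lemma image_eq_vimage: "\<psi> ` A = inv \<psi> -` A"
  using bij by (simp add: bij_vimage_eq_inv_image bij_imp_bij_inv inv_inv_eq)

text \<open>Every chart is a pushed chart. Transport proofs reindex quantified charts in this way
  and then use that corresponding points have the same coordinates in corresponding charts.\<close>

lemma all_push: "(\<forall>c. R c) \<longleftrightarrow> (\<forall>c. R (P c))"
  by (metis push_simps(2))

lemma ex_push: "(\<exists>c. R c) \<longleftrightarrow> (\<exists>c. R (P c))"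
  by (metis push_simps(2))

lemma atlas_push [simp]: "P c \<in> atlas M \<longleftrightarrow> c \<in> atlas M"
  using push_atlas push_inv_atlas push_simps(1) by metis

lemma charts_at_push [simp]: "P c \<in> charts_at M (\<psi> p) \<longleftrightarrow> c \<in> charts_at M p"
  by (simp add: charts_at_def)

lemma ball_atlas: "(\<forall>c\<in>atlas M. R c) \<longleftrightarrow> (\<forall>c\<in>atlas M. R (P c))"
  unfolding Ball_def by (subst all_push) simp

lemma ball_charts: "(\<forall>c\<in>charts_at M (\<psi> p). R c) \<longleftrightarrow> (\<forall>c\<in>charts_at M p. R (P c))"
  unfolding Ball_def by (subst all_push) simp

lemma bex_charts: "(\<exists>c\<in>charts_at M (\<psi> p). R c) \<longleftrightarrow> (\<exists>c\<in>charts_at M p. R (P c))"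
  unfolding Bex_def by (subst ex_push) simp

lemma inverse: "atlas_auto M (inv \<psi>)"
proof -
  obtain g where g: "homeomorphic_maps (mtop M) (mtop M) \<psi> g"
    using homeo homeomorphic_map_maps by blast
  have "inv \<psi> p = g p" if "p \<in> topspace (mtop M)" for p
    using g that bij by (metis homeomorphic_maps_def inv_simps(1))
  then have "homeomorphic_map (mtop M) (mtop M) (inv \<psi>)"
    using homeomorphic_map_eq[of "mtop M" "mtop M" g "inv \<psi>"] g by (simp add: homeomorphic_maps_map)
  then show ?thesis
    using bij push_atlas push_inv_atlas
    by unfold_locales (simp_all add: bij_imp_bij_inv inv_inv_eq)
qed

lemma topspace_image [simp]: "\<psi> ` topspace (mtop M) = topspace (mtop M)"
  using homeomorphic_imp_surjective_map[OF homeo] .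

lemma topspace_iff [simp]: "\<psi> p \<in> topspace (mtop M) \<longleftrightarrow> p \<in> topspace (mtop M)"
  by (metis inv_simps(4) topspace_image)

lemma topspace_image_subset [simp]: "\<psi> ` A \<subseteq> topspace (mtop M) \<longleftrightarrow> A \<subseteq> topspace (mtop M)"
  by auto

lemma openin_image [simp]: "openin (mtop M) (\<psi> ` U) \<longleftrightarrow> openin (mtop M) U"
  using homeomorphic_map_openness_eq[OF homeo] openin_subset topspace_image_subset by metis

lemma closedin_image [simp]: "closedin (mtop M) (\<psi> ` U) \<longleftrightarrow> closedin (mtop M) U"
  using homeomorphic_map_closedness_eq[OF homeo] closedin_subset topspace_image_subset by metis

lemma compactin_image [simp]: "compactin (mtop M) (\<psi> ` U) \<longleftrightarrow> compactin (mtop M) U"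
  using homeomorphic_map_compactness_eq[OF homeo] compactin_subset_topspace topspace_image_subset by metis

lemma homeo_sub: "homeomorphic_map (subtopology (mtop M) S) (subtopology (mtop M) (\<psi> ` S)) \<psi>"
  by (rule homeomorphic_map_subtopologies_alt[OF homeo]) simp

lemma continuous_sub: "continuous_map (subtopology (mtop M) S) (subtopology (mtop M) (\<psi> ` S)) \<psi>"
  using homeo_sub by (rule homeomorphic_imp_continuous_map)

lemma openin_sub_image [simp]:
  "openin (subtopology (mtop M) (\<psi> ` S)) (\<psi> ` U) \<longleftrightarrow> openin (subtopology (mtop M) S) U"
proof
  assume o: "openin (subtopology (mtop M) (\<psi> ` S)) (\<psi> ` U)"
  then have "\<psi> ` U \<subseteq> topspace (subtopology (mtop M) (\<psi> ` S))" by (rule openin_subset)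
  then have "U \<subseteq> topspace (subtopology (mtop M) S)" by auto
  with o show "openin (subtopology (mtop M) S) U"
    using homeomorphic_map_openness_eq[OF homeo_sub] by blast
next
  assume "openin (subtopology (mtop M) S) U"
  then show "openin (subtopology (mtop M) (\<psi> ` S)) (\<psi> ` U)"
    using homeomorphic_map_openness_eq[OF homeo_sub] by blast
qed

lemma cimage_push [simp]: "cimage (P c) (\<psi> ` S) = cimage c S" "cimage (P c) UNIV = cimage c UNIV"
proof -
  have *: "cimage (P c) (\<psi> ` S) = cimage c S" for S
  proof -
    have "fst (P c) \<inter> \<psi> ` S = \<psi> ` (fst c \<inter> S)" by auto
    then have "cimage (P c) (\<psi> ` S) = snd (P c) ` \<psi> ` (fst c \<inter> S)" by (simp only: cimage_def)
    then show ?thesis by (simp add: image_image cimage_def)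
  qed
  have "\<psi> ` UNIV = UNIV" using bij by (simp add: bij_is_surj)
  with *[of S] *[of UNIV] show "cimage (P c) (\<psi> ` S) = cimage c S" "cimage (P c) UNIV = cimage c UNIV"
    by simp_all
qed

lemma pt_push:
  assumes "c \<in> atlas M" "x \<in> cimage c UNIV"
  shows "pt (P c) x = \<psi> (pt c x)"
proof -
  have "pt (P c) (snd (P c) (\<psi> (pt c x))) = \<psi> (pt c x)"
    using assms pt_in[of x c] by (intro pt_snd) auto
  then show ?thesis using snd_pt[OF assms(2)] by simp
qed

section \<open>Submanifolds, tangent spaces and corners under transport\<close>

lemma local_model_push [simp]: "local_model M (\<psi> ` Y) (\<psi> p) (P c) B C \<longleftrightarrow> local_model M Y p c B C"
  by (simp add: local_model_def)

text \<open>The predicate \<open>R\<close> stands for the conditions on the model in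
  \<open>submanifold\<close>, \<open>sub_boundary\<close> and \<open>meets_boundary\<close>, so that
  one reindexing settles all three.\<close>

lemma ex_local_model: "(\<exists>c B C. local_model M (\<psi> ` Y) (\<psi> p) c B C \<and> R B C (snd c (\<psi> p))) \<longleftrightarrow>
    (\<exists>c B C. local_model M Y p c B C \<and> R B C (snd c p))"
  by (subst ex_push) simp

lemma set_eq_imageI:
  assumes "\<And>p. \<psi> p \<in> A \<longleftrightarrow> p \<in> B"
  shows "A = \<psi> ` B"
  using assms[of "inv \<psi> _"] by (auto simp: image_eq_vimage)

lemma submanifold_push: "submanifold M k Y \<Longrightarrow> submanifold M k (\<psi> ` Y)"
  using ex_local_model[of Y _ "\<lambda>B C x. card B = k"] by (simp add: submanifold_def conj_commute)

lemma sub_boundary_push: "sub_boundary M (\<psi> ` Y) = \<psi> ` sub_boundary M Y"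
proof (rule set_eq_imageI)
  show "\<psi> p \<in> sub_boundary M (\<psi> ` Y) \<longleftrightarrow> p \<in> sub_boundary M Y" for p
    using ex_local_model[of Y p "\<lambda>B C x. C \<noteq> {} \<or> (\<exists>b\<in>Basis - B. x \<bullet> b = 0)"]
    unfolding sub_boundary_def mem_Collect_eq inv_simps by (simp only:)
qed

lemma meets_boundary_push: "meets_boundary M (\<psi> ` Y) = \<psi> ` meets_boundary M Y"
proof (rule set_eq_imageI)
  show "\<psi> p \<in> meets_boundary M (\<psi> ` Y) \<longleftrightarrow> p \<in> meets_boundary M Y" for p
    using ex_local_model[of Y p "\<lambda>B C x. \<exists>b\<in>Basis - B. x \<bullet> b = 0"]
    unfolding meets_boundary_def mem_Collect_eq inv_simps by (simp only:)
qed

lemma proper_hypersurface_push: "proper_hypersurface M H \<Longrightarrow> proper_hypersurface M (\<psi> ` H)"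
  using submanifold_push by (simp add: proper_hypersurface_def sub_boundary_push meets_boundary_push)

text \<open>Composition with \<open>\<psi>\<close> or its inverse matches curves through
  \<open>p\<close> with curves through \<open>\<psi> p\<close>. In corresponding charts matched
  curves have the same coordinates, hence the same velocities.\<close>

lemma tspace_push [simp]: "tspace (\<psi> ` Y) (P c) (\<psi> p) = tspace Y c p"
proof -
  have "(\<exists>\<gamma>::real \<Rightarrow> 'a. \<gamma> 0 = \<psi> p \<and> \<gamma> ` {0..1} \<subseteq> \<psi> ` Y \<inter> fst (P c) \<and>
      ((snd (P c) \<circ> \<gamma>) has_vector_derivative v) (at 0 within {0..1})) \<longleftrightarrow>
    (\<exists>\<gamma>::real \<Rightarrow> 'a. \<gamma> 0 = p \<and> \<gamma> ` {0..1} \<subseteq> Y \<inter> fst c \<and>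
      ((snd c \<circ> \<gamma>) has_vector_derivative v) (at 0 within {0..1}))" (is "?L \<longleftrightarrow> ?R") for v
  proof
    assume ?L
    then obtain \<gamma> :: "real \<Rightarrow> 'a" where \<gamma>: "\<gamma> 0 = \<psi> p" "\<gamma> ` {0..1} \<subseteq> \<psi> ` Y \<inter> fst (P c)"
      "((snd (P c) \<circ> \<gamma>) has_vector_derivative v) (at 0 within {0..1})" by blast
    have "snd c \<circ> (inv \<psi> \<circ> \<gamma>) = snd (P c) \<circ> \<gamma>" by (simp add: push_def comp_assoc)
    then show ?R using \<gamma> by (intro exI[of _ "inv \<psi> \<circ> \<gamma>"]) auto
  next
    assume ?R
    then obtain \<gamma> :: "real \<Rightarrow> 'a" where \<gamma>: "\<gamma> 0 = p" "\<gamma> ` {0..1} \<subseteq> Y \<inter> fst c"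
      "((snd c \<circ> \<gamma>) has_vector_derivative v) (at 0 within {0..1})" by blast
    then show ?L by (intro exI[of _ "\<psi> \<circ> \<gamma>"]) auto
  qed
  then show ?thesis by (simp add: tspace_def)
qed

lemma dmap_push:
  assumes "c \<in> charts_at M p" "c' \<in> charts_at M p"
  shows "dmap (P c) (P c') id (snd c p) = dmap c c' id (snd c p)"
proof -
  have c: "c \<in> atlas M" "p \<in> fst c" and c': "p \<in> fst c'" using assms by (auto simp: charts_at_def)
  have dom: "cimage (P c) (id -` fst (P c')) = cimage c (id -` fst c')"
    unfolding vimage_id by (simp only: id_apply push_simps cimage_push)
  show ?thesis unfolding dmap_def dom
  proof (rule frechet_derivative_within_cong[OF _ UNIV_I open_UNIV])
    show "snd c p \<in> cimage c (id -` fst c')" using c c' by (simp add: cimageI)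
    fix y assume "y \<in> cimage c (id -` fst c') \<inter> UNIV"
    then have "y \<in> cimage c UNIV" using cimage_subset[of c "id -` fst c'"] by auto
    then show "(snd (P c') \<circ> id \<circ> pt (P c)) y = (snd c' \<circ> id \<circ> pt c) y"
      using pt_push[OF c(1), of y] by simp
  qed
qed

text \<open>Evaluating at \<open>Q c\<close> gives the pushforward of \<open>V\<close>: its
  components in \<open>P c\<close> are those of \<open>V\<close> in \<open>c\<close>. The
  transformation law carries over because corresponding charts have the same transition
  maps.\<close>

lemma vector_field_push:
  assumes "vector_field_on M S V"
  shows "vector_field_on M (\<psi> ` S) (\<lambda>c. V (Q c))"
  unfolding vector_field_on_def
proof
  show "\<forall>c\<in>atlas M. smooth_on (cimage c (\<psi> ` S)) (V (Q c))"
    using assms by (subst ball_atlas) (simp add: vector_field_on_def)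
  show "\<forall>p\<in>\<psi> ` S. \<forall>c\<in>charts_at M p. \<forall>c'\<in>charts_at M p.
      V (Q c') (snd c' p) = dmap c c' id (snd c p) (V (Q c) (snd c p))"
    unfolding ball_simps(9) ball_charts push_simps
  proof (intro ballI)
    fix p c c' assume *: "p \<in> S" "c \<in> charts_at M p" "c' \<in> charts_at M p"
    have "V c' (snd c' p) = dmap c c' id (snd c p) (V c (snd c p))"
      by (rule assms[unfolded vector_field_on_def, THEN conjunct2, rule_format, OF *])
    then show "V c' (snd c' p) = dmap (P c) (P c') id (snd c p) (V c (snd c p))"
      by (simp only: dmap_push[OF *(2,3)])
  qed
qed

lemma coorientable_push:
  assumes "coorientable M H"
  shows "coorientable M (\<psi> ` H)"
proof -
  obtain \<nu> where \<nu>: "vector_field_on M H \<nu>" "\<forall>p\<in>H. \<forall>c\<in>charts_at M p. \<nu> c (snd c p) \<notin> tspace H c p"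
    using assms by (auto simp: coorientable_def)
  then show ?thesis unfolding coorientable_def
    by (intro exI[of _ "\<lambda>c. \<nu> (Q c)"]) (simp add: vector_field_push ball_charts)
qed

lemma stratum_push: "\<psi> ` stratum M k = stratum M k"
  by (rule set_eq_imageI[symmetric]) (simp add: stratum_def bex_charts)

lemma components_push: "connected_components_of (subtopology (mtop M) (stratum M k)) =
    (`) \<psi> ` connected_components_of (subtopology (mtop M) (stratum M k))"
  using homeomorphic_map_connected_components_of[OF homeo_sub[of "stratum M k"]] by (simp add: stratum_push)

text \<open>A homeomorphism that preserves the stratum permutes its components and commutes with
  closure.\<close>

lemma corner_push:
  assumes "corner M m C"
  shows "corner M m (\<psi> ` C)"
proof -
  obtain \<D> where D: "\<D> \<subseteq> connected_components_of (subtopology (mtop M) (stratum M m))"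
    "C = mtop M closure_of \<Union>\<D>"
    using assms by (auto simp: corner_def)
  have "\<Union>\<D> \<subseteq> topspace (mtop M)"
    using D(1) connected_components_of_subset by fastforce
  then have "\<psi> ` C = mtop M closure_of (\<psi> ` \<Union>\<D>)"
    using homeomorphic_map_closure_of[OF homeo] D(2) by simp
  also have "\<psi> ` \<Union>\<D> = \<Union> ((`) \<psi> ` \<D>)" by auto
  finally have "\<psi> ` C = mtop M closure_of \<Union> ((`) \<psi> ` \<D>)" .
  moreover have "(`) \<psi> ` \<D> \<subseteq> connected_components_of (subtopology (mtop M) (stratum M m))"
    using image_mono[OF D(1)] components_push by metis
  ultimately show ?thesis unfolding corner_def by blast
qed

end

text \<open>Null spaces, leaves and coisotropy involve a form only through its differential, so
  nothing more is assumed to correspond. The locale serves twice: for a form and its pullback by a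
  diffeomorphism, and with the identity permutation for two forms of equal differential.\<close>

locale dform_push = atlas_auto M \<psi> for M :: "('a, 'e::euclidean_space) cmfd" and \<psi> +
  fixes \<theta> \<mu> :: "('a, 'e) form1"
  assumes dform_push: "c \<in> atlas M \<Longrightarrow> x \<in> cimage c UNIV \<Longrightarrow> dform \<theta> (P c) x = dform \<mu> c x"
begin

lemma dform_inverse: "dform_push M (inv \<psi>) \<mu> \<theta>"
proof -
  interpret inv: atlas_auto M "inv \<psi>" by (rule inverse)
  show ?thesis
  proof
    fix c x assume "c \<in> atlas M" "x \<in> cimage c UNIV"
    then show "dform \<mu> (Q c) x = dform \<theta> c x"
      using dform_push[of "Q c" x] push_inv_atlas by simp
  qed
qed

lemma dform_at: "c \<in> charts_at M p \<Longrightarrow> dform \<theta> (P c) (snd c p) = dform \<mu> c (snd c p)"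
  by (rule dform_push) (auto simp: charts_at_def cimage_UNIV)

lemma null_space_push: "c \<in> charts_at M p \<Longrightarrow> null_space \<theta> (\<psi> ` Y) (P c) (\<psi> p) = null_space \<mu> Y c p"
  by (simp add: null_space_def dform_at)

lemma coisotropic_push: "coisotropic M \<mu> k Y \<Longrightarrow> coisotropic M \<theta> k (\<psi> ` Y)"
  by (simp add: coisotropic_def submanifold_push ball_charts dform_at)

lemma symplectic_push: "symplectic M \<mu> \<Longrightarrow> symplectic M \<theta>"
  unfolding symplectic_def by (subst ball_atlas) (simp add: dform_push)

lemma null_curve_push:
  assumes "null_curve M \<mu> Y \<gamma>"
  shows "null_curve M \<theta> (\<psi> ` Y) (\<psi> \<circ> \<gamma>)"
  unfolding null_curve_def
proof (intro conjI)
  show "continuous_map (top_of_set {0..1}) (subtopology (mtop M) (\<psi> ` Y)) (\<psi> \<circ> \<gamma>)"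
    using assms continuous_sub by (auto simp: null_curve_def intro: continuous_map_compose)
  show "\<forall>c\<in>atlas M. smooth_on {t \<in> {0..1}. (\<psi> \<circ> \<gamma>) t \<in> fst c} (snd c \<circ> (\<psi> \<circ> \<gamma>))"
    using assms by (subst ball_atlas) (simp add: null_curve_def)
  show "\<forall>t\<in>{0..1}. \<forall>c\<in>charts_at M ((\<psi> \<circ> \<gamma>) t).
      vector_derivative (snd c \<circ> (\<psi> \<circ> \<gamma>)) (at t within {0..1}) \<in> null_space \<theta> (\<psi> ` Y) c ((\<psi> \<circ> \<gamma>) t)"
    using assms by (simp add: null_curve_def ball_charts null_space_push)
qed

lemma null_leaf_push_subset: "\<psi> ` null_leaf M \<mu> Y p \<subseteq> null_leaf M \<theta> (\<psi> ` Y) (\<psi> p)"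
proof
  fix q' assume "q' \<in> \<psi> ` null_leaf M \<mu> Y p"
  then obtain q where q: "q' = \<psi> q" "(\<lambda>x y. \<exists>\<gamma>. null_curve M \<mu> Y \<gamma> \<and> \<gamma> 0 = x \<and> \<gamma> 1 = y)\<^sup>*\<^sup>* p q"
    by (auto simp: null_leaf_def)
  from q(2) have "(\<lambda>x y. \<exists>\<gamma>. null_curve M \<theta> (\<psi> ` Y) \<gamma> \<and> \<gamma> 0 = x \<and> \<gamma> 1 = y)\<^sup>*\<^sup>* (\<psi> p) (\<psi> q)"
  proof (induction rule: rtranclp_induct)
    case (step y z)
    then obtain \<gamma> where "null_curve M \<mu> Y \<gamma>" "\<gamma> 0 = y" "\<gamma> 1 = z" by blast
    then have "null_curve M \<theta> (\<psi> ` Y) (\<psi> \<circ> \<gamma>) \<and> (\<psi> \<circ> \<gamma>) 0 = \<psi> y \<and> (\<psi> \<circ> \<gamma>) 1 = \<psi> z"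
      using null_curve_push by simp
    then have "\<exists>\<gamma>. null_curve M \<theta> (\<psi> ` Y) \<gamma> \<and> \<gamma> 0 = \<psi> y \<and> \<gamma> 1 = \<psi> z" by blast
    with step.IH show ?case by (rule rtranclp.rtrancl_into_rtrancl)
  qed simp
  then show "q' \<in> null_leaf M \<theta> (\<psi> ` Y) (\<psi> p)" by (simp add: null_leaf_def q(1))
qed

text \<open>The reverse inclusion is \<open>null_leaf_push_subset\<close> for the inverse
  permutation, carried back by \<open>\<psi>\<close>.\<close>

lemma null_leaf_push: "null_leaf M \<theta> (\<psi> ` Y) (\<psi> p) = \<psi> ` null_leaf M \<mu> Y p"
proof -
  interpret inv: dform_push M "inv \<psi>" \<mu> \<theta> by (rule dform_inverse)
  have "inv \<psi> ` null_leaf M \<theta> (\<psi> ` Y) (\<psi> p) \<subseteq> null_leaf M \<mu> Y p"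
    using inv.null_leaf_push_subset[of "\<psi> ` Y" "\<psi> p"] by simp
  then have "\<psi> ` inv \<psi> ` null_leaf M \<theta> (\<psi> ` Y) (\<psi> p) \<subseteq> \<psi> ` null_leaf M \<mu> Y p" by (rule image_mono)
  then show ?thesis using null_leaf_push_subset by (simp only: inv_simps subset_antisym)
qed

lemma leaves_push: "leaves M \<theta> (\<psi> ` Y) = (`) \<psi> ` leaves M \<mu> Y"
  by (simp add: leaves_def image_image null_leaf_push)

lemma leaf_homeomorphic: "subtopology (mtop M) (\<psi> ` L) homeomorphic_space subtopology (mtop M) L"
  using homeo_sub homeomorphic_map_imp_homeomorphic_space homeomorphic_space_sym by blast

text \<open>A section is conjugated by the actions of \<open>\<psi>\<close> on points and on leaves.
  Continuity is checked on open families of leaves: the points whose leaf lies in the image family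
  are the images of those whose leaf lies in the family, so the quotient topologies
  correspond.\<close>

lemma section_push:
  assumes "has_continuous_section M \<mu> Y"
  shows "has_continuous_section M \<theta> (\<psi> ` Y)"
proof -
  obtain \<sigma> where \<sigma>: "continuous_map (leaf_space M \<mu> Y) (subtopology (mtop M) Y) \<sigma>"
    "\<forall>L\<in>leaves M \<mu> Y. null_leaf M \<mu> Y (\<sigma> L) = L"
    using assms by (auto simp: has_continuous_section_def)
  have preim: "{p \<in> \<psi> ` Y. null_leaf M \<theta> (\<psi> ` Y) p \<in> (`) \<psi> ` \<U>} = \<psi> ` {p\<in>Y. null_leaf M \<mu> Y p \<in> \<U>}" for \<U>
    using null_leaf_push[of Y] bij by (auto simp: inj_image_eq_iff bij_is_inj)
  have open_iff: "openin (leaf_space M \<theta> (\<psi> ` Y)) ((`) \<psi> ` \<U>) \<longleftrightarrow> openin (leaf_space M \<mu> Y) \<U>" for \<U>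
    unfolding openin_leaf_space preim leaves_push
    using bij by (simp add: inj_image_subset_iff bij_is_inj inj_on_image)
  have cont: "continuous_map (leaf_space M \<theta> (\<psi> ` Y)) (leaf_space M \<mu> Y) ((`) (inv \<psi>))"
    unfolding continuous_map_def
  proof (intro conjI allI impI)
    have *: "openin (leaf_space M \<theta> (\<psi> ` Y)) {L \<in> topspace (leaf_space M \<theta> (\<psi> ` Y)). inv \<psi> ` L \<in> \<U>}"
      if "openin (leaf_space M \<mu> Y) \<U>" for \<U>
    proof -
      have "openin (leaf_space M \<theta> (\<psi> ` Y)) ((`) \<psi> ` \<U>)" using that open_iff by simp
      moreover have "{L. inv \<psi> ` L \<in> \<U>} = (`) \<psi> ` \<U>"
        by (auto intro!: image_eqI[of _ "(`) \<psi>" "inv \<psi> ` _"])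
      moreover have "{L \<in> topspace (leaf_space M \<theta> (\<psi> ` Y)). inv \<psi> ` L \<in> \<U>}
          = {L. inv \<psi> ` L \<in> \<U>} \<inter> topspace (leaf_space M \<theta> (\<psi> ` Y))" by auto
      ultimately show ?thesis by (simp add: openin_Int)
    qed
    then show "openin (leaf_space M \<theta> (\<psi> ` Y)) {L \<in> topspace (leaf_space M \<theta> (\<psi> ` Y)). inv \<psi> ` L \<in> \<U>}"
      if "openin (leaf_space M \<mu> Y) \<U>" for \<U> using that .
    \<comment> \<open>Being an open family, the whole leaf space is carried to an open family, which
      therefore lies in the other leaf space.\<close>
    let ?T = "topspace (leaf_space M \<theta> (\<psi> ` Y))"
    have "(`) \<psi> ` (`) (inv \<psi>) ` ?T = ?T" by (simp add: image_image)
    then have "openin (leaf_space M \<mu> Y) ((`) (inv \<psi>) ` ?T)"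
      using open_iff[of "(`) (inv \<psi>) ` ?T"] openin_topspace by metis
    then have "(`) (inv \<psi>) ` ?T \<subseteq> topspace (leaf_space M \<mu> Y)" by (rule openin_subset)
    then show "(`) (inv \<psi>) \<in> ?T \<rightarrow> topspace (leaf_space M \<mu> Y)" by blast
  qed
  show ?thesis unfolding has_continuous_section_def
  proof (intro exI[of _ "\<psi> \<circ> (\<sigma> \<circ> (`) (inv \<psi>))"] conjI)
    show "continuous_map (leaf_space M \<theta> (\<psi> ` Y)) (subtopology (mtop M) (\<psi> ` Y)) (\<psi> \<circ> (\<sigma> \<circ> (`) (inv \<psi>)))"
      by (intro continuous_map_compose[OF _ continuous_sub] continuous_map_compose[OF cont] \<sigma>(1))
    show "\<forall>L\<in>leaves M \<theta> (\<psi> ` Y). null_leaf M \<theta> (\<psi> ` Y) ((\<psi> \<circ> (\<sigma> \<circ> (`) (inv \<psi>))) L) = L"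
      using \<sigma>(2) by (simp add: leaves_push null_leaf_push)
  qed
qed

end

section \<open>Liouville fields, cylindrical ends and sectorial data under transport\<close>

locale form_push = atlas_auto M \<psi> for M :: "('a, 'e::euclidean_space) cmfd" and \<psi> +
  fixes \<theta> \<mu> :: "('a, 'e) form1"
  assumes form_push: "c \<in> atlas M \<Longrightarrow> x \<in> cimage c UNIV \<Longrightarrow> \<theta> (P c) x = \<mu> c x"
begin

lemma form_derivative_push:
  assumes "c \<in> atlas M" "x \<in> cimage c UNIV"
  shows "dchart (P c) (\<lambda>y. \<theta> (P c) y v) x = dchart c (\<lambda>y. \<mu> c y v) x"
  unfolding dchart_def cimage_push
  by (rule frechet_derivative_within_cong[OF assms(2) UNIV_I open_UNIV]) (simp add: form_push[OF assms(1)])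

sublocale dform_push M \<psi> \<theta> \<mu>
proof unfold_locales
  fix c x assume "c \<in> atlas M" "x \<in> cimage c UNIV"
  note d = form_derivative_push[OF this]
  show "dform \<theta> (P c) x = dform \<mu> c x"
    by (intro ext) (simp only: dform_def d)
qed

lemma form_inverse: "form_push M (inv \<psi>) \<mu> \<theta>"
proof -
  interpret inv: atlas_auto M "inv \<psi>" by (rule inverse)
  show ?thesis
  proof
    fix c x assume "c \<in> atlas M" "x \<in> cimage c UNIV"
    then show "\<mu> (Q c) x = \<theta> c x"
      using form_push[of "Q c" x] push_inv_atlas by simp
  qed
qed

lemma form_at: "c \<in> charts_at M p \<Longrightarrow> \<theta> (P c) (snd c p) = \<mu> c (snd c p)"
  by (rule form_push) (auto simp: charts_at_def cimage_UNIV)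

lemma liouville_push:
  "c \<in> atlas M \<Longrightarrow> x \<in> cimage c UNIV \<Longrightarrow> liouville_field \<theta> (P c) x = liouville_field \<mu> c x"
  by (simp add: liouville_field_def form_push dform_push)

lemma liouville_at: "c \<in> charts_at M p \<Longrightarrow> liouville_field \<theta> (P c) (snd c p) = liouville_field \<mu> c (snd c p)"
  by (rule liouville_push) (auto simp: charts_at_def cimage_UNIV)

lemma one_form_push:
  assumes "one_form M \<mu>"
  shows "one_form M \<theta>"
  unfolding one_form_def
proof (intro conjI allI)
  show "\<forall>c\<in>atlas M. (\<forall>x\<in>cimage c UNIV. linear (\<theta> c x)) \<and>
      (\<forall>v. smooth_on (cimage c UNIV) (\<lambda>x. \<theta> c x v))"
  proof (subst ball_atlas, unfold cimage_push, intro ballI conjI allI)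
    fix c x assume "c \<in> atlas M" "x \<in> cimage c UNIV"
    then show "linear (\<theta> (P c) x)" using assms by (simp add: one_form_def form_push)
  next
    fix c v assume c: "c \<in> atlas M"
    have "smooth_on (cimage c UNIV) (\<lambda>x. \<mu> c x v)" using assms c by (rule smooth_form)
    then show "smooth_on (cimage c UNIV) (\<lambda>x. \<theta> (P c) x v)"
      by (rule smooth_on_cong[THEN iffD1, rotated]) (simp add: form_push[OF c])
  qed
next
  fix p
  have "\<forall>c\<in>charts_at M (\<psi> q). \<forall>c'\<in>charts_at M (\<psi> q). \<forall>v.
      \<theta> c (snd c (\<psi> q)) v = \<theta> c' (snd c' (\<psi> q)) (dmap c c' id (snd c (\<psi> q)) v)" for q
    unfolding ball_charts push_simps
  proof (intro ballI allI)
    fix c c' v assume *: "c \<in> charts_at M q" "c' \<in> charts_at M q"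
    have "\<mu> c (snd c q) v = \<mu> c' (snd c' q) (dmap c c' id (snd c q) v)"
      by (rule assms[unfolded one_form_def, THEN conjunct2, rule_format, OF *])
    then show "\<theta> (P c) (snd c q) v = \<theta> (P c') (snd c' q) (dmap (P c) (P c') id (snd c q) v)"
      by (simp only: dmap_push[OF *] form_at[OF *(1)] form_at[OF *(2)])
  qed
  from this[of "inv \<psi> p"] show "\<forall>c\<in>charts_at M p. \<forall>c'\<in>charts_at M p. \<forall>v.
      \<theta> c (snd c p) v = \<theta> c' (snd c' p) (dmap c c' id (snd c p) v)" by (simp only: inv_simps)
qed

lemma lie_form_push:
  assumes "c \<in> charts_at M p"
  shows "lie_form (\<lambda>c. V (Q c)) \<theta> (P c) (snd c p) w = lie_form V \<mu> c (snd c p) w"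
proof -
  have c: "c \<in> atlas M" "snd c p \<in> cimage c UNIV" using assms by (auto simp: charts_at_def cimage_UNIV)
  have "dchart (P c) (V c) = dchart c (V c)" by (simp add: dchart_def fun_eq_iff)
  then show ?thesis by (simp add: lie_form_def form_derivative_push[OF c] form_at[OF assms])
qed

lemma tangent_near_infinity_push:
  assumes "tangent_near_infinity M (liouville_field \<mu>) H"
  shows "tangent_near_infinity M (liouville_field \<theta>) (\<psi> ` H)"
proof -
  obtain K where K: "compactin (mtop M) K"
    "\<forall>p\<in>H - K. \<forall>c\<in>charts_at M p. liouville_field \<mu> c (snd c p) \<in> tspace H c p"
    using assms by (auto simp: tangent_near_infinity_def)
  have "\<psi> ` H - \<psi> ` K = \<psi> ` (H - K)" using bij by (simp add: image_set_diff bij_is_inj)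
  then show ?thesis unfolding tangent_near_infinity_def
    using K by (intro exI[of _ "\<psi> ` K"]) (simp add: ball_charts liouville_at)
qed

lemma contact_field_push:
  assumes "contact_field_on M \<mu> S W V"
  shows "contact_field_on M \<theta> (\<psi> ` S) (\<psi> ` W) (\<lambda>c. V (Q c))"
proof -
  obtain g where g: "\<forall>p\<in>S \<inter> W. \<forall>c\<in>charts_at M p. \<forall>w\<in>tspace S c p.
      lie_form V \<mu> c (snd c p) w = g p * \<mu> c (snd c p) w"
    using assms by (auto simp: contact_field_on_def)
  have SW: "\<psi> ` S \<inter> \<psi> ` W = \<psi> ` (S \<inter> W)" using bij by (simp add: image_Int bij_is_inj)
  have "\<forall>p\<in>\<psi> ` S \<inter> \<psi> ` W. \<forall>c\<in>charts_at M p. \<forall>w\<in>tspace (\<psi> ` S) c p.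
      lie_form (\<lambda>c. V (Q c)) \<theta> c (snd c p) w = (g \<circ> inv \<psi>) p * \<theta> c (snd c p) w"
    using g unfolding SW by (simp add: ball_charts lie_form_push form_at)
  moreover have "\<forall>p\<in>\<psi> ` S \<inter> \<psi> ` W. \<forall>c\<in>charts_at M p. V (Q c) (snd c p) \<in> tspace (\<psi> ` S) c p"
    using assms unfolding SW by (simp add: ball_charts contact_field_on_def)
  ultimately show ?thesis
    using assms vector_field_push by (auto simp: contact_field_on_def)
qed

lemma convex_hypersurface_push:
  assumes "convex_hypersurface M \<mu> S \<Gamma>"
  shows "convex_hypersurface M \<theta> (\<psi> ` S) (\<psi> ` \<Gamma>)"
proof -
  obtain W V where WV: "\<Gamma> \<subseteq> W" "contact_field_on M \<mu> S W V"
    "\<forall>p\<in>\<Gamma>. \<forall>c\<in>charts_at M p. V c (snd c p) \<notin> tspace \<Gamma> c p"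
    using assms by (auto simp: convex_hypersurface_def)
  have "\<psi> ` \<Gamma> \<subseteq> \<psi> ` W \<and> contact_field_on M \<theta> (\<psi> ` S) (\<psi> ` W) (\<lambda>c. V (Q c)) \<and>
      (\<forall>p\<in>\<psi> ` \<Gamma>. \<forall>c\<in>charts_at M p. V (Q c) (snd c p) \<notin> tspace (\<psi> ` \<Gamma>) c p)"
    using WV by (simp add: ball_charts contact_field_push image_mono)
  then have "\<exists>W V. \<psi> ` \<Gamma> \<subseteq> W \<and> contact_field_on M \<theta> (\<psi> ` S) W V \<and>
      (\<forall>p\<in>\<psi> ` \<Gamma>. \<forall>c\<in>charts_at M p. V c (snd c p) \<notin> tspace (\<psi> ` \<Gamma>) c p)"
    by (intro exI)
  then show ?thesis using assms submanifold_push by (auto simp: convex_hypersurface_def)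
qed

definition flow_push :: "('a \<Rightarrow> real \<Rightarrow> 'a) \<Rightarrow> 'a \<Rightarrow> real \<Rightarrow> 'a" where
  "flow_push \<Phi> p t = \<psi> (\<Phi> (inv \<psi> p) t)"

lemma flow_push_simp [simp]: "flow_push \<Phi> (\<psi> p) t = \<psi> (\<Phi> p t)"
  by (simp add: flow_push_def)

lemma flow_push_range: "{flow_push \<Phi> p t |p t. p \<in> \<psi> ` S \<and> R t} = \<psi> ` {\<Phi> p t |p t. p \<in> S \<and> R t}"
  by (force simp: flow_push_def)

lemma flow_push_image: "(\<lambda>p. flow_push \<Phi> p t) ` \<psi> ` S = \<psi> ` (\<lambda>p. \<Phi> p t) ` S"
  by (simp add: image_image)

text \<open>Once both chart quantifiers are reindexed, the coordinate expressions of the flow, of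
  the projection and of the time are the old ones. The embedding clause is free of charts: the new
  map is \<open>\<Phi>\<close> preceded by \<open>inv \<psi>\<close> on the base and followed by
  \<open>\<psi>\<close>.\<close>

lemma cylindrical_end_push:
  assumes "cylindrical_end M \<mu> S \<Phi>"
  shows "cylindrical_end M \<theta> (\<psi> ` S) (flow_push \<Phi>)"
proof -
  note A = assms[unfolded cylindrical_end_def]
  from A have hyp: "proper_hypersurface M S"
    and trans: "\<forall>p\<in>S. \<forall>c\<in>charts_at M p. liouville_field \<mu> c (snd c p) \<notin> tspace S c p"
    and init: "\<forall>p\<in>S. \<Phi> p 0 = p"
    and flow: "\<forall>p\<in>S. \<forall>t\<ge>0. \<forall>c\<in>charts_at M (\<Phi> p t).
        ((\<lambda>s. snd c (\<Phi> p s)) has_vector_derivative liouville_field \<mu> c (snd c (\<Phi> p t))) (at t within {0..})"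
    and emb: "embedding_map (prod_topology (subtopology (mtop M) S) (top_of_set {0..})) (mtop M) (\<lambda>(p, t). \<Phi> p t)"
    and cl: "closedin (mtop M) {\<Phi> p t |p t. p \<in> S \<and> 0 \<le> t}"
    and sm: "\<forall>c\<in>atlas M. \<forall>c'\<in>atlas M.
        smooth_on {(x, t). x \<in> cimage c S \<and> 0 \<le> t \<and> \<Phi> (pt c x) t \<in> fst c'} (\<lambda>(x, t). snd c' (\<Phi> (pt c x) t))"
    and inv: "\<exists>\<pi> s. (\<forall>p\<in>S. \<forall>t\<ge>0. \<pi> (\<Phi> p t) = p \<and> s (\<Phi> p t) = t) \<and>
        (\<forall>c\<in>atlas M. \<forall>c'\<in>atlas M. smooth_on (cimage c {q. \<exists>p\<in>S \<inter> fst c'. \<exists>t\<ge>0. q = \<Phi> p t})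
             (\<lambda>x. (snd c' (\<pi> (pt c x)), s (pt c x) :: real)))"
    and cpt: "compactin (mtop M) (topspace (mtop M) - {\<Phi> p t |p t. p \<in> S \<and> 0 < t})"
    by blast+
  have emb': "embedding_map (prod_topology (subtopology (mtop M) (\<psi> ` S)) (top_of_set {0..})) (mtop M)
      (\<lambda>(p, t). flow_push \<Phi> p t)"
  proof -
    interpret inv: atlas_auto M "inv \<psi>" by (rule inverse)
    obtain g where "homeomorphic_maps (subtopology (mtop M) (\<psi> ` S)) (subtopology (mtop M) S) (inv \<psi>) g"
      using inv.homeo_sub[of "\<psi> ` S"] by (auto simp: homeomorphic_map_maps)
    moreover have "homeomorphic_maps (top_of_set {0::real..}) (top_of_set {0..}) (\<lambda>t. t) (\<lambda>t. t)"
      by (simp add: homeomorphic_maps_def)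
    ultimately have "homeomorphic_maps (prod_topology (subtopology (mtop M) (\<psi> ` S)) (top_of_set {0::real..}))
        (prod_topology (subtopology (mtop M) S) (top_of_set {0..})) (\<lambda>(x,y). (inv \<psi> x, y)) (\<lambda>(x,y). (g x, y))"
      unfolding homeomorphic_maps_prod[of _ _ _ _ _ "\<lambda>t. t" _ "\<lambda>t. t"] by blast
    then have 1: "embedding_map (prod_topology (subtopology (mtop M) (\<psi> ` S)) (top_of_set {0::real..}))
        (prod_topology (subtopology (mtop M) S) (top_of_set {0..})) (\<lambda>(x,y). (inv \<psi> x, y))"
      using homeomorphic_map_maps surjective_embedding_map by blast
    have 2: "embedding_map (mtop M) (mtop M) \<psi>"
      using homeo surjective_embedding_map by blast
    have "(\<lambda>(p, t). flow_push \<Phi> p t) = \<psi> \<circ> ((\<lambda>(p, t). \<Phi> p t) \<circ> (\<lambda>(x,y). (inv \<psi> x, y)))"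
      by (auto simp: flow_push_def fun_eq_iff)
    then show ?thesis using embedding_map_compose[OF embedding_map_compose[OF 1 emb] 2] by simp
  qed
  have sm': "\<forall>c\<in>atlas M. \<forall>c'\<in>atlas M.
      smooth_on {(x, t). x \<in> cimage c (\<psi> ` S) \<and> 0 \<le> t \<and> flow_push \<Phi> (pt c x) t \<in> fst c'}
        (\<lambda>(x, t). snd c' (flow_push \<Phi> (pt c x) t))"
  proof (subst ball_atlas, subst (2) ball_atlas, intro ballI)
    fix c c' assume c: "c \<in> atlas M" "c' \<in> atlas M"
    have pt: "pt (P c) x = \<psi> (pt c x)" if "x \<in> cimage c S" for x
      using pt_push[OF c(1), of x] that cimage_subset[of c S] by auto
    have "{(x, t). x \<in> cimage (P c) (\<psi> ` S) \<and> 0 \<le> t \<and> flow_push \<Phi> (pt (P c) x) t \<in> fst (P c')}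
        = {(x, t). x \<in> cimage c S \<and> 0 \<le> t \<and> \<Phi> (pt c x) t \<in> fst c'}"
      using pt by auto
    moreover have "smooth_on {(x, t). x \<in> cimage c S \<and> 0 \<le> t \<and> \<Phi> (pt c x) t \<in> fst c'}
        (\<lambda>(x, t). snd (P c') (flow_push \<Phi> (pt (P c) x) t))"
      by (rule smooth_on_cong[THEN iffD1, rotated, OF sm[rule_format, OF c]]) (use pt in auto)
    ultimately show "smooth_on {(x, t). x \<in> cimage (P c) (\<psi> ` S) \<and> 0 \<le> t \<and> flow_push \<Phi> (pt (P c) x) t \<in> fst (P c')}
        (\<lambda>(x, t). snd (P c') (flow_push \<Phi> (pt (P c) x) t))" by (simp only:)
  qed
  have inv': "\<exists>\<pi> s. (\<forall>p\<in>\<psi> ` S. \<forall>t\<ge>0. \<pi> (flow_push \<Phi> p t) = p \<and> s (flow_push \<Phi> p t) = t) \<and>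
        (\<forall>c\<in>atlas M. \<forall>c'\<in>atlas M. smooth_on (cimage c {q. \<exists>p\<in>\<psi> ` S \<inter> fst c'. \<exists>t\<ge>0. q = flow_push \<Phi> p t})
             (\<lambda>x. (snd c' (\<pi> (pt c x)), s (pt c x) :: real)))"
  proof -
    obtain \<pi> s where \<pi>: "\<forall>p\<in>S. \<forall>t\<ge>0. \<pi> (\<Phi> p t) = p \<and> s (\<Phi> p t) = t"
      and sm: "\<forall>c\<in>atlas M. \<forall>c'\<in>atlas M. smooth_on (cimage c {q. \<exists>p\<in>S \<inter> fst c'. \<exists>t\<ge>0. q = \<Phi> p t})
             (\<lambda>x. (snd c' (\<pi> (pt c x)), s (pt c x) :: real))" using inv by blast
    show ?thesis
    proof (intro exI conjI)
      show "\<forall>p\<in>\<psi> ` S. \<forall>t\<ge>0. (\<psi> \<circ> \<pi> \<circ> inv \<psi>) (flow_push \<Phi> p t) = p \<and> (s \<circ> inv \<psi>) (flow_push \<Phi> p t) = t"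
        using \<pi> by simp
      show "\<forall>c\<in>atlas M. \<forall>c'\<in>atlas M. smooth_on (cimage c {q. \<exists>p\<in>\<psi> ` S \<inter> fst c'. \<exists>t\<ge>0. q = flow_push \<Phi> p t})
             (\<lambda>x. (snd c' ((\<psi> \<circ> \<pi> \<circ> inv \<psi>) (pt c x)), (s \<circ> inv \<psi>) (pt c x)))"
      proof (subst ball_atlas, subst (2) ball_atlas, intro ballI)
        fix c c' assume c: "c \<in> atlas M" "c' \<in> atlas M"
        let ?A = "{q. \<exists>p\<in>S \<inter> fst c'. \<exists>t\<ge>0. q = \<Phi> p t}"
        have "{q. \<exists>p\<in>\<psi> ` S \<inter> fst (P c'). \<exists>t\<ge>0. q = flow_push \<Phi> p t} = \<psi> ` ?A"
        proof (rule set_eq_imageI)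
          have "\<psi> ` S \<inter> fst (P c') = \<psi> ` (S \<inter> fst c')" using bij by (simp add: image_Int bij_is_inj)
          then show "\<psi> q \<in> {q. \<exists>p\<in>\<psi> ` S \<inter> fst (P c'). \<exists>t\<ge>0. q = flow_push \<Phi> p t} \<longleftrightarrow> q \<in> ?A" for q
            by simp
        qed
        moreover have "smooth_on (cimage c ?A)
            (\<lambda>x. (snd (P c') ((\<psi> \<circ> \<pi> \<circ> inv \<psi>) (pt (P c) x)), (s \<circ> inv \<psi>) (pt (P c) x)))"
        proof (rule smooth_on_cong[THEN iffD1, rotated, OF sm[rule_format, OF c]])
          fix x assume "x \<in> cimage c ?A"
          then have "pt (P c) x = \<psi> (pt c x)" using pt_push[OF c(1), of x] cimage_subset[of c ?A] by auto
          then show "(snd c' (\<pi> (pt c x)), s (pt c x)) =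
              (snd (P c') ((\<psi> \<circ> \<pi> \<circ> inv \<psi>) (pt (P c) x)), (s \<circ> inv \<psi>) (pt (P c) x))" by simp
        qed
        ultimately show "smooth_on (cimage (P c) {q. \<exists>p\<in>\<psi> ` S \<inter> fst (P c'). \<exists>t\<ge>0. q = flow_push \<Phi> p t})
            (\<lambda>x. (snd (P c') ((\<psi> \<circ> \<pi> \<circ> inv \<psi>) (pt (P c) x)), (s \<circ> inv \<psi>) (pt (P c) x)))"
          by (simp only: cimage_push)
      qed
    qed
  qed
  have cpt': "compactin (mtop M) (topspace (mtop M) - {flow_push \<Phi> p t |p t. p \<in> \<psi> ` S \<and> 0 < t})"
  proof -
    have "topspace (mtop M) - \<psi> ` A = \<psi> ` (topspace (mtop M) - A)" for A
      using image_set_diff[OF bij_is_inj[OF bij], of "topspace (mtop M)" A] by simp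
    then show ?thesis using cpt by (simp add: flow_push_range[of _ _ "\<lambda>t. 0 < t"])
  qed
  have cl': "closedin (mtop M) {flow_push \<Phi> p t |p t. p \<in> \<psi> ` S \<and> 0 \<le> t}"
    using cl by (simp add: flow_push_range[of _ _ "\<lambda>t. 0 \<le> t"])
  have trans': "\<forall>p\<in>\<psi> ` S. \<forall>c\<in>charts_at M p. liouville_field \<theta> c (snd c p) \<notin> tspace (\<psi> ` S) c p"
    using trans by (simp add: ball_charts liouville_at)
  have flow': "\<forall>p\<in>\<psi> ` S. \<forall>t\<ge>0. \<forall>c\<in>charts_at M (flow_push \<Phi> p t).
      ((\<lambda>s. snd c (flow_push \<Phi> p s)) has_vector_derivative liouville_field \<theta> c (snd c (flow_push \<Phi> p t)))
        (at t within {0..})"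
    using flow by (simp add: ball_charts liouville_at)
  have init': "\<forall>p\<in>\<psi> ` S. flow_push \<Phi> p 0 = p" using init by simp
  show ?thesis unfolding cylindrical_end_def
    using proper_hypersurface_push[OF hyp] trans' init' flow' emb' cl' sm' inv' cpt' by blast
qed

lemma rays_push: "rays_in (\<psi> ` S) (flow_push \<Phi>) (\<psi> ` H) = \<psi> ` rays_in S \<Phi> H"
  by (rule set_eq_imageI) (simp add: rays_in_def)

lemma convex_at_infinity_push:
  assumes "convex_at_infinity M \<mu> H"
  shows "convex_at_infinity M \<theta> (\<psi> ` H)"
proof -
  obtain S \<Phi> where S: "cylindrical_end M \<mu> S \<Phi>"
    "\<forall>t\<ge>0. convex_hypersurface M \<mu> ((\<lambda>p. \<Phi> p t) ` S) ((\<lambda>p. \<Phi> p t) ` rays_in S \<Phi> H)"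
    using assms by (auto simp: convex_at_infinity_def)
  then have "\<forall>t\<ge>0. convex_hypersurface M \<theta> ((\<lambda>p. flow_push \<Phi> p t) ` \<psi> ` S)
      ((\<lambda>p. flow_push \<Phi> p t) ` rays_in (\<psi> ` S) (flow_push \<Phi>) (\<psi> ` H))"
    using convex_hypersurface_push by (simp only: rays_push flow_push_image) blast
  then show ?thesis using cylindrical_end_push[OF S(1)] unfolding convex_at_infinity_def by blast
qed

lemma liouville_manifold_push: "liouville_manifold M \<mu> \<Longrightarrow> liouville_manifold M \<theta>"
  using one_form_push symplectic_push cylindrical_end_push unfolding liouville_manifold_def by blast

lemma sigma_sectorial_push:
  assumes "sigma_sectorial M \<mu> H"
  shows "sigma_sectorial M \<theta> (\<psi> ` H)"
  using assms proper_hypersurface_push coorientable_push tangent_near_infinity_push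
    convex_at_infinity_push section_push homeomorphic_space_trans[OF leaf_homeomorphic]
  unfolding sigma_sectorial_def by (simp add: leaves_push) blast

lemma transverse_coisotropic_push:
  assumes "transverse_coisotropic M \<mu> m H"
  shows "transverse_coisotropic M \<theta> m (\<lambda>i. \<psi> ` H i)"
proof -
  have "dim (\<Inter>i\<in>I. tspace (\<psi> ` H i) c q) + card I = DIM('e)"
    if I: "I \<subseteq> {..<m}" "q \<in> topspace (mtop M) \<inter> (\<Inter>i\<in>I. \<psi> ` H i)" "c \<in> charts_at M q" for I q c
  proof -
    \<comment> \<open>Pulling back the point and the chart, instead of rewriting the intersections,
      also covers empty \<open>I\<close>, where the intersection is the whole type.\<close>
    define p d where "p = inv \<psi> q" and "d = Q c"
    have q: "q = \<psi> p" "c = P d" by (simp_all add: p_def d_def)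
    have "p \<in> topspace (mtop M) \<inter> (\<Inter>i\<in>I. H i)" "d \<in> charts_at M p" using I by (auto simp: q)
    then show ?thesis using assms I(1) by (simp add: q transverse_coisotropic_def)
  qed
  moreover have "coisotropic M \<theta> 2 (\<psi> ` H i \<inter> \<psi> ` H j)" if "i < m" "j < m" "i \<noteq> j" for i j
  proof -
    have "\<psi> ` H i \<inter> \<psi> ` H j = \<psi> ` (H i \<inter> H j)" using bij by (simp add: image_Int bij_is_inj)
    then show ?thesis using assms that coisotropic_push by (simp add: transverse_coisotropic_def)
  qed
  ultimately show ?thesis
    using assms submanifold_push coorientable_push tangent_near_infinity_push
    by (simp add: transverse_coisotropic_def)
qed

lemma sectorial_corner_push:
  assumes "sectorial_corner M \<mu> m H C"
  shows "sectorial_corner M \<theta> m (\<lambda>i. \<psi> ` H i) (\<psi> ` C)"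
proof -
  from assms have m: "m \<ge> 1" and C: "corner M m C" "C = (\<Inter>i<m. H i)"
    and H: "transverse_coisotropic M \<mu> m H" "\<forall>i<m. sigma_sectorial M \<mu> (H i)"
    and L: "\<forall>L\<in>leaves M \<mu> C. contractible_space (subtopology (mtop M) L)"
    unfolding sectorial_corner_def by blast+
  have "(\<Inter>i<m. \<psi> ` H i) = \<psi> ` C"
    by (rule set_eq_imageI) (simp add: C(2))
  moreover have "\<forall>L\<in>leaves M \<theta> (\<psi> ` C). contractible_space (subtopology (mtop M) L)"
    unfolding leaves_push using L homeomorphic_space_contractibility[OF leaf_homeomorphic] by blast
  ultimately show ?thesis
    unfolding sectorial_corner_def
    using m corner_push[OF C(1)] transverse_coisotropic_push[OF H(1)] H(2) sigma_sectorial_push by simp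
qed

lemma sigma_sector_push:
  assumes "sigma_sector M \<mu>"
  shows "sigma_sector M \<theta>"
  unfolding sigma_sector_def
proof (intro conjI allI impI ballI)
  show "liouville_manifold M \<theta>" using assms liouville_manifold_push by (simp add: sigma_sector_def)
  fix m \<delta> assume m: "1 \<le> m" and "\<delta> \<in> connected_components_of (subtopology (mtop M) (stratum M m))"
  \<comment> \<open>\<open>\<psi>\<close> permutes the components of the stratum, so
    \<open>\<delta>\<close> is the image of a component for which a corner is given.\<close>
  then have "\<delta> \<in> (`) \<psi> ` connected_components_of (subtopology (mtop M) (stratum M m))"
    by (simp only: components_push[symmetric])
  then obtain \<delta>' where d: "\<delta>' \<in> connected_components_of (subtopology (mtop M) (stratum M m))" "\<delta> = \<psi> ` \<delta>'"
    by blast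
  then obtain H C where "\<delta>' \<subseteq> C" "sectorial_corner M \<mu> m H C"
    using assms m unfolding sigma_sector_def by blast
  then show "\<exists>H C. \<delta> \<subseteq> C \<and> sectorial_corner M \<theta> m H C"
    using sectorial_corner_push d(2) image_mono by blast
qed

end

section \<open>Cylindrical ends\<close>

text \<open>Fixes the smooth inverse of the flow, consisting of the base point \<open>\<pi>\<close>
  and the time \<open>s\<close>, which \<open>cylindrical_end\<close> only asserts to exist. Off the
  end its values are arbitrary, so statements about it are restricted to the end.\<close>

locale cylinder = corner_manifold M for M :: "('a, 'e::euclidean_space) cmfd" +
  fixes \<theta> :: "('a, 'e) form1" and S :: "'a set" and \<Phi> :: "'a \<Rightarrow> real \<Rightarrow> 'a"
    and \<pi> :: "'a \<Rightarrow> 'a" and s :: "'a \<Rightarrow> real"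
  assumes cyl_end: "cylindrical_end M \<theta> S \<Phi>"
    and proj [simp]: "p \<in> S \<Longrightarrow> 0 \<le> t \<Longrightarrow> \<pi> (\<Phi> p t) = p" "p \<in> S \<Longrightarrow> 0 \<le> t \<Longrightarrow> s (\<Phi> p t) = t"
    and smooth_proj: "c \<in> atlas M \<Longrightarrow> c' \<in> atlas M \<Longrightarrow>
      smooth_on (cimage c {q. \<exists>p\<in>S \<inter> fst c'. \<exists>t\<ge>0. q = \<Phi> p t}) (\<lambda>x. (snd c' (\<pi> (pt c x)), s (pt c x)))"
begin

text \<open>\<open>E\<close> is the closed end, where \<open>\<pi>\<close> and \<open>s\<close> are
  meaningful; \<open>U0\<close> below is its open part of positive time, on which charts adapted to
  the flow are built.\<close>

definition E :: "'a set" where "E = {\<Phi> p t |p t. p \<in> S \<and> 0 \<le> t}"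
definition U0 :: "'a set" where "U0 = {\<Phi> p t |p t. p \<in> S \<and> 0 < t}"

lemma end_props:
  shows hyp: "proper_hypersurface M S"
    and init: "p \<in> S \<Longrightarrow> \<Phi> p 0 = p"
    and flow: "p \<in> S \<Longrightarrow> 0 \<le> t \<Longrightarrow> c \<in> charts_at M (\<Phi> p t) \<Longrightarrow>
        ((\<lambda>s. snd c (\<Phi> p s)) has_vector_derivative liouville_field \<theta> c (snd c (\<Phi> p t))) (at t within {0..})"
    and emb: "embedding_map (prod_topology (subtopology (mtop M) S) (top_of_set {0..})) (mtop M) (\<lambda>(p, t). \<Phi> p t)"
    and closed_E: "closedin (mtop M) E"
    and smooth_flow: "c \<in> atlas M \<Longrightarrow> c' \<in> atlas M \<Longrightarrow>
        smooth_on {(x, t). x \<in> cimage c S \<and> 0 \<le> t \<and> \<Phi> (pt c x) t \<in> fst c'} (\<lambda>(x, t). snd c' (\<Phi> (pt c x) t))"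
    and compact_rest: "compactin (mtop M) (topspace (mtop M) - U0)"
  using cyl_end unfolding cylindrical_end_def E_def U0_def by blast+

lemma S_subset: "S \<subseteq> topspace (mtop M)"
  using hyp by (simp add: proper_hypersurface_def submanifold_def)

lemma closed_S: "closedin (mtop M) S"
  using hyp by (simp add: proper_hypersurface_def)

lemma EI [intro]: "p \<in> S \<Longrightarrow> 0 \<le> t \<Longrightarrow> \<Phi> p t \<in> E"
  by (auto simp: E_def)

lemma E_proj: "q \<in> E \<Longrightarrow> \<pi> q \<in> S" "q \<in> E \<Longrightarrow> 0 \<le> s q" "q \<in> E \<Longrightarrow> \<Phi> (\<pi> q) (s q) = q"
  by (auto simp: E_def)

lemma E_subset: "E \<subseteq> topspace (mtop M)"
  using closed_E closedin_subset by blast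

lemma U0_iff: "q \<in> U0 \<longleftrightarrow> q \<in> E \<and> 0 < s q"
proof
  assume "q \<in> U0"
  then show "q \<in> E \<and> 0 < s q" by (auto simp: U0_def)
next
  assume "q \<in> E \<and> 0 < s q"
  then show "q \<in> U0" using E_proj[of q] unfolding U0_def by (intro CollectI exI[of _ "\<pi> q"] exI[of _ "s q"]) simp
qed

lemma S_in_E: "p \<in> S \<Longrightarrow> p \<in> E" "p \<in> S \<Longrightarrow> \<pi> p = p" "p \<in> S \<Longrightarrow> s p = 0"
  using EI[of p 0] proj[of p 0] by (simp_all add: init)

lemma topspace_cyl: "topspace (prod_topology (subtopology (mtop M) S) (top_of_set {0::real..})) = S \<times> {0..}"
  using S_subset by auto

lemma image_flow: "(\<lambda>(p, t). \<Phi> p t) ` (S \<times> {0..}) = E"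
  by (force simp: E_def)

lemma homeo_flow: "homeomorphic_map (prod_topology (subtopology (mtop M) S) (top_of_set {0..}))
    (subtopology (mtop M) E) (\<lambda>(p, t). \<Phi> p t)"
  using emb unfolding embedding_map_def topspace_cyl image_flow .

lemma continuous_flow:
  "continuous_map (prod_topology (subtopology (mtop M) S) (top_of_set {0..})) (mtop M) (\<lambda>(p, t). \<Phi> p t)"
  using homeomorphic_imp_continuous_map[OF homeo_flow] by (rule continuous_map_into_fulltopology)

lemma continuous_proj: "continuous_map (subtopology (mtop M) E)
    (prod_topology (subtopology (mtop M) S) (top_of_set {0..})) (\<lambda>q. (\<pi> q, s q))"
proof -
  obtain g where g: "homeomorphic_maps (prod_topology (subtopology (mtop M) S) (top_of_set {0..}))
      (subtopology (mtop M) E) (\<lambda>(p, t). \<Phi> p t) g"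
    using homeo_flow homeomorphic_map_maps by blast
  then have "continuous_map (subtopology (mtop M) E) (prod_topology (subtopology (mtop M) S) (top_of_set {0..})) g"
    by (simp add: homeomorphic_maps_def)
  moreover have "g q = (\<pi> q, s q)" if "q \<in> topspace (subtopology (mtop M) E)" for q
  proof -
    have q: "q \<in> E" using that by simp
    have "(\<pi> q, s q) \<in> S \<times> {0..}" using E_proj[OF q] by simp
    then have "g ((\<lambda>(p, t). \<Phi> p t) (\<pi> q, s q)) = (\<pi> q, s q)"
      using g unfolding homeomorphic_maps_def topspace_cyl by blast
    then show ?thesis using E_proj(3)[OF q] by simp
  qed
  ultimately show ?thesis by (rule continuous_map_eq)
qed

lemma continuous_base: "continuous_map (subtopology (mtop M) E) (mtop M) \<pi>"
  using continuous_map_compose[OF continuous_proj continuous_map_fst]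
  by (simp add: o_def continuous_map_in_subtopology)

lemma continuous_time: "continuous_map (subtopology (mtop M) E) euclideanreal s"
  using continuous_map_compose[OF continuous_proj continuous_map_snd]
  by (simp add: o_def continuous_map_in_subtopology)

text \<open>The complement is compact, hence closed in a Hausdorff space.\<close>

lemma open_U0: "openin (mtop M) U0"
proof -
  have "closedin (mtop M) (topspace (mtop M) - U0)"
    using compact_rest Hausdorff compactin_imp_closedin by blast
  moreover have "U0 \<subseteq> topspace (mtop M)" using U0_iff E_subset by auto
  ultimately show ?thesis by (simp add: openin_closedin_eq)
qed

text \<open>Points of \<open>S\<close> have time 0, so the closed set \<open>S\<close> lies in the
  compact complement of \<open>U0\<close>.\<close>

lemma compact_S: "compactin (mtop M) S"
proof (rule closed_compactin[OF compact_rest _ closed_S])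
  show "S \<subseteq> topspace (mtop M) - U0" using S_subset S_in_E(3) by (force simp: U0_iff)
qed

lemma compact_slab: "compactin (mtop M) {\<Phi> p t |p t. p \<in> S \<and> 0 \<le> t \<and> t \<le> T}"
proof -
  have "compactin (prod_topology (subtopology (mtop M) S) (top_of_set {0..})) (S \<times> {0..T})"
    using compact_S by (simp add: compactin_Times compactin_subtopology)
  then have "compactin (mtop M) ((\<lambda>(p, t). \<Phi> p t) ` (S \<times> {0..T}))"
    by (rule image_compactin[OF _ continuous_flow])
  moreover have "(\<lambda>(p, t). \<Phi> p t) ` (S \<times> {0..T}) = {\<Phi> p t |p t. p \<in> S \<and> 0 \<le> t \<and> t \<le> T}" by force
  ultimately show ?thesis by simp
qed

lemma open_base_preimage:
  assumes "openin (mtop M) W"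
  obtains W' where "openin (mtop M) W'" "\<And>q. q \<in> E \<Longrightarrow> q \<in> W' \<longleftrightarrow> \<pi> q \<in> W"
proof -
  have "openin (subtopology (mtop M) E) {q \<in> topspace (subtopology (mtop M) E). \<pi> q \<in> W}"
    by (rule openin_continuous_map_preimage[OF continuous_base assms])
  then obtain W' where W': "openin (mtop M) W'" "{q \<in> topspace (subtopology (mtop M) E). \<pi> q \<in> W} = W' \<inter> E"
    by (auto simp: openin_subtopology)
  have "q \<in> W' \<longleftrightarrow> \<pi> q \<in> W" if "q \<in> E" for q using W'(2) that E_subset by auto
  with W'(1) show ?thesis by (rule that)
qed

section \<open>Smoothness of the base point, the time and the flow\<close>

lemma smooth_base_time:
  assumes "c \<in> atlas M" "c' \<in> atlas M"
  shows "smooth_on (cimage c {q \<in> E. \<pi> q \<in> fst c'}) (\<lambda>x. (snd c' (\<pi> (pt c x)), s (pt c x)))"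
proof -
  have "{q. \<exists>p\<in>S \<inter> fst c'. \<exists>t\<ge>0. q = \<Phi> p t} = {q \<in> E. \<pi> q \<in> fst c'}"
    by (auto simp: E_def)
  then show ?thesis using smooth_proj[OF assms] by simp
qed

text \<open>\<open>smooth_base_time\<close> needs all base points in one chart \<open>c'\<close>.
  Continuity of \<open>\<pi>\<close> achieves this near each point, which is enough for smoothness
  statements.\<close>

lemma base_chart_nbhd:
  assumes "c \<in> atlas M" "x \<in> cimage c E"
  obtains c1 U where "c1 \<in> atlas M" "open U" "x \<in> U"
    "\<And>y. y \<in> cimage c E \<Longrightarrow> y \<in> U \<Longrightarrow> y \<in> cimage c {q \<in> E. \<pi> q \<in> fst c1}"
proof -
  have q: "pt c x \<in> E" "pt c x \<in> fst c" "x \<in> cimage c UNIV" "snd c (pt c x) = x"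
    using assms(2) cimage_iff[OF assms(1), of x E] pt_in[of x c] snd_pt[of x c] by auto
  then have "\<pi> (pt c x) \<in> topspace (mtop M)" using E_proj(1) S_subset by blast
  then obtain c1 where c1: "c1 \<in> atlas M" "\<pi> (pt c x) \<in> fst c1" by (rule chart_obtain)
  obtain W where W: "openin (mtop M) W" "\<And>q. q \<in> E \<Longrightarrow> q \<in> W \<longleftrightarrow> \<pi> q \<in> fst c1"
    using open_base_preimage[OF open_domain[OF c1(1)]] by blast
  have "pt c x \<in> W" using W(2) q(1) c1(2) by simp
  obtain U where U: "open U" "snd c (pt c x) \<in> U" "\<And>y. y \<in> cimage c UNIV \<Longrightarrow> y \<in> U \<Longrightarrow> pt c y \<in> W"
    using open_cimage_nbhd[OF assms(1) W(1) q(2) \<open>pt c x \<in> W\<close>] by blast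
  have "y \<in> cimage c {q \<in> E. \<pi> q \<in> fst c1}" if "y \<in> cimage c E" "y \<in> U" for y
  proof -
    have "y \<in> cimage c UNIV" "pt c y \<in> E" using that cimage_iff[OF assms(1), of y E] by auto
    then show ?thesis using U(3) that(2) W(2) cimage_iff[OF assms(1), of y "{q \<in> E. \<pi> q \<in> fst c1}"] by auto
  qed
  with c1(1) U(1) U(2)[unfolded q(4)] show ?thesis by (rule that)
qed

lemma smooth_time:
  assumes "c \<in> atlas M"
  shows "smooth_on (cimage c E) (\<lambda>x. s (pt c x))"
proof (rule smooth_on_local)
  fix x assume "x \<in> cimage c E"
  then obtain c1 U where U: "c1 \<in> atlas M" "open U" "x \<in> U"
    "\<And>y. y \<in> cimage c E \<Longrightarrow> y \<in> U \<Longrightarrow> y \<in> cimage c {q \<in> E. \<pi> q \<in> fst c1}"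
    using base_chart_nbhd[OF assms] by blast
  have "smooth_on (cimage c {q \<in> E. \<pi> q \<in> fst c1}) (\<lambda>x. snd (snd c1 (\<pi> (pt c x)), s (pt c x)))"
    by (rule smooth_on_compose[OF smooth_base_time[OF assms U(1)]
          smooth_on_bounded_linear[OF bounded_linear_snd] subset_UNIV])
  then have "smooth_on (cimage c E \<inter> U) (\<lambda>x. snd (snd c1 (\<pi> (pt c x)), s (pt c x)))"
    by (rule smooth_on_subset) (use U(4) in blast)
  then show "\<exists>U. open U \<and> x \<in> U \<and> smooth_on (cimage c E \<inter> U) (\<lambda>x. s (pt c x))"
    using U(2,3) by auto
qed

text \<open>The flow is given as smooth in coordinates on \<open>S\<close>. Composing with the base
  point map makes it smooth in the coordinates of any point of the end, as is needed when a later
  level replaces \<open>S\<close>.\<close>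

lemma smooth_flow_base:
  assumes "c \<in> atlas M" "c' \<in> atlas M"
  shows "smooth_on {(x, u). x \<in> cimage c E \<and> 0 \<le> u \<and> \<Phi> (\<pi> (pt c x)) u \<in> fst c'}
    (\<lambda>(x, u). snd c' (\<Phi> (\<pi> (pt c x)) u))" (is "smooth_on ?A ?f")
proof (rule smooth_on_local)
  fix z assume z: "z \<in> ?A"
  then have "fst z \<in> cimage c E" by auto
  then obtain c1 U where U: "c1 \<in> atlas M" "open U" "fst z \<in> U"
    "\<And>y. y \<in> cimage c E \<Longrightarrow> y \<in> U \<Longrightarrow> y \<in> cimage c {q \<in> E. \<pi> q \<in> fst c1}"
    using base_chart_nbhd[OF assms(1)] by blast
  let ?B = "?A \<inter> U \<times> UNIV"
  let ?h = "\<lambda>z. (fst (snd c1 (\<pi> (pt c (fst z))), s (pt c (fst z))), snd z)"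
  have "smooth_on ?B (\<lambda>z. (snd c1 (\<pi> (pt c (fst z))), s (pt c (fst z))))"
    by (rule smooth_on_compose[OF smooth_on_bounded_linear[OF bounded_linear_fst] smooth_base_time[OF assms(1) U(1)]])
      (use U(4) in auto)
  then have "smooth_on ?B (\<lambda>z. fst (snd c1 (\<pi> (pt c (fst z))), s (pt c (fst z))))"
    by (rule smooth_on_compose[OF _ smooth_on_bounded_linear[OF bounded_linear_fst] subset_UNIV])
  then have h: "smooth_on ?B ?h"
    by (rule smooth_on_Pair[OF _ smooth_on_bounded_linear[OF bounded_linear_snd]])
  have pt1: "pt c1 (snd c1 (\<pi> (pt c x))) = \<pi> (pt c x)" "\<pi> (pt c x) \<in> fst c1" "\<pi> (pt c x) \<in> S"
    if "x \<in> cimage c E" "x \<in> U" for x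
  proof -
    have "pt c x \<in> E" "\<pi> (pt c x) \<in> fst c1"
      using U(4)[OF that] cimage_iff[OF assms(1), of x "{q \<in> E. \<pi> q \<in> fst c1}"] by auto
    then show "pt c1 (snd c1 (\<pi> (pt c x))) = \<pi> (pt c x)" "\<pi> (pt c x) \<in> fst c1" "\<pi> (pt c x) \<in> S"
      using pt_snd[OF U(1)] E_proj(1) by auto
  qed
  have "smooth_on ?B (\<lambda>z. (\<lambda>(x, t). snd c' (\<Phi> (pt c1 x) t)) (?h z))"
    by (rule smooth_on_compose[OF h smooth_flow[OF U(1) assms(2)]]) (use pt1 in \<open>auto intro!: cimageI\<close>)
  moreover have "?f z = (\<lambda>(x, t). snd c' (\<Phi> (pt c1 x) t)) (?h z)" if "z \<in> ?B" for z
    using that pt1 by auto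
  ultimately have "smooth_on ?B ?f"
    using smooth_on_cong[of ?B ?f "\<lambda>z. (\<lambda>(x, t). snd c' (\<Phi> (pt c1 x) t)) (?h z)"] by blast
  moreover have "open (U \<times> (UNIV :: real set))" "z \<in> U \<times> UNIV"
    using U(2,3) by (auto intro: open_Times simp: mem_Times_iff)
  ultimately show "\<exists>V. open V \<and> z \<in> V \<and> smooth_on (?A \<inter> V) ?f" by blast
qed

text \<open>The coordinates of such a chart are those of \<open>S\<close>, with the edges of \<open>S\<close> moved to the faces of
  the quadrant, together with the time.\<close>

lemma adapted_chart:
  assumes "p \<in> S"
  obtains c b N where "c \<in> atlas M" "b \<in> Basis" "p \<in> N" "N \<subseteq> S"
    "fst c = {q \<in> U0. \<pi> q \<in> N}" "\<And>q. q \<in> fst c \<Longrightarrow> snd c q \<bullet> b = s q"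
proof -
  obtain c0 B C where card: "card B = 1" and model: "local_model M S p c0 B C"
    using hyp assms unfolding proper_hypersurface_def submanifold_def by blast
  then obtain b where B: "B = {b}" using card_1_singletonE by blast
  have c0: "c0 \<in> atlas M" "p \<in> fst c0" and b: "b \<in> Basis" and C: "C \<subseteq> Basis" "b \<notin> C"
    using model by (auto simp: local_model_def charts_at_def B)
  define a where "a = snd c0 p"
  define e where "e = (\<Sum>i\<in>C. (a \<bullet> i) *\<^sub>R i)"
  have c0S: "cimage c0 S = {x \<in> cimage c0 UNIV. x \<bullet> b = a \<bullet> b \<and> (\<forall>i\<in>C. a \<bullet> i \<le> x \<bullet> i)}"
    using model by (simp add: local_model_def B a_def)
  obtain G where G: "open G" "cimage c0 UNIV = quadrant \<inter> G"
    using open_cimage[OF c0(1)] by (auto simp: openin_open)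
  have a_nonneg: "0 \<le> a \<bullet> i" if "i \<in> Basis" for i
    using cimageI[OF c0(2) UNIV_I] G(2) that by (auto simp: a_def quadrant_def)
  have e_inner: "e \<bullet> i = (if i \<in> C then a \<bullet> i else 0)" if "i \<in> Basis" for i
  proof -
    have "e \<bullet> i = (\<Sum>j\<in>C. (a \<bullet> j) * (j \<bullet> i))" by (simp add: e_def inner_sum_left)
    also have "\<dots> = (\<Sum>j\<in>C. if j = i then a \<bullet> j else 0)"
      using C that by (intro sum.cong) (auto simp: inner_Basis)
    also have "\<dots> = (if i \<in> C then a \<bullet> i else 0)"
      using finite_subset[OF C(1) finite_Basis] by simp
    finally show ?thesis .
  qed
  define N where "N = S \<inter> fst c0"
  define D where "D = {q \<in> U0. \<pi> q \<in> N}"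
  \<comment> \<open>On \<open>S\<close> the coordinate along \<open>b\<close> is constantly
    \<open>a \<bullet> b\<close>, so \<open>A\<close> replaces it by the time, besides subtracting
    the lower bounds collected in \<open>e\<close>. Conversely \<open>L\<close> forgets the time and
    restores the coordinates on \<open>S\<close>.\<close>
  define A where "A = (\<lambda>(y, t). y - e + (t - a \<bullet> b) *\<^sub>R b)"
  define L where "L x = x + e + (a \<bullet> b - x \<bullet> b) *\<^sub>R b" for x
  define \<kappa> where "\<kappa> q = A (snd c0 (\<pi> q), s q)" for q
  define \<Psi> where "\<Psi> x = \<Phi> (pt c0 (L x)) (x \<bullet> b)" for x
  define c where "c = (D, \<kappa>)"
  have A_inner: "A (y, t) \<bullet> i = (if i = b then y \<bullet> b + t - a \<bullet> b else if i \<in> C then y \<bullet> i - a \<bullet> i else y \<bullet> i)"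
    if "i \<in> Basis" for y t i
    using that b C e_inner[OF that] by (auto simp: A_def inner_add_left inner_diff_left inner_Basis)
  have L_inner: "L x \<bullet> i = (if i = b then a \<bullet> b else if i \<in> C then x \<bullet> i + a \<bullet> i else x \<bullet> i)"
    if "i \<in> Basis" for x i
    using that b C e_inner[OF that] by (auto simp: L_def inner_add_left inner_diff_left inner_Basis)
  have D_props: "q \<in> E" "q \<in> topspace (mtop M)" "\<pi> q \<in> S" "\<pi> q \<in> fst c0" "0 < s q"
    "snd c0 (\<pi> q) \<in> cimage c0 S" "snd c0 (\<pi> q) \<bullet> b = a \<bullet> b" if "q \<in> D" for q
  proof -
    show 1: "q \<in> E" "\<pi> q \<in> S" "\<pi> q \<in> fst c0" "0 < s q"
      using that by (auto simp: D_def N_def U0_iff)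
    then show "q \<in> topspace (mtop M)" using E_subset by blast
    show "snd c0 (\<pi> q) \<in> cimage c0 S" using 1 by (intro cimageI)
    then show "snd c0 (\<pi> q) \<bullet> b = a \<bullet> b" by (simp add: c0S)
  qed
  have L_\<kappa>: "L (\<kappa> q) = snd c0 (\<pi> q)" and \<kappa>_b: "\<kappa> q \<bullet> b = s q" if "q \<in> D" for q
  proof -
    have "L (\<kappa> q) \<bullet> i = snd c0 (\<pi> q) \<bullet> i" if "i \<in> Basis" for i
      using D_props(7)[OF \<open>q \<in> D\<close>] that b by (simp add: L_inner \<kappa>_def A_inner)
    then show "L (\<kappa> q) = snd c0 (\<pi> q)" by (rule euclidean_eqI)
    show "\<kappa> q \<bullet> b = s q" using D_props(7)[OF that] b by (simp add: \<kappa>_def A_inner)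
  qed
  \<comment> \<open>The image of the chart under construction. For \<open>x\<close> in the quadrant,
    \<open>L x\<close> satisfies the bounds that define \<open>S\<close> automatically; what remains
    is that \<open>L x\<close> lies in the open set \<open>G\<close>, and that the time is
    positive.\<close>
  define R where "R = {x \<in> quadrant. 0 < x \<bullet> b \<and> L x \<in> G}"
  have L_R: "L x \<in> cimage c0 S" if "x \<in> R" for x
  proof -
    have "0 \<le> L x \<bullet> i" if "i \<in> Basis" for i
      using \<open>x \<in> R\<close> a_nonneg that by (auto simp: R_def quadrant_def L_inner)
    then have "L x \<in> cimage c0 UNIV" using that G(2) by (auto simp: R_def quadrant_def)
    moreover have "a \<bullet> i \<le> L x \<bullet> i" if "i \<in> C" for i
      using \<open>x \<in> R\<close> that C by (auto simp: R_def quadrant_def L_inner subset_eq)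
    ultimately show ?thesis using b by (simp add: c0S L_inner)
  qed
  have \<Psi>: "\<Psi> x \<in> D" "\<kappa> (\<Psi> x) = x" if "x \<in> R" for x
  proof -
    have r: "pt c0 (L x) \<in> S" "pt c0 (L x) \<in> fst c0" "snd c0 (pt c0 (L x)) = L x" "L x \<in> cimage c0 UNIV"
      using L_R[OF that] cimage_iff[OF c0(1), of "L x" S] pt_in[of "L x" c0] snd_pt[of "L x" c0] by auto
    have t: "0 < x \<bullet> b" using that by (simp add: R_def)
    then have pr: "\<pi> (\<Psi> x) = pt c0 (L x)" "s (\<Psi> x) = x \<bullet> b" using r(1) by (auto simp: \<Psi>_def)
    show "\<Psi> x \<in> D" using r t pr by (auto simp: D_def N_def U0_iff \<Psi>_def)
    have "\<kappa> (\<Psi> x) \<bullet> i = x \<bullet> i" if "i \<in> Basis" for i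
      using that b by (simp add: \<kappa>_def pr r(3) A_inner L_inner)
    then show "\<kappa> (\<Psi> x) = x" by (rule euclidean_eqI)
  qed
  have \<kappa>_R: "\<kappa> q \<in> R" and \<Psi>_\<kappa>: "\<Psi> (\<kappa> q) = q" if "q \<in> D" for q
  proof -
    have y: "snd c0 (\<pi> q) \<in> quadrant" "snd c0 (\<pi> q) \<in> G" "\<forall>i\<in>C. a \<bullet> i \<le> snd c0 (\<pi> q) \<bullet> i"
      using D_props(6)[OF that] G(2) by (auto simp: c0S)
    have "0 \<le> \<kappa> q \<bullet> i" if "i \<in> Basis" for i
      using y(1,3) D_props(5,7)[OF \<open>q \<in> D\<close>] that by (auto simp: \<kappa>_def A_inner quadrant_def)
    then show "\<kappa> q \<in> R"
      using L_\<kappa>[OF that] y(2) \<kappa>_b[OF that] D_props(5)[OF that] by (auto simp: R_def quadrant_def)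
    show "\<Psi> (\<kappa> q) = q"
      using L_\<kappa>[OF that] \<kappa>_b[OF that] pt_snd[OF c0(1) D_props(4)[OF that]] E_proj(3)[OF D_props(1)[OF that]]
      by (simp add: \<Psi>_def)
  qed
  have img: "cimage c UNIV = R"
    unfolding cimage_UNIV c_def fst_conv snd_conv using \<kappa>_R \<Psi> by force
  have inj: "inj_on \<kappa> D" by (rule inj_on_inverseI[where g = \<Psi>]) (rule \<Psi>_\<kappa>)
  have pt_c: "pt c x = \<Psi> x" if "x \<in> R" for x
    unfolding pt_def c_def fst_conv snd_conv
    using inv_into_f_f[OF inj \<Psi>(1)[OF that]] \<Psi>(2)[OF that] by simp
  have A_lin: "A = (\<lambda>z. (fst z + snd z *\<^sub>R b) + (- e - (a \<bullet> b) *\<^sub>R b))"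
    by (auto simp: A_def fun_eq_iff algebra_simps)
  have bl: "bounded_linear (\<lambda>z::'e \<times> real. fst z + snd z *\<^sub>R b)"
    by (intro bounded_linear_add bounded_linear_fst bounded_linear_scaleR_const bounded_linear_snd)
  have smA: "smooth_on T A" for T
    unfolding A_lin by (intro smooth_on_add smooth_on_bounded_linear[OF bl] smooth_on_const)
  have L_lin: "L = (\<lambda>x. (x + (- (x \<bullet> b)) *\<^sub>R b) + (e + (a \<bullet> b) *\<^sub>R b))"
    by (auto simp: L_def fun_eq_iff algebra_simps)
  have bl': "bounded_linear (\<lambda>x. x + (- (x \<bullet> b)) *\<^sub>R b)"
    by (intro bounded_linear_add bounded_linear_ident bounded_linear_scaleR_const bounded_linear_minus
        bounded_linear_inner_left)
  have smL: "smooth_on T L" for T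
    unfolding L_lin by (intro smooth_on_add smooth_on_bounded_linear[OF bl'] smooth_on_const)
  have contL: "continuous_on T L" for T by (rule smooth_on_imp_continuous_on[OF smL])
  have contA: "continuous_on T A" for T by (rule smooth_on_imp_continuous_on[OF smA])
  have openD: "openin (mtop M) D"
  proof -
    obtain W where W: "openin (mtop M) W" "\<And>q. q \<in> E \<Longrightarrow> q \<in> W \<longleftrightarrow> \<pi> q \<in> fst c0"
      using open_base_preimage[OF open_domain[OF c0(1)]] by blast
    have "D = W \<inter> U0" using W(2) by (auto simp: D_def N_def U0_iff E_proj(1))
    then show ?thesis using W(1) open_U0 by (simp add: openin_Int)
  qed
  have homeo: "homeomorphic_maps (subtopology (mtop M) D) (top_of_set R) \<kappa> \<Psi>"
    unfolding homeomorphic_maps_def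
  proof (intro conjI ballI)
    have DE: "D \<subseteq> E" using D_props(1) by auto
    have sub: "subtopology (mtop M) D = subtopology (subtopology (mtop M) E) D"
      using DE by (simp add: subtopology_subtopology Int_absorb1)
    have "continuous_map (subtopology (mtop M) D) (subtopology (mtop M) (fst c0)) \<pi>"
      using continuous_map_from_subtopology[OF continuous_base, of D] D_props(4)
      by (auto simp: sub continuous_map_in_subtopology)
    then have "continuous_map (subtopology (mtop M) D) (top_of_set (cimage c0 UNIV)) (snd c0 \<circ> \<pi>)"
      by (rule continuous_map_compose[OF _ homeomorphic_imp_continuous_map[OF homeo_chart[OF c0(1)]]])
    then have "continuous_map (subtopology (mtop M) D) euclidean (\<lambda>q. snd c0 (\<pi> q))"
      by (simp add: o_def continuous_map_in_subtopology)
    moreover have "continuous_map (subtopology (mtop M) D) euclidean s"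
      unfolding sub by (rule continuous_map_from_subtopology[OF continuous_time])
    ultimately have "continuous_map (subtopology (mtop M) D) (prod_topology euclidean euclidean) (\<lambda>q. (snd c0 (\<pi> q), s q))"
      by (rule continuous_map_pairedI)
    then have "continuous_map (subtopology (mtop M) D) euclidean (\<lambda>q. (snd c0 (\<pi> q), s q))"
      by (simp only: prod_topology_euclidean)
    moreover have "continuous_map euclidean euclidean A" using contA[of UNIV] by simp
    ultimately have "continuous_map (subtopology (mtop M) D) euclidean (A \<circ> (\<lambda>q. (snd c0 (\<pi> q), s q)))"
      by (rule continuous_map_compose)
    then have "continuous_map (subtopology (mtop M) D) euclidean \<kappa>" by (simp add: \<kappa>_def[abs_def] o_def)
    then show "continuous_map (subtopology (mtop M) D) (top_of_set R) \<kappa>"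
      using \<kappa>_R by (auto simp: continuous_map_in_subtopology)
    have "continuous_map (top_of_set R) (top_of_set (cimage c0 UNIV)) L"
      using contL[of R] L_R cimage_subset[of c0 S] by (auto simp: continuous_map_in_subtopology)
    then have "continuous_map (top_of_set R) (subtopology (mtop M) (fst c0)) (pt c0 \<circ> L)"
      by (rule continuous_map_compose[OF _ continuous_pt[OF c0(1)]])
    then have "continuous_map (top_of_set R) (subtopology (mtop M) S) (\<lambda>x. pt c0 (L x))"
      using L_R by (auto simp: continuous_map_in_subtopology o_def dest!: cimage_iff[OF c0(1), of _ S, THEN iffD1])
    moreover have "continuous_map (top_of_set R) (top_of_set {0..}) (\<lambda>x. x \<bullet> b)"
      by (auto simp: continuous_map_in_subtopology R_def intro!: continuous_intros)
    ultimately have "continuous_map (top_of_set R) (prod_topology (subtopology (mtop M) S) (top_of_set {0..}))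
        (\<lambda>x. (pt c0 (L x), x \<bullet> b))" by (rule continuous_map_pairedI)
    from continuous_map_compose[OF this continuous_flow]
    have "continuous_map (top_of_set R) (mtop M) \<Psi>" by (simp add: o_def \<Psi>_def[abs_def])
    then show "continuous_map (top_of_set R) (subtopology (mtop M) D) \<Psi>"
      using \<Psi>(1) by (auto simp: continuous_map_in_subtopology)
    show "\<Psi> (\<kappa> q) = q" if "q \<in> topspace (subtopology (mtop M) D)" for q
      using that \<Psi>_\<kappa> by simp
    show "\<kappa> (\<Psi> x) = x" if "x \<in> topspace (top_of_set R)" for x
      using that \<Psi>(2) by simp
  qed
  have "is_chart (mtop M) c"
    unfolding is_chart_def img
  proof (intro conjI)
    show "openin (mtop M) (fst c)" using openD by (simp add: c_def)
    have "open {x. 0 < x \<bullet> b \<and> L x \<in> G}"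
    proof -
      have "open {x. 0 < x \<bullet> b}" by (intro open_Collect_less continuous_intros)
      moreover have "open (L -` G)" using contL[of UNIV] G(1) by (simp add: open_vimage)
      ultimately have "open ({x. 0 < x \<bullet> b} \<inter> L -` G)" by (rule open_Int)
      then show ?thesis by (simp add: Collect_conj_eq vimage_def)
    qed
    then show "openin (top_of_set quadrant) R"
      unfolding openin_open R_def by blast
    show "homeomorphic_map (subtopology (mtop M) (fst c)) (top_of_set R) (snd c)"
      using homeo homeomorphic_map_maps by (auto simp: c_def)
  qed
  \<comment> \<open>In one direction the transition map is the flow after the affine map
    \<open>L\<close>, in the other it is the affine map \<open>A\<close> after base point and
    time.\<close>
  moreover have "compatible c c'" if c': "c' \<in> atlas M" for c'
    unfolding compatible_def
  proof
    have in_R: "x \<in> R \<and> \<Psi> x \<in> fst c'" if x: "x \<in> cimage c (fst c')" for x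
    proof -
      obtain q where q: "q \<in> D" "q \<in> fst c'" "x = \<kappa> q" using x by (auto simp: cimage_def c_def)
      then show ?thesis using \<kappa>_R \<Psi>_\<kappa> by simp
    qed
    have h: "smooth_on (cimage c (fst c')) (\<lambda>x. (L x, x \<bullet> b))"
      by (intro smooth_on_Pair smL smooth_on_bounded_linear bounded_linear_inner_left)
    have "smooth_on (cimage c (fst c')) (\<lambda>x. (\<lambda>(x, t). snd c' (\<Phi> (pt c0 x) t)) (L x, x \<bullet> b))"
    proof (rule smooth_on_compose[OF h smooth_flow[OF c0(1) c']], rule image_subsetI)
      fix x assume x: "x \<in> cimage c (fst c')"
      have "0 \<le> x \<bullet> b" using in_R[OF x] by (simp add: R_def)
      then show "(L x, x \<bullet> b) \<in> {(x, t). x \<in> cimage c0 S \<and> 0 \<le> t \<and> \<Phi> (pt c0 x) t \<in> fst c'}"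
        using in_R[OF x] L_R by (auto simp: \<Psi>_def)
    qed
    then show "smooth_on (cimage c (fst c')) (snd c' \<circ> pt c)"
      by (rule smooth_on_cong[THEN iffD1, rotated]) (use in_R pt_c in \<open>auto simp: \<Psi>_def\<close>)
    have DE: "D \<subseteq> {q \<in> E. \<pi> q \<in> fst c0}" using D_props(1,4) by auto
    have fstc: "fst c = D" by (simp add: c_def)
    have sub: "cimage c' (fst c) \<subseteq> cimage c' {q \<in> E. \<pi> q \<in> fst c0}"
      using DE by (auto simp: cimage_def fstc)
    have "smooth_on (cimage c' (fst c)) (\<lambda>x. A (snd c0 (\<pi> (pt c' x)), s (pt c' x)))"
      by (rule smooth_on_compose[OF smooth_on_subset[OF smooth_base_time[OF c' c0(1)] sub] smA subset_UNIV])
    then show "smooth_on (cimage c' (fst c)) (snd c \<circ> pt c')"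
      by (rule smooth_on_cong[THEN iffD1, rotated]) (simp add: c_def \<kappa>_def)
  qed
  ultimately have "c \<in> atlas M" by (rule atlas_maximal)
  moreover have "p \<in> N" "N \<subseteq> S" using assms c0(2) by (auto simp: N_def)
  moreover have "fst c = {q \<in> U0. \<pi> q \<in> N}" by (simp add: c_def D_def)
  moreover have "snd c q \<bullet> b = s q" if "q \<in> fst c" for q using that \<kappa>_b by (simp add: c_def)
  ultimately show ?thesis using b that by blast
qed

end

section \<open>One-sided derivatives along curves\<close>

lemma chain_rule_curve:
  assumes "(F has_derivative D) (at x within A)" "(\<alpha> has_vector_derivative v) (at t within I)"
    and "\<alpha> t = x" "\<alpha> ` I \<subseteq> A"
  shows "((\<lambda>r. F (\<alpha> r)) has_vector_derivative D v) (at t within I)"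
  using vector_derivative_diff_chain_within[OF assms(2), of F D] has_derivative_subset[OF assms(1,4)] assms(3)
  by (simp add: o_def)

lemma vector_derivative_unique_Icc:
  fixes f g :: "real \<Rightarrow> 'b::euclidean_space"
  assumes "(f has_vector_derivative v) (at a within {a..b})" "(g has_vector_derivative w) (at a within {a..b})"
    and "a < b" "\<And>t. t \<in> {a..b} \<Longrightarrow> f t = g t"
  shows "v = w"
proof -
  have "(f has_vector_derivative w) (at a within {a..b})"
    by (rule has_vector_derivative_transform[OF _ _ assms(2)]) (use assms(3,4) in auto)
  with assms(1,3) show ?thesis
    using vector_derivative_unique_within_closed_interval[of a b a f v w] by simp
qed

context corner_manifold
begin

text \<open>A direction that does not decrease the vanishing coordinates keeps them nonnegative, and
  the positive coordinates stay positive for a short time. At interior points every direction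
  qualifies.\<close>

lemma line_in_cimage:
  assumes c: "c \<in> atlas M" and W: "openin (mtop M) W" and p: "p \<in> fst c" "p \<in> W"
    and v: "\<And>i. i \<in> Basis \<Longrightarrow> snd c p \<bullet> i = 0 \<Longrightarrow> 0 \<le> v \<bullet> i"
  shows "\<exists>\<epsilon>>0. \<forall>t\<in>{0..\<epsilon>}. snd c p + t *\<^sub>R v \<in> cimage c W"
proof -
  let ?x = "snd c p"
  have "openin (top_of_set quadrant) (cimage c W)"
    by (rule openin_trans[OF open_cimage_openin[OF c W] open_cimage[OF c]])
  then obtain G where G: "open G" "cimage c W = quadrant \<inter> G" by (auto simp: openin_open)
  have x: "?x \<in> quadrant" "?x \<in> G" using cimageI[OF p] G(2) by auto
  define H where "H = G \<inter> (\<Inter>i\<in>{i\<in>Basis. 0 < ?x \<bullet> i}. {y. 0 < y \<bullet> i})"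
  have "open {y. 0 < y \<bullet> i}" for i :: 'e by (intro open_Collect_less continuous_intros)
  then have "open H" unfolding H_def using G(1) by (intro open_Int open_INT) auto
  moreover have "?x \<in> H" using x by (auto simp: H_def)
  ultimately obtain r where r: "0 < r" "ball ?x r \<subseteq> H" by (meson openE)
  \<comment> \<open>The summand 1 keeps the quotient defining \<open>\<epsilon>\<close> meaningful
    when \<open>v\<close> is zero; steps up to \<open>\<epsilon>\<close> have length at most
    \<open>r / 2\<close>.\<close>
  define n where "n = norm v + 1"
  define \<epsilon> where "\<epsilon> = r / 2 / n"
  have n: "0 < n" by (simp add: n_def add_nonneg_pos)
  then have \<epsilon>: "0 < \<epsilon>" using r(1) by (simp add: \<epsilon>_def)
  have "?x + t *\<^sub>R v \<in> cimage c W" if "t \<in> {0..\<epsilon>}" for t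
  proof -
    have "norm (t *\<^sub>R v) \<le> \<epsilon> * n"
      using that by (simp add: mult_mono n_def)
    also have "\<dots> = r / 2" using n by (simp add: \<epsilon>_def)
    also have "\<dots> < r" using r(1) by simp
    finally have "?x + t *\<^sub>R v \<in> ball ?x r" by (simp add: dist_norm)
    then have H: "?x + t *\<^sub>R v \<in> H" using r(2) by blast
    have "0 \<le> (?x + t *\<^sub>R v) \<bullet> i" if i: "i \<in> Basis" for i
    proof (cases "?x \<bullet> i = 0")
      case True
      then show ?thesis using v[OF i True] \<open>t \<in> _\<close> by (simp add: inner_add_left)
    next
      case False
      then have "0 < ?x \<bullet> i" using x(1) i unfolding quadrant_def by (auto simp: less_le)
      then have "?x + t *\<^sub>R v \<in> {y. 0 < y \<bullet> i}" using H i by (auto simp: H_def)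
      then show ?thesis by simp
    qed
    then show ?thesis using H by (auto simp: G(2) H_def quadrant_def)
  qed
  with \<epsilon> show ?thesis by blast
qed

end

context cylinder
begin

section \<open>Levels of the time as hypersurfaces\<close>

definition level :: "real \<Rightarrow> 'a set" where "level T = (\<lambda>p. \<Phi> p T) ` S"

lemma level_iff: "0 \<le> T \<Longrightarrow> q \<in> level T \<longleftrightarrow> q \<in> E \<and> s q = T"
  using E_proj[of q] by (auto simp: level_def intro!: image_eqI[of q _ "\<pi> q"])

text \<open>The adapted chart at the base point \<open>\<pi> q\<close> contains the rays at positive
  times over a piece of \<open>S\<close>, hence also \<open>q\<close>, and one of its coordinates is
  the time.\<close>

lemma level_chart:
  assumes "0 < T" "q \<in> level T"
  obtains c b where "c \<in> charts_at M q" "b \<in> Basis" "snd c q \<bullet> b = T"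
    "cimage c (level T) = {x \<in> cimage c UNIV. x \<bullet> b = T}"
proof -
  have q: "q \<in> E" "s q = T" using assms level_iff[of T q] by auto
  obtain c b N where c: "c \<in> atlas M" "b \<in> Basis" "\<pi> q \<in> N" "N \<subseteq> S"
    "fst c = {q \<in> U0. \<pi> q \<in> N}" "\<And>q. q \<in> fst c \<Longrightarrow> snd c q \<bullet> b = s q"
    using adapted_chart[OF E_proj(1)[OF q(1)]] by blast
  have qc: "q \<in> fst c" using c(3,5) q assms(1) by (simp add: U0_iff)
  have lev: "q' \<in> level T \<longleftrightarrow> snd c q' \<bullet> b = T" if "q' \<in> fst c" for q'
    using that c(5,6) level_iff[of T q'] assms(1) by (auto simp: U0_iff)
  have "cimage c (level T) = {x \<in> cimage c UNIV. x \<bullet> b = T}"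
    using lev by (auto simp: cimage_def)
  moreover have "snd c q \<bullet> b = T" using lev[OF qc] assms(2) by simp
  ultimately show ?thesis by (rule that[OF charts_atI[OF c(1) qc] c(2), rotated])
qed

lemma level_model:
  assumes "c \<in> charts_at M q" "b \<in> Basis" "snd c q \<bullet> b = T"
    "cimage c (level T) = {x \<in> cimage c UNIV. x \<bullet> b = T}"
  shows "local_model M (level T) q c {b} {}"
  using assms by (auto simp: local_model_def)

lemma closed_level:
  assumes "0 \<le> T"
  shows "closedin (mtop M) (level T)"
proof -
  have "closedin (subtopology (mtop M) E) {q \<in> topspace (subtopology (mtop M) E). s q \<in> {T}}"
    by (rule closedin_continuous_map_preimage[OF continuous_time]) simp
  moreover have "{q \<in> topspace (subtopology (mtop M) E). s q \<in> {T}} = level T"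
    using level_iff[OF assms] E_subset by auto
  ultimately show ?thesis using closedin_trans_full[OF _ closed_E] by simp
qed

lemma submanifold_level:
  assumes "0 < T"
  shows "submanifold M 1 (level T)"
  unfolding submanifold_def
proof (intro conjI ballI)
  show "level T \<subseteq> topspace (mtop M)" using closed_level[of T] assms closedin_subset by auto
  fix q assume "q \<in> level T"
  then obtain c b where "c \<in> charts_at M q" "b \<in> Basis" "snd c q \<bullet> b = T"
    "cimage c (level T) = {x \<in> cimage c UNIV. x \<bullet> b = T}" using level_chart[OF assms] by blast
  from level_model[OF this] show "\<exists>c B C. card B = 1 \<and> local_model M (level T) q c B C"
    by (intro exI[of _ c] exI[of _ "{b}"] exI[of _ "{}"]) simp
qed

text \<open>In the interior of \<open>M\<close>, a curve leaving an edge can be continued backwards in a chart in which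
  the level set is flat, so there are no edges.\<close>

lemma no_interior_edge:
  assumes "0 < T" and k: "k \<in> charts_at M q" "b \<in> Basis" "snd k q \<bullet> b = T"
      "cimage k (level T) = {x \<in> cimage k UNIV. x \<bullet> b = T}"
    and interior: "\<And>i. i \<in> Basis \<Longrightarrow> snd k q \<bullet> i \<noteq> 0"
    and model: "local_model M (level T) q c B C"
  shows "C = {}"
proof (rule ccontr)
  assume "C \<noteq> {}"
  then obtain d where d: "d \<in> C" by blast
  have c: "c \<in> atlas M" "q \<in> fst c" and dB: "d \<in> Basis" "d \<notin> B" and BC: "B \<subseteq> Basis" "C \<subseteq> Basis"
    and cl: "cimage c (level T) = {x \<in> cimage c UNIV. (\<forall>i\<in>B. x \<bullet> i = snd c q \<bullet> i) \<and> (\<forall>i\<in>C. snd c q \<bullet> i \<le> x \<bullet> i)}"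
    using model d by (auto simp: local_model_def charts_at_def)
  have k': "k \<in> atlas M" "q \<in> fst k" using k(1) by (auto simp: charts_at_def)
  let ?x = "snd c q" and ?y = "snd k q"
  let ?F = "snd k \<circ> pt c" and ?G = "snd c \<circ> pt k"
  have Fx: "?F ?x = ?y" and Gy: "?G ?y = ?x" using pt_snd[OF c] pt_snd[OF k'] by simp_all
  have sm: "smooth_on (cimage c (fst k)) ?F" "smooth_on (cimage k (fst c)) ?G"
    using atlas_compatible[OF c(1) k'(1)] by (simp_all add: compatible_def)
  have xin: "?x \<in> cimage c (fst k)" "?y \<in> cimage k (fst c)" using c k' by (auto intro: cimageI)
  obtain D where D: "(?F has_derivative D) (at ?x within cimage c (fst k))"
    by (rule smooth_on_derivativeE[OF sm(1) xin(1)]) (use xin in blast)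
  obtain D' where D': "(?G has_derivative D') (at ?y within cimage k (fst c))"
    by (rule smooth_on_derivativeE[OF sm(2) xin(2)]) (use xin in blast)
  have der: "((\<lambda>t. z + t *\<^sub>R v) has_vector_derivative v) (at 0 within I)" for z v :: 'e and I
    by (auto intro!: derivative_eq_intros simp: has_vector_derivative_def)
  \<comment> \<open>In the model given by \<open>c\<close>, the direction \<open>d\<close> runs
    inside the level: it fixes the coordinates in \<open>B\<close> and moves the coordinate
    \<open>d\<close> away from its lower bound.\<close>
  have "\<exists>\<epsilon>>0. \<forall>t\<in>{0..\<epsilon>}. ?x + t *\<^sub>R d \<in> cimage c (fst k)"
    by (rule line_in_cimage[OF c(1) open_domain[OF k'(1)] c(2) k'(2)]) (use dB(1) in \<open>simp add: inner_Basis\<close>)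
  then obtain \<epsilon> where \<epsilon>: "0 < \<epsilon>" "\<And>t. t \<in> {0..\<epsilon>} \<Longrightarrow> ?x + t *\<^sub>R d \<in> cimage c (fst k)"
    by blast
  have \<alpha>: "?x + t *\<^sub>R d \<in> cimage c (level T)" if "t \<in> {0..\<epsilon>}" for t
  proof -
    have "?x + t *\<^sub>R d \<in> cimage c UNIV" using \<epsilon>(2)[OF that] cimage_subset[of c "fst k"] by blast
    moreover have "d \<bullet> i = 0" if "i \<in> B" for i using that dB BC by (auto simp: inner_Basis)
    moreover have "0 \<le> d \<bullet> i" if "i \<in> C" for i using that dB BC by (auto simp: inner_Basis)
    ultimately show ?thesis using that by (simp add: cl inner_add_left)
  qed
  have F\<alpha>: "?F (?x + t *\<^sub>R d) \<in> cimage k (level T)" "?G (?F (?x + t *\<^sub>R d)) = ?x + t *\<^sub>R d"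
    "?F (?x + t *\<^sub>R d) \<in> cimage k (fst c)" if "t \<in> {0..\<epsilon>}" for t
  proof -
    let ?z = "?x + t *\<^sub>R d"
    have "?z \<in> cimage c UNIV" "pt c ?z \<in> fst k" "pt c ?z \<in> level T"
      using \<epsilon>(2)[OF that] \<alpha>[OF that] cimage_iff[OF c(1), of ?z "fst k"] cimage_iff[OF c(1), of ?z "level T"]
      by auto
    then show "?F ?z \<in> cimage k (level T)" "?G (?F ?z) = ?z" "?F ?z \<in> cimage k (fst c)"
      using pt_snd[OF k'(1)] snd_pt[of ?z c] pt_in[of ?z c] by (auto intro!: cimageI)
  qed
  define w where "w = D d"
  have dF: "((\<lambda>t. ?F (?x + t *\<^sub>R d)) has_vector_derivative w) (at 0 within {0..\<epsilon>})"
    unfolding w_def by (rule chain_rule_curve[OF D der]) (use \<epsilon>(2) in auto)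
  have "((\<lambda>t. ?F (?x + t *\<^sub>R d) \<bullet> b) has_vector_derivative w \<bullet> b) (at 0 within {0..\<epsilon>})"
    by (rule bounded_linear.has_vector_derivative[OF bounded_linear_inner_left dF])
  \<comment> \<open>The curve stays in the level, where the coordinate along \<open>b\<close> in
    \<open>k\<close> is constantly \<open>T\<close>; so \<open>w\<close> is tangent to the flat
    slice.\<close>
  then have wb: "w \<bullet> b = 0"
    by (rule vector_derivative_unique_Icc[OF _ has_vector_derivative_const[of T] \<epsilon>(1)]) (use F\<alpha>(1) k(4) in auto)
  have "((\<lambda>t. ?G (?F (?x + t *\<^sub>R d))) has_vector_derivative D' w) (at 0 within {0..\<epsilon>})"
    by (rule chain_rule_curve[OF D' dF]) (use F\<alpha>(3) Fx in auto)
  then have D'w: "D' w = d"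
    by (rule vector_derivative_unique_Icc[OF _ der[of ?x d] \<epsilon>(1)]) (use F\<alpha>(2) in auto)
  \<comment> \<open>Here the interior hypothesis enters: the straight line against \<open>w\<close>
    stays in the image of \<open>k\<close> for a short time, and by \<open>wb\<close> it stays in
    the level.\<close>
  obtain \<delta> where \<delta>: "0 < \<delta>" "\<And>t. t \<in> {0..\<delta>} \<Longrightarrow> ?y + t *\<^sub>R (- w) \<in> cimage k (fst c)"
    using line_in_cimage[OF k'(1) open_domain[OF c(1)] k'(2) c(2), of "- w"] interior by blast
  have "((\<lambda>t. ?G (?y + t *\<^sub>R (- w))) has_vector_derivative D' (- w)) (at 0 within {0..\<delta>})"
    by (rule chain_rule_curve[OF D' der]) (use \<delta>(2) in auto)
  moreover have "D' (- w) = - d"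
    using D'w has_derivative_linear[OF D'] by (simp add: linear_neg)
  ultimately have "((\<lambda>t. ?G (?y + t *\<^sub>R (- w))) has_vector_derivative - d) (at 0 within {0..\<delta>})"
    by (simp only:)
  then have "((\<lambda>t. ?G (?y + t *\<^sub>R (- w)) \<bullet> d) has_vector_derivative (- d) \<bullet> d) (at 0 within {0..\<delta>})"
    by (rule bounded_linear.has_vector_derivative[OF bounded_linear_inner_left])
  \<comment> \<open>Seen in \<open>c\<close>, that line starts with velocity \<open>- d\<close>, so
    the coordinate \<open>d\<close> falls below its value at \<open>q\<close>, against the bound
    imposed by the model.\<close>
  then have "((\<lambda>t. ?G (?y + t *\<^sub>R (- w)) \<bullet> d) has_real_derivative -1) (at 0 within {0..\<delta>})"
    using dB(1) by (simp add: has_real_derivative_iff_has_vector_derivative)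
  then obtain r where r: "0 < r" "\<And>h. 0 < h \<Longrightarrow> 0 + h \<in> {0..\<delta>} \<Longrightarrow> h < r \<Longrightarrow>
      ?G (?y + (0 + h) *\<^sub>R (- w)) \<bullet> d < ?G (?y + 0 *\<^sub>R (- w)) \<bullet> d"
    using has_real_derivative_neg_dec_right[of "\<lambda>t. ?G (?y + t *\<^sub>R (- w)) \<bullet> d" "-1" 0 "{0..\<delta>}"] by auto
  define h where "h = min r \<delta> / 2"
  have h: "0 < h" "h < r" "h \<in> {0..\<delta>}" using r(1) \<delta>(1) by (auto simp: h_def)
  let ?z = "?y + h *\<^sub>R (- w)"
  have "?z \<in> cimage k (level T)"
    using \<delta>(2)[OF h(3)] cimage_subset[of k "fst c"] wb k(3) by (auto simp: k(4) inner_add_left inner_diff_left)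
  then have "pt k ?z \<in> level T" "pt k ?z \<in> fst c"
    using \<delta>(2)[OF h(3)] cimage_iff[OF k'(1), of ?z "level T"] cimage_iff[OF k'(1), of ?z "fst c"] by auto
  then have "?G ?z \<in> cimage c (level T)" by (auto intro: cimageI)
  then have "?x \<bullet> d \<le> ?G ?z \<bullet> d" using cl d by auto
  moreover have "?G ?z \<bullet> d < ?x \<bullet> d" using r(2)[of h] h Gy by simp
  ultimately show False by simp
qed

text \<open>An edge at \<open>q\<close> comes with some model in a chart \<open>c\<close>, to be
  compared with the flat chart \<open>k\<close>. If neither puts \<open>q\<close> in
  \<open>meets_boundary\<close>, then no coordinate of \<open>q\<close> in \<open>k\<close>
  vanishes, the one along \<open>b\<close> being \<open>T > 0\<close>, and
  \<open>no_interior_edge\<close> excludes edges of the level itself.\<close>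

lemma proper_hypersurface_level:
  assumes "0 < T"
  shows "proper_hypersurface M (level T)"
  unfolding proper_hypersurface_def
proof (intro conjI equalityI subsetI)
  show "submanifold M 1 (level T)" by (rule submanifold_level[OF assms])
  show "closedin (mtop M) (level T)" using closed_level assms by simp
  show "q \<in> sub_boundary M (level T)" if "q \<in> meets_boundary M (level T)" for q
    using that unfolding sub_boundary_def meets_boundary_def by blast
  fix q assume "q \<in> sub_boundary M (level T)"
  then obtain c B C where q: "q \<in> level T" and model: "local_model M (level T) q c B C"
    and edge: "C \<noteq> {} \<or> (\<exists>b\<in>Basis - B. snd c q \<bullet> b = 0)" unfolding sub_boundary_def by blast
  obtain k b where k: "k \<in> charts_at M q" "b \<in> Basis" "snd k q \<bullet> b = T"
    "cimage k (level T) = {x \<in> cimage k UNIV. x \<bullet> b = T}" by (rule level_chart[OF assms q])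
  have "(\<exists>i\<in>Basis - B. snd c q \<bullet> i = 0) \<or> (\<exists>i\<in>Basis - {b}. snd k q \<bullet> i = 0)"
  proof (rule ccontr)
    assume no: "\<not> ?thesis"
    then have "snd k q \<bullet> i \<noteq> 0" if "i \<in> Basis" for i
      using that k(3) assms by (cases "i = b") auto
    from no_interior_edge[OF assms k this model] no edge show False by blast
  qed
  then show "q \<in> meets_boundary M (level T)"
    using q model level_model[OF k] unfolding meets_boundary_def by blast
qed

lemma continuous_ray: "p \<in> S \<Longrightarrow> continuous_map (top_of_set {0..}) (mtop M) (\<Phi> p)"
proof -
  assume p: "p \<in> S"
  have "continuous_map (top_of_set {0::real..}) (prod_topology (subtopology (mtop M) S) (top_of_set {0..})) (\<lambda>t. (p, t))"
    using p S_subset by (intro continuous_map_pairedI) auto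
  from continuous_map_compose[OF this continuous_flow] show ?thesis by (simp add: o_def)
qed

lemma ray_in_chart:
  assumes "p \<in> S" "0 \<le> T" "c \<in> charts_at M (\<Phi> p T)"
  obtains \<epsilon> where "0 < \<epsilon>" "\<And>t. t \<in> {T..T + \<epsilon>} \<Longrightarrow> \<Phi> p t \<in> fst c"
proof -
  have c: "c \<in> atlas M" "\<Phi> p T \<in> fst c" using assms(3) by (auto simp: charts_at_def)
  have "openin (top_of_set {0..}) {t \<in> topspace (top_of_set {0..}). \<Phi> p t \<in> fst c}"
    by (rule openin_continuous_map_preimage[OF continuous_ray[OF assms(1)] open_domain[OF c(1)]])
  then obtain G where G: "open G" "{t \<in> {0..}. \<Phi> p t \<in> fst c} = {0..} \<inter> G"
    by (auto simp: openin_open)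
  have "T \<in> G" using G(2) c(2) assms(2) by auto
  then obtain e where e: "0 < e" "cball T e \<subseteq> G" using G(1) open_contains_cball by blast
  have "\<Phi> p t \<in> fst c" if "t \<in> {T..T + e}" for t
  proof -
    have "t \<in> cball T e" using that by (auto simp: dist_real_def)
    then have "t \<in> {0..} \<inter> G" using e(2) that assms(2) by auto
    then show ?thesis using G(2) by auto
  qed
  with e(1) show ?thesis by (rule that)
qed

text \<open>The derivative of the time vanishes on vectors tangent to the level set and is 1 on the Liouville field.\<close>

lemma level_transverse:
  assumes "0 < T" "p \<in> S" "c \<in> charts_at M (\<Phi> p T)"
  shows "liouville_field \<theta> c (snd c (\<Phi> p T)) \<notin> tspace (level T) c (\<Phi> p T)"
proof
  let ?q = "\<Phi> p T" and ?Z = "liouville_field \<theta> c (snd c (\<Phi> p T))"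
  assume Z: "?Z \<in> tspace (level T) c ?q"
  have c: "c \<in> atlas M" "?q \<in> fst c" using assms(3) by (auto simp: charts_at_def)
  have x: "snd c ?q \<in> cimage c E" using EI[OF assms(2), of T] c(2) assms(1) by (simp add: cimageI)
  \<comment> \<open>Any derivative of the time within \<open>E\<close> will do, since it is
    evaluated along curves in \<open>E\<close> only.\<close>
  obtain D where D: "((\<lambda>x. s (pt c x)) has_derivative D) (at (snd c ?q) within cimage c E)"
    by (rule smooth_on_derivativeE[OF smooth_time[OF c(1)] x]) (use x in blast)
  have kernel: "D v = 0" if "\<gamma> 0 = ?q" "\<gamma> ` {0..1} \<subseteq> level T \<inter> fst c"
    "((snd c \<circ> \<gamma>) has_vector_derivative v) (at 0 within {0..1})" for v and \<gamma> :: "real \<Rightarrow> 'a"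
  proof -
    have \<gamma>: "\<gamma> t \<in> E" "s (\<gamma> t) = T" "\<gamma> t \<in> fst c" if "t \<in> {0..1}" for t
    proof -
      have "\<gamma> t \<in> level T \<inter> fst c" using \<open>\<gamma> ` {0..1} \<subseteq> _\<close> that by blast
      then show "\<gamma> t \<in> E" "s (\<gamma> t) = T" "\<gamma> t \<in> fst c"
        using assms(1) level_iff[of T "\<gamma> t"] by auto
    qed
    have "((\<lambda>t. s (pt c ((snd c \<circ> \<gamma>) t))) has_vector_derivative D v) (at 0 within {0..1})"
      by (rule chain_rule_curve[OF D that(3)]) (use that(1) \<gamma> in \<open>auto intro!: cimageI\<close>)
    moreover have "s (pt c ((snd c \<circ> \<gamma>) t)) = T" if "t \<in> {0..1}" for t
      using \<gamma>[OF that] pt_snd[OF c(1), of "\<gamma> t"] by simp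
    ultimately show ?thesis
      using vector_derivative_unique_Icc[OF _ has_vector_derivative_const[of T], of _ "D v" 0 1] by simp
  qed
  have "D ?Z = 0"
  \<comment> \<open>\<open>tspace\<close> is a span of velocities, and the kernel of
    \<open>D\<close> is a subspace, so it suffices to treat the velocities.\<close>
  proof (rule span_induct[of ?Z _ "\<lambda>v. D v = 0"])
    show "?Z \<in> span {v. \<exists>\<gamma>::real \<Rightarrow> 'a. \<gamma> 0 = ?q \<and> \<gamma> ` {0..1} \<subseteq> level T \<inter> fst c \<and>
        ((snd c \<circ> \<gamma>) has_vector_derivative v) (at 0 within {0..1})}"
      using Z unfolding tspace_def .
    show "subspace {v. D v = 0}"
      using has_derivative_linear[OF D] by (simp add: subspace_def linear_0 linear_add linear_scale)
  qed (use kernel in blast)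
  moreover have "D ?Z = 1"
  proof -
    obtain \<epsilon> where \<epsilon>: "0 < \<epsilon>" "\<And>t. t \<in> {T..T + \<epsilon>} \<Longrightarrow> \<Phi> p t \<in> fst c"
      using ray_in_chart[OF assms(2) _ assms(3)] assms(1) by auto
    have "((\<lambda>t. snd c (\<Phi> p t)) has_vector_derivative ?Z) (at T within {T..T + \<epsilon>})"
      using flow[OF assms(2) _ assms(3)] assms(1)
      by (rule_tac has_vector_derivative_within_subset[of _ _ _ "{0..}"]) auto
    then have "((\<lambda>t. s (pt c (snd c (\<Phi> p t)))) has_vector_derivative D ?Z) (at T within {T..T + \<epsilon>})"
      by (rule chain_rule_curve[OF D]) (use \<epsilon>(2) assms(1,2) in \<open>auto intro!: cimageI\<close>)
    then show ?thesis
    proof (rule vector_derivative_unique_Icc[OF _ has_vector_derivative_id])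
      show "T < T + \<epsilon>" using \<epsilon>(1) by simp
      show "s (pt c (snd c (\<Phi> p t))) = t" if "t \<in> {T..T + \<epsilon>}" for t
        using pt_snd[OF c(1) \<epsilon>(2)[OF that]] that assms(1,2) by simp
    qed
  qed
  ultimately show False by simp
qed

section \<open>The end restarted on the level of time \<open>T\<close>\<close>

definition shift :: "real \<Rightarrow> 'a \<Rightarrow> real \<Rightarrow> 'a" where "shift T q t = \<Phi> (\<pi> q) (T + t)"

lemma shift_level [simp]: "0 \<le> T \<Longrightarrow> p \<in> S \<Longrightarrow> shift T (\<Phi> p T) t = \<Phi> p (T + t)"
  by (simp add: shift_def)

lemma shift_image: "0 \<le> T \<Longrightarrow> (\<lambda>q. shift T q t) ` level T = (\<lambda>p. \<Phi> p (T + t)) ` S"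
  by (simp add: level_def image_image cong: image_cong)

lemma shift_range:
  assumes "0 \<le> T"
  shows "{shift T q t |q t. q \<in> level T \<and> 0 \<le> t} = {q \<in> E. T \<le> s q}"
    and "{shift T q t |q t. q \<in> level T \<and> 0 < t} = {q \<in> E. T < s q}"
proof -
  have *: "\<exists>p t. q = shift T p t \<and> p \<in> level T \<and> t = s q - T" if "q \<in> E" "T \<le> s q" for q
    using E_proj[OF that(1)] assms
    by (intro exI[of _ "\<Phi> (\<pi> q) T"] exI[of _ "s q - T"]) (simp add: level_def)
  have **: "\<exists>p\<in>S. shift T q t = \<Phi> p (T + t)" if "q \<in> level T" for q t
    using that assms by (auto simp: level_def)
  have "shift T q t \<in> E" "s (shift T q t) = T + t" if "q \<in> level T" "0 \<le> t" for q t
    using **[OF that(1), of t] that(2) assms by (auto intro!: EI)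
  then show "{shift T q t |q t. q \<in> level T \<and> 0 \<le> t} = {q \<in> E. T \<le> s q}"
    and "{shift T q t |q t. q \<in> level T \<and> 0 < t} = {q \<in> E. T < s q}"
    using * by force+
qed

text \<open>The inverse sends \<open>q\<close> to the point of its ray at time \<open>T\<close>
  together with the remaining time \<open>s q - T\<close>; it is continuous because
  \<open>\<pi>\<close>, \<open>s\<close> and the flow are.\<close>

lemma embedding_shift:
  assumes "0 \<le> T"
  shows "embedding_map (prod_topology (subtopology (mtop M) (level T)) (top_of_set {0..})) (mtop M)
    (\<lambda>(q, t). shift T q t)"
proof -
  let ?P = "prod_topology (subtopology (mtop M) (level T)) (top_of_set {0::real..})"
  let ?F = "{q \<in> E. T \<le> s q}"
  let ?\<Psi> = "\<lambda>q. (\<Phi> (\<pi> q) T, s q - T)"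
  have levE: "level T \<subseteq> E" using level_iff[OF assms] by auto
  have top: "topspace ?P = level T \<times> {0..}" using levE E_subset by auto
  have img: "(\<lambda>(q, t). shift T q t) ` (level T \<times> {0..}) = ?F"
    unfolding shift_range(1)[OF assms, symmetric] by force
  have sub: "subtopology (mtop M) A = subtopology (subtopology (mtop M) E) A" if "A \<subseteq> E" for A
    using that by (simp add: subtopology_subtopology Int_absorb1)
  have "continuous_map (subtopology (mtop M) (level T)) (subtopology (mtop M) S) \<pi>"
    using continuous_map_from_subtopology[OF continuous_base, of "level T"] E_proj(1) levE
    by (auto simp: sub[OF levE] continuous_map_in_subtopology)
  from continuous_map_compose[OF continuous_map_fst this]
  have 1: "continuous_map ?P (subtopology (mtop M) S) (\<lambda>z. \<pi> (fst z))" by (simp add: o_def)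
  have "continuous_map (top_of_set {0..}) (top_of_set {0..}) (\<lambda>t::real. T + t)"
    using assms by (auto simp: continuous_map_in_subtopology intro!: continuous_intros)
  from continuous_map_compose[OF continuous_map_snd this]
  have 2: "continuous_map ?P (top_of_set {0..}) (\<lambda>z. T + snd z)" by (simp add: o_def)
  have cont: "continuous_map ?P (mtop M) (\<lambda>(q, t). shift T q t)"
    using continuous_map_compose[OF continuous_map_pairedI[OF 1 2] continuous_flow]
    by (simp add: o_def shift_def case_prod_unfold)
  have FE: "?F \<subseteq> E" by auto
  have "continuous_map (subtopology (mtop M) E) (subtopology (mtop M) S) \<pi>"
    using continuous_base E_proj(1) by (auto simp: continuous_map_in_subtopology)
  moreover have "continuous_map (subtopology (mtop M) E) (top_of_set {0..}) (\<lambda>q. T)"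
    using assms by (auto simp: continuous_map_in_subtopology)
  ultimately have "continuous_map (subtopology (mtop M) E)
      (prod_topology (subtopology (mtop M) S) (top_of_set {0..})) (\<lambda>q. (\<pi> q, T))" by (rule continuous_map_pairedI)
  from continuous_map_compose[OF this continuous_flow]
  have "continuous_map (subtopology (mtop M) E) (mtop M) (\<lambda>q. \<Phi> (\<pi> q) T)" by (simp add: o_def)
  then have 3: "continuous_map (subtopology (mtop M) ?F) (subtopology (mtop M) (level T)) (\<lambda>q. \<Phi> (\<pi> q) T)"
    using continuous_map_from_subtopology[of _ _ _ ?F] E_proj(1)
    by (auto simp: sub[OF FE] continuous_map_in_subtopology level_def)
  have "continuous_map (subtopology (mtop M) E) euclideanreal (\<lambda>q. s q - T)"
    by (intro continuous_map_diff continuous_time) simp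
  then have 4: "continuous_map (subtopology (mtop M) ?F) (top_of_set {0..}) (\<lambda>q. s q - T)"
    using continuous_map_from_subtopology[of _ _ _ ?F]
    by (auto simp: sub[OF FE] continuous_map_in_subtopology)
  have "homeomorphic_maps ?P (subtopology (mtop M) ?F) (\<lambda>(q, t). shift T q t) ?\<Psi>"
    unfolding homeomorphic_maps_def
  proof (intro conjI ballI)
    show "continuous_map ?P (subtopology (mtop M) ?F) (\<lambda>(q, t). shift T q t)"
      using cont img top by (auto simp: continuous_map_in_subtopology)
    show "continuous_map (subtopology (mtop M) ?F) ?P ?\<Psi>" by (rule continuous_map_pairedI[OF 3 4])
    show "?\<Psi> ((\<lambda>(q, t). shift T q t) z) = z" if "z \<in> topspace ?P" for z
      using that assms unfolding top by (auto simp: level_def)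
    show "(\<lambda>(q, t). shift T q t) (?\<Psi> q) = q" if "q \<in> topspace (subtopology (mtop M) ?F)" for q
    proof -
      have q: "q \<in> E" using that by simp
      show ?thesis using E_proj[OF q] assms by (simp add: shift_def)
    qed
  qed
  then show ?thesis
    unfolding embedding_map_def top img using homeomorphic_map_maps by blast
qed

lemma smooth_shift:
  assumes "0 \<le> T" "c \<in> atlas M" "c' \<in> atlas M"
  shows "smooth_on {(x, t). x \<in> cimage c (level T) \<and> 0 \<le> t \<and> shift T (pt c x) t \<in> fst c'}
    (\<lambda>(x, t). snd c' (shift T (pt c x) t))"
proof -
  let ?A = "{(x, t). x \<in> cimage c (level T) \<and> 0 \<le> t \<and> shift T (pt c x) t \<in> fst c'}"
  have lev: "cimage c (level T) \<subseteq> cimage c E"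
    using level_iff[OF assms(1)] by (auto simp: cimage_def)
  have h: "smooth_on ?A (\<lambda>z. (fst z, T + snd z))"
    by (intro smooth_on_Pair smooth_on_add smooth_on_const smooth_on_bounded_linear
        bounded_linear_fst bounded_linear_snd)
  have "smooth_on ?A (\<lambda>z. (\<lambda>(x, u). snd c' (\<Phi> (\<pi> (pt c x)) u)) (fst z, T + snd z))"
    by (rule smooth_on_compose[OF h smooth_flow_base[OF assms(2,3)]])
      (use lev assms(1) in \<open>auto simp: shift_def\<close>)
  then show ?thesis
    by (simp add: shift_def case_prod_unfold)
qed

lemma smooth_shift_proj:
  assumes "0 \<le> T" "c \<in> atlas M" "c' \<in> atlas M"
  shows "smooth_on (cimage c {q. \<exists>p\<in>level T \<inter> fst c'. \<exists>t\<ge>0. q = shift T p t})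
    (\<lambda>x. (snd c' (\<Phi> (\<pi> (pt c x)) T), s (pt c x) - T))" (is "smooth_on (cimage c ?A) _")
proof (rule smooth_on_Pair)
  have A: "q \<in> E \<and> \<Phi> (\<pi> q) T \<in> fst c'" if "q \<in> ?A" for q
    using that assms(1) by (auto simp: level_def intro!: EI)
  have sub: "cimage c ?A \<subseteq> cimage c E" using A by (auto simp: cimage_def)
  have "smooth_on (cimage c ?A) (\<lambda>x. s (pt c x) + (- T))"
    by (intro smooth_on_add smooth_on_const smooth_on_subset[OF smooth_time[OF assms(2)] sub])
  then show "smooth_on (cimage c ?A) (\<lambda>x. s (pt c x) - T)" by simp
  have h: "smooth_on (cimage c ?A) (\<lambda>x. (x, T))"
    by (intro smooth_on_Pair smooth_on_const smooth_on_bounded_linear bounded_linear_ident)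
  have "smooth_on (cimage c ?A) (\<lambda>x. (\<lambda>(x, u). snd c' (\<Phi> (\<pi> (pt c x)) u)) (x, T))"
  proof (rule smooth_on_compose[OF h smooth_flow_base[OF assms(2,3)]], rule image_subsetI)
    fix x assume x: "x \<in> cimage c ?A"
    then have "pt c x \<in> ?A" using cimage_iff[OF assms(2), of x ?A] by blast
    then show "(x, T) \<in> {(x, u). x \<in> cimage c E \<and> 0 \<le> u \<and> \<Phi> (\<pi> (pt c x)) u \<in> fst c'}"
      using A[of "pt c x"] sub x assms(1) by blast
  qed
  then show "smooth_on (cimage c ?A) (\<lambda>x. snd c' (\<Phi> (\<pi> (pt c x)) T))" by simp
qed

text \<open>Only transversality and the flow equation mention the form, and both concern times from
  \<open>T\<close> on, where the two Liouville fields agree. The other clauses concern the level and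
  the flow map; the compact complement grows by the slab of times up to \<open>T\<close>.\<close>

lemma cylindrical_end_level:
  assumes T: "0 < T"
    and \<mu>: "\<And>p t c. p \<in> S \<Longrightarrow> T \<le> t \<Longrightarrow> c \<in> charts_at M (\<Phi> p t) \<Longrightarrow>
      liouville_field \<mu> c (snd c (\<Phi> p t)) = liouville_field \<theta> c (snd c (\<Phi> p t))"
  shows "cylindrical_end M \<mu> (level T) (shift T)"
proof -
  have T0: "0 \<le> T" using T by simp
  have trans: "\<forall>q\<in>level T. \<forall>c\<in>charts_at M q. liouville_field \<mu> c (snd c q) \<notin> tspace (level T) c q"
    using level_transverse[OF T] \<mu> by (auto simp: level_def)
  have init: "\<forall>q\<in>level T. shift T q 0 = q" using T0 by (simp add: level_def)
  have "((\<lambda>r. snd c (shift T q r)) has_vector_derivative liouville_field \<mu> c (snd c (shift T q t))) (at t within {0..})"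
    if q: "q \<in> level T" and t: "0 \<le> t" and c: "c \<in> charts_at M (shift T q t)" for q t c
  proof -
    obtain p where p: "p \<in> S" "q = \<Phi> p T" using q by (auto simp: level_def)
    have c': "c \<in> charts_at M (\<Phi> p (T + t))" using c p T0 by simp
    have "((\<lambda>r. snd c (\<Phi> p r)) has_vector_derivative liouville_field \<theta> c (snd c (\<Phi> p (T + t)))) (at (T + t) within (+) T ` {0..})"
      using flow[OF p(1) _ c'] T0 t by (rule_tac has_vector_derivative_within_subset[of _ _ _ "{0..}"]) auto
    moreover have "((+) T has_vector_derivative 1) (at t within {0..})"
      by (auto intro!: derivative_eq_intros)
    ultimately have "(((\<lambda>r. snd c (\<Phi> p r)) \<circ> (+) T) has_vector_derivative
        1 *\<^sub>R liouville_field \<theta> c (snd c (\<Phi> p (T + t)))) (at t within {0..})"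
      by (rule_tac vector_diff_chain_within)
    then show ?thesis using \<mu>[OF p(1) _ c'] t p T0 by (simp add: o_def)
  qed
  then have flow: "\<forall>q\<in>level T. \<forall>t\<ge>0. \<forall>c\<in>charts_at M (shift T q t).
      ((\<lambda>r. snd c (shift T q r)) has_vector_derivative liouville_field \<mu> c (snd c (shift T q t))) (at t within {0..})"
    by blast
  have closed: "closedin (mtop M) {shift T q t |q t. q \<in> level T \<and> 0 \<le> t}"
  proof -
    have "closedin (subtopology (mtop M) E) {q \<in> topspace (subtopology (mtop M) E). s q \<in> {T..}}"
      by (rule closedin_continuous_map_preimage[OF continuous_time]) simp
    moreover have "{q \<in> topspace (subtopology (mtop M) E). s q \<in> {T..}} = {q \<in> E. T \<le> s q}"
      using E_subset by auto
    ultimately show ?thesis using closedin_trans_full[OF _ closed_E] shift_range(1)[OF T0] by simp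
  qed
  have compact: "compactin (mtop M) (topspace (mtop M) - {shift T q t |q t. q \<in> level T \<and> 0 < t})"
  proof -
    have slab: "{\<Phi> p t |p t. p \<in> S \<and> 0 \<le> t \<and> t \<le> T} = {q \<in> E. s q \<le> T}"
    proof (intro equalityI subsetI)
      fix q assume "q \<in> {q \<in> E. s q \<le> T}"
      then show "q \<in> {\<Phi> p t |p t. p \<in> S \<and> 0 \<le> t \<and> t \<le> T}"
        using E_proj[of q] by (intro CollectI exI[of _ "\<pi> q"] exI[of _ "s q"]) simp
    qed auto
    have "topspace (mtop M) - {q \<in> E. T < s q} = (topspace (mtop M) - U0) \<union> {q \<in> E. s q \<le> T}"
      using T E_subset by (auto simp: U0_iff)
    then show ?thesis
      unfolding shift_range(2)[OF T0] using compactin_Un[OF compact_rest compact_slab[of T]] slab by simp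
  qed
  have "(\<forall>q\<in>level T. \<forall>t\<ge>0. \<Phi> (\<pi> (shift T q t)) T = q \<and> s (shift T q t) - T = t)"
    using T0 by (auto simp: level_def)
  then have inv: "\<exists>\<pi>' s'. (\<forall>q\<in>level T. \<forall>t\<ge>0. \<pi>' (shift T q t) = q \<and> s' (shift T q t) = t) \<and>
      (\<forall>c\<in>atlas M. \<forall>c'\<in>atlas M. smooth_on (cimage c {q. \<exists>p\<in>level T \<inter> fst c'. \<exists>t\<ge>0. q = shift T p t})
        (\<lambda>x. (snd c' (\<pi>' (pt c x)), s' (pt c x) :: real)))"
    using smooth_shift_proj[OF T0]
    by (intro exI[of _ "\<lambda>q. \<Phi> (\<pi> q) T"] exI[of _ "\<lambda>q. s q - T"]) blast
  show ?thesis
    unfolding cylindrical_end_def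
    using proper_hypersurface_level[OF T] trans init flow embedding_shift[OF T0] closed
      smooth_shift[OF T0] inv compact by blast
qed

text \<open>Being eventually contained in \<open>H\<close> does not depend on where the time
  starts.\<close>

lemma rays_shift:
  assumes "0 \<le> T"
  shows "rays_in (level T) (shift T) H = (\<lambda>p. \<Phi> p T) ` rays_in S \<Phi> H"
proof -
  have *: "(\<exists>t\<^sub>0\<ge>0. \<forall>t\<ge>t\<^sub>0. \<Phi> p (T + t) \<in> H) \<longleftrightarrow> (\<exists>t\<^sub>0\<ge>0. \<forall>t\<ge>t\<^sub>0. \<Phi> p t \<in> H)" for p
  proof
    assume "\<exists>t\<^sub>0\<ge>0. \<forall>t\<ge>t\<^sub>0. \<Phi> p (T + t) \<in> H"
    then obtain t0 where t0: "t0 \<ge> 0" "\<And>t. t \<ge> t0 \<Longrightarrow> \<Phi> p (T + t) \<in> H" by blast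
    have "\<Phi> p t \<in> H" if "t \<ge> T + t0" for t using t0(2)[of "t - T"] that by simp
    then show "\<exists>t\<^sub>0\<ge>0. \<forall>t\<ge>t\<^sub>0. \<Phi> p t \<in> H" using t0(1) assms by (intro exI[of _ "T + t0"]) simp
  next
    assume "\<exists>t\<^sub>0\<ge>0. \<forall>t\<ge>t\<^sub>0. \<Phi> p t \<in> H"
    then obtain t0 where t0: "t0 \<ge> 0" "\<And>t. t \<ge> t0 \<Longrightarrow> \<Phi> p t \<in> H" by blast
    have "\<Phi> p (T + t) \<in> H" if "t \<ge> t0" for t using t0(2)[of "T + t"] that assms by simp
    then show "\<exists>t\<^sub>0\<ge>0. \<forall>t\<ge>t\<^sub>0. \<Phi> p (T + t) \<in> H" using t0(1) by blast
  qed
  have "rays_in (level T) (shift T) H =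
      (\<lambda>p. \<Phi> p T) ` {p \<in> S. \<exists>t\<^sub>0\<ge>0. \<forall>t\<ge>t\<^sub>0. shift T (\<Phi> p T) t \<in> H}"
    unfolding rays_in_def level_def by blast
  also have "{p \<in> S. \<exists>t\<^sub>0\<ge>0. \<forall>t\<ge>t\<^sub>0. shift T (\<Phi> p T) t \<in> H} = rays_in S \<Phi> H"
    unfolding rays_in_def using assms * by (intro Collect_cong conj_cong) simp_all
  finally show ?thesis .
qed

text \<open>The end is closed, so it meets \<open>K\<close> in a compact set, on which the
  continuous time is bounded.\<close>

lemma compact_bounded_time:
  assumes "compactin (mtop M) K"
  obtains T where "0 < T" "\<And>p t. p \<in> S \<Longrightarrow> T \<le> t \<Longrightarrow> \<Phi> p t \<notin> K"
proof -
  have "compactin (mtop M) (E \<inter> K)" by (rule closed_Int_compactin[OF closed_E assms])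
  then have "compactin (subtopology (mtop M) E) (E \<inter> K)" by (simp add: compactin_subtopology)
  then have "compactin euclideanreal (s ` (E \<inter> K))" by (rule image_compactin[OF _ continuous_time])
  then have "bounded (s ` (E \<inter> K))" by (intro compact_imp_bounded) simp
  then obtain B where B: "\<And>q. q \<in> E \<Longrightarrow> q \<in> K \<Longrightarrow> norm (s q) \<le> B"
    unfolding bounded_iff by blast
  \<comment> \<open>Taking the absolute value of \<open>B\<close> and adding 1 makes the threshold
    positive and strictly larger than all times in \<open>K\<close>.\<close>
  have "\<Phi> p t \<notin> K" if "p \<in> S" "\<bar>B\<bar> + 1 \<le> t" for p t
  proof
    assume "\<Phi> p t \<in> K"
    moreover have "0 \<le> t" using that(2) by simp
    ultimately have "\<bar>t\<bar> \<le> B" using B[of "\<Phi> p t"] that(1) by auto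
    then show False using that(2) by simp
  qed
  then show ?thesis by (rule that[of "\<bar>B\<bar> + 1", rotated]) simp_all
qed

end

section \<open>Perturbation by a compactly supported exact form\<close>

text \<open>Records the two effects of adding the differential of a compactly supported function:
  the exterior derivative is unchanged everywhere, and the form itself is unchanged off
  \<open>K\<close>. Sectorial data are carried from \<open>\<theta>\<close> to
  \<open>\<mu>\<close>.\<close>

locale compact_perturbation = corner_manifold M for M :: "('a, 'e::euclidean_space) cmfd" +
  fixes \<theta> \<mu> :: "('a, 'e) form1" and K :: "'a set"
  assumes compact_K: "compactin (mtop M) K"
    and dform_eq: "c \<in> atlas M \<Longrightarrow> x \<in> cimage c UNIV \<Longrightarrow> dform \<mu> c x = dform \<theta> c x"
    and off_K: "c \<in> atlas M \<Longrightarrow> x \<in> cimage c UNIV \<Longrightarrow> pt c x \<notin> K \<Longrightarrow> \<mu> c x = \<theta> c x"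
begin

lemma atlas_auto_id: "atlas_auto M id"
  by unfold_locales (simp_all add: push_def)

text \<open>With the identity as permutation, images of sets are the sets themselves, so the
  transport lemmas compare the null foliations of two forms on one submanifold.\<close>

lemma dform_push_id: "dform_push M id \<mu> \<theta>"
proof -
  interpret atlas_auto M id by (rule atlas_auto_id)
  show ?thesis by unfold_locales (simp add: push_def dform_eq)
qed

sublocale id: dform_push M id \<mu> \<theta>
  by (rule dform_push_id)

lemma off_K_at: "c \<in> charts_at M p \<Longrightarrow> p \<notin> K \<Longrightarrow> \<mu> c (snd c p) = \<theta> c (snd c p)"
  by (rule off_K) (auto simp: charts_at_def cimage_UNIV pt_snd)

lemma liouville_off_K:
  assumes "c \<in> charts_at M p" "p \<notin> K"
  shows "liouville_field \<mu> c (snd c p) = liouville_field \<theta> c (snd c p)"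
proof -
  have "c \<in> atlas M" "snd c p \<in> cimage c UNIV" using assms(1) by (auto simp: charts_at_def cimage_UNIV)
  then show ?thesis by (simp add: liouville_field_def dform_eq off_K_at[OF assms])
qed

text \<open>A Lie derivative involves derivatives of the form, so equality at \<open>p\<close> alone
  would not suffice. As \<open>K\<close> is compact, hence closed, the forms agree on a
  neighbourhood of \<open>p\<close>.\<close>

lemma lie_form_off_K:
  assumes "c \<in> charts_at M p" "p \<notin> K"
  shows "lie_form V \<mu> c (snd c p) w = lie_form V \<theta> c (snd c p) w"
proof -
  have c: "c \<in> atlas M" "p \<in> fst c" using assms(1) by (auto simp: charts_at_def)
  have "closedin (mtop M) K" using compactin_imp_closedin[OF Hausdorff compact_K] .
  then have W: "openin (mtop M) (topspace (mtop M) - K)" by (rule openin_diff[OF openin_topspace])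
  have p: "p \<in> topspace (mtop M) - K" using c domain_subset assms(2) by blast
  obtain U where U: "open U" "snd c p \<in> U"
    "\<And>x. x \<in> cimage c UNIV \<Longrightarrow> x \<in> U \<Longrightarrow> pt c x \<in> topspace (mtop M) - K"
    using open_cimage_nbhd[OF c(1) W c(2) p] by blast
  have "dchart c (\<lambda>y. \<mu> c y w) (snd c p) = dchart c (\<lambda>y. \<theta> c y w) (snd c p)"
    unfolding dchart_def
  proof (rule frechet_derivative_within_cong[OF _ U(2,1)])
    show "snd c p \<in> cimage c UNIV" using c(2) by (simp add: cimageI)
    fix y assume "y \<in> cimage c UNIV \<inter> U"
    then show "\<mu> c y w = \<theta> c y w" using U(3)[of y] off_K[OF c(1), of y] by simp
  qed
  then show ?thesis by (simp add: lie_form_def off_K_at[OF assms])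
qed

text \<open>The same contact field with the same factor \<open>g\<close> serves both forms, because
  the contact condition is tested at points of \<open>S\<close> only.\<close>

lemma convex_hypersurface_off_K:
  assumes "convex_hypersurface M \<theta> S \<Gamma>" "S \<inter> K = {}"
  shows "convex_hypersurface M \<mu> S \<Gamma>"
proof -
  have "contact_field_on M \<mu> S W V" if V: "contact_field_on M \<theta> S W V" for W V
  proof -
    from V obtain g where g: "\<And>p c w. p \<in> S \<inter> W \<Longrightarrow> c \<in> charts_at M p \<Longrightarrow> w \<in> tspace S c p \<Longrightarrow>
        lie_form V \<theta> c (snd c p) w = g p * \<theta> c (snd c p) w"
      unfolding contact_field_on_def by blast
    have "lie_form V \<mu> c (snd c p) w = g p * \<mu> c (snd c p) w"
      if "p \<in> S \<inter> W" "c \<in> charts_at M p" "w \<in> tspace S c p" for p c w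
    proof -
      have "p \<notin> K" using that(1) assms(2) by blast
      then show ?thesis using g[OF that] by (simp add: lie_form_off_K[OF that(2)] off_K_at[OF that(2)])
    qed
    then show ?thesis using V unfolding contact_field_on_def by blast
  qed
  then show ?thesis using assms(1) unfolding convex_hypersurface_def by blast
qed

text \<open>The end of \<open>\<theta>\<close> is restarted beyond \<open>K\<close>. Its level at
  time \<open>t\<close> is the old level at time \<open>T + t\<close>, which is covered by the old
  convexity and misses \<open>K\<close>; the rays contained in \<open>H\<close> stay the
  same.\<close>

lemma convex_at_infinity_perturb:
  assumes "convex_at_infinity M \<theta> H"
  shows "convex_at_infinity M \<mu> H"
proof -
  obtain S \<Phi> where e: "cylindrical_end M \<theta> S \<Phi>"
    and conv: "\<And>t. 0 \<le> t \<Longrightarrow> convex_hypersurface M \<theta> ((\<lambda>p. \<Phi> p t) ` S) ((\<lambda>p. \<Phi> p t) ` rays_in S \<Phi> H)"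
    using assms unfolding convex_at_infinity_def by blast
  obtain \<pi> s where \<pi>: "\<forall>p\<in>S. \<forall>t\<ge>0. \<pi> (\<Phi> p t) = p \<and> s (\<Phi> p t) = t"
    and sm: "\<forall>c\<in>atlas M. \<forall>c'\<in>atlas M. smooth_on (cimage c {q. \<exists>p\<in>S \<inter> fst c'. \<exists>t\<ge>0. q = \<Phi> p t})
             (\<lambda>x. (snd c' (\<pi> (pt c x)), s (pt c x) :: real))"
    using e unfolding cylindrical_end_def by blast
  interpret cyl: cylinder M \<theta> S \<Phi> \<pi> s
    using e \<pi> sm by unfold_locales blast+
  obtain T where T: "0 < T" "\<And>p t. p \<in> S \<Longrightarrow> T \<le> t \<Longrightarrow> \<Phi> p t \<notin> K"
    using cyl.compact_bounded_time[OF compact_K] by blast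
  have "cylindrical_end M \<mu> (cyl.level T) (cyl.shift T)"
    by (rule cyl.cylindrical_end_level[OF T(1)]) (simp add: liouville_off_K T(2))
  moreover have "convex_hypersurface M \<mu> ((\<lambda>q. cyl.shift T q t) ` cyl.level T)
      ((\<lambda>q. cyl.shift T q t) ` rays_in (cyl.level T) (cyl.shift T) H)" if t: "0 \<le> t" for t
  proof -
    have T0: "0 \<le> T" using T(1) by simp
    have "rays_in S \<Phi> H \<subseteq> S" by (auto simp: rays_in_def)
    then have "(\<lambda>q. cyl.shift T q t) ` rays_in (cyl.level T) (cyl.shift T) H = (\<lambda>p. \<Phi> p (T + t)) ` rays_in S \<Phi> H"
      unfolding cyl.rays_shift[OF T0] image_image
      by (intro image_cong refl cyl.shift_level[OF T0]) blast
    moreover have "convex_hypersurface M \<mu> ((\<lambda>p. \<Phi> p (T + t)) ` S) ((\<lambda>p. \<Phi> p (T + t)) ` rays_in S \<Phi> H)"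
    proof (rule convex_hypersurface_off_K[OF conv])
      show "0 \<le> T + t" using T0 t by simp
      show "(\<lambda>p. \<Phi> p (T + t)) ` S \<inter> K = {}" using T(2) t by auto
    qed
    ultimately show ?thesis by (simp add: cyl.shift_image[OF T0])
  qed
  ultimately show ?thesis unfolding convex_at_infinity_def by blast
qed

lemma tangent_near_infinity_perturb:
  assumes "tangent_near_infinity M (liouville_field \<theta>) H"
  shows "tangent_near_infinity M (liouville_field \<mu>) H"
proof -
  obtain K' where K': "compactin (mtop M) K'"
    "\<And>p c. p \<in> H - K' \<Longrightarrow> c \<in> charts_at M p \<Longrightarrow> liouville_field \<theta> c (snd c p) \<in> tspace H c p"
    using assms unfolding tangent_near_infinity_def by blast
  have "liouville_field \<mu> c (snd c p) \<in> tspace H c p" if "p \<in> H - (K' \<union> K)" "c \<in> charts_at M p" for p c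
    using that K'(2)[of p c] liouville_off_K[OF that(2)] by simp
  then show ?thesis using compactin_Un[OF K'(1) compact_K] unfolding tangent_near_infinity_def by blast
qed

lemma leaves_perturb: "leaves M \<mu> Y = leaves M \<theta> Y"
  using id.leaves_push[of Y] by (simp add: image_id[unfolded id_def])

lemma sigma_sectorial_perturb:
  assumes "sigma_sectorial M \<theta> H"
  shows "sigma_sectorial M \<mu> H"
  using assms convex_at_infinity_perturb[of H] tangent_near_infinity_perturb[of H] id.section_push[of H]
  unfolding sigma_sectorial_def by (simp add: leaves_perturb)

lemma transverse_coisotropic_perturb:
  assumes "transverse_coisotropic M \<theta> m H"
  shows "transverse_coisotropic M \<mu> m H"
  using assms tangent_near_infinity_perturb id.coisotropic_push[of 2]
  unfolding transverse_coisotropic_def by simp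

lemma sectorial_corner_perturb:
  assumes "sectorial_corner M \<theta> m H C"
  shows "sectorial_corner M \<mu> m H C"
  using assms transverse_coisotropic_perturb[of m H] sigma_sectorial_perturb
  unfolding sectorial_corner_def leaves_perturb by blast

end

section \<open>Diffeomorphisms as permutations of the atlas\<close>

context corner_manifold
begin

text \<open>Maximality of the atlas reduces this to compatibility with each \<open>c'\<close>. The
  two transition maps are the coordinate expressions of \<open>\<phi>\<close> from \<open>c\<close>
  to \<open>c'\<close> and of its inverse from \<open>c'\<close> to \<open>c\<close>, which are
  smooth by hypothesis.\<close>

lemma push_in_atlas:
  assumes bij: "bij \<phi>" and homeo: "homeomorphic_map (mtop M) (mtop M) \<phi>" "homeomorphic_map (mtop M) (mtop M) (inv \<phi>)"
    and smooth: "smooth_map M M \<phi>" "smooth_map M M (inv \<phi>)" and c: "c \<in> atlas M"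
  shows "push \<phi> c \<in> atlas M"
proof (rule atlas_maximal)
  let ?c = "push \<phi> c"
  have inv [simp]: "inv \<phi> (\<phi> p) = p" "\<phi> (inv \<phi> p) = p" for p
    using bij by (simp_all add: bij_is_inj bij_is_surj surj_f_inv_f)
  have fst: "fst ?c = inv \<phi> -` fst c"
    unfolding push_def fst_conv using bij by (simp add: bij_vimage_eq_inv_image bij_imp_bij_inv inv_inv_eq)
  have fst_iff: "\<phi> p \<in> fst ?c \<longleftrightarrow> p \<in> fst c" for p by (simp add: fst)
  have snd: "snd ?c (\<phi> p) = snd c p" for p by (simp add: push_def)
  have img: "cimage ?c A = cimage c (\<phi> -` A)" for A
  proof -
    have "fst ?c \<inter> A = \<phi> ` (fst c \<inter> \<phi> -` A)"
    proof (intro equalityI subsetI)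
      fix q assume "q \<in> fst ?c \<inter> A"
      then show "q \<in> \<phi> ` (fst c \<inter> \<phi> -` A)" by (intro image_eqI[of q \<phi> "inv \<phi> q"]) (auto simp: fst)
    qed (auto simp: fst)
    then show ?thesis by (simp add: cimage_def image_image snd)
  qed
  have inj: "inj_on (snd ?c) (fst ?c)"
  proof (rule inj_onI)
    fix p q assume "p \<in> fst ?c" "q \<in> fst ?c" "snd ?c p = snd ?c q"
    then have "inv \<phi> p = inv \<phi> q"
      using inj_onD[OF inj_chart[OF c], of "inv \<phi> p" "inv \<phi> q"] by (simp add: fst) (simp add: push_def)
    then show "p = q" using inv(2) by metis
  qed
  have pt: "pt ?c x = \<phi> (pt c x)" if "x \<in> cimage c UNIV" for x
    unfolding pt_def[of ?c]
    by (rule inv_into_f_eq[OF inj]) (use pt_in[OF that] snd_pt[OF that] in \<open>simp_all add: fst_iff snd\<close>)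
  show "is_chart (mtop M) ?c"
    unfolding is_chart_def img vimage_UNIV
  proof (intro conjI)
    show "openin (mtop M) (fst ?c)"
      using iffD1[OF homeomorphic_map_openness_eq[OF homeo(1)] open_domain[OF c]] by (simp add: push_def)
    show "openin (top_of_set quadrant) (cimage c UNIV)" by (rule open_cimage[OF c])
    have "homeomorphic_map (subtopology (mtop M) (fst ?c)) (subtopology (mtop M) (fst c)) (inv \<phi>)"
      by (rule homeomorphic_map_subtopologies_alt[OF homeo(2)]) (simp add: fst)
    from homeomorphic_map_compose[OF this homeo_chart[OF c]]
    show "homeomorphic_map (subtopology (mtop M) (fst ?c)) (top_of_set (cimage c UNIV)) (snd ?c)"
      by (simp add: push_def)
  qed
  fix c' assume c': "c' \<in> atlas M"
  show "compatible ?c c'"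
    unfolding compatible_def
  proof
    have sub: "cimage c (\<phi> -` fst c') \<subseteq> cimage c UNIV" by (rule cimage_subset)
    have "smooth_on (cimage c (\<phi> -` fst c')) (snd c' \<circ> \<phi> \<circ> pt c)"
      using smooth(1) c c' unfolding smooth_map_def by blast
    then show "smooth_on (cimage ?c (fst c')) (snd c' \<circ> pt ?c)"
      unfolding img
    proof (rule smooth_on_cong[THEN iffD1, rotated])
      fix x assume "x \<in> cimage c (\<phi> -` fst c')"
      then show "(snd c' \<circ> \<phi> \<circ> pt c) x = (snd c' \<circ> pt ?c) x" using pt[of x] sub by auto
    qed
    have "smooth_on (cimage c' (inv \<phi> -` fst c)) (snd c \<circ> inv \<phi> \<circ> pt c')"
      using smooth(2) c c' unfolding smooth_map_def by blast
    then show "smooth_on (cimage c' (fst ?c)) (snd ?c \<circ> pt c')"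
      unfolding fst by (simp add: push_def)
  qed
qed

lemma smooth_map_cong:
  assumes "smooth_map M M F" "\<And>p. p \<in> topspace (mtop M) \<Longrightarrow> G p = F p"
  shows "smooth_map M M G"
  unfolding smooth_map_def
proof (intro conjI ballI)
  show "continuous_map (mtop M) (mtop M) G"
    using assms(1) by (rule_tac continuous_map_eq[of _ _ F]) (auto simp: smooth_map_def assms(2))
  fix c c' assume c: "c \<in> atlas M" "c' \<in> atlas M"
  have eq: "G p = F p" if "p \<in> fst c" for p using assms(2) domain_subset[OF c(1)] that by blast
  have img: "cimage c (G -` fst c') = cimage c (F -` fst c')"
    using eq by (auto simp: cimage_def)
  have "smooth_on (cimage c (F -` fst c')) (snd c' \<circ> F \<circ> pt c)"
    using assms(1) c unfolding smooth_map_def by blast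
  then show "smooth_on (cimage c (G -` fst c')) (snd c' \<circ> G \<circ> pt c)"
    unfolding img
  proof (rule smooth_on_cong[THEN iffD1, rotated])
    fix x assume "x \<in> cimage c (F -` fst c')"
    then have "x \<in> cimage c UNIV" using cimage_subset[of c "F -` fst c'"] by blast
    then show "(snd c' \<circ> F \<circ> pt c) x = (snd c' \<circ> G \<circ> pt c) x" using eq[OF pt_in] by simp
  qed
qed

end

text \<open>\<open>diffeomorphism\<close> does not constrain \<open>\<psi>\<close> off the manifold,
  whereas \<open>push\<close> uses the inverse on the whole type.\<close>

definition extend_id :: "('a, 'e) cmfd \<Rightarrow> ('a \<Rightarrow> 'a) \<Rightarrow> 'a \<Rightarrow> 'a" where
  "extend_id M \<psi> p = (if p \<in> topspace (mtop M) then \<psi> p else p)"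

context corner_manifold
begin

lemma atlas_auto_extend_id:
  assumes "diffeomorphism M M \<psi>"
  shows "atlas_auto M (extend_id M \<psi>)"
proof -
  let ?X = "topspace (mtop M)" and ?\<phi> = "extend_id M \<psi>"
  have h: "homeomorphic_map (mtop M) (mtop M) \<psi>" and sm: "smooth_map M M \<psi>" "smooth_map M M (inv_into ?X \<psi>)"
    using assms by (auto simp: diffeomorphism_def)
  have surj: "\<psi> ` ?X = ?X" and inj: "inj_on \<psi> ?X"
    using homeomorphic_imp_surjective_map[OF h] homeomorphic_imp_injective_map[OF h] by auto
  have "bij_betw ?\<phi> ?X ?X"
    using inj surj by (simp add: bij_betw_def extend_id_def inj_on_def cong: image_cong_simp)
  moreover have "bij_betw ?\<phi> (- ?X) (- ?X)"
    by (simp add: bij_betw_def extend_id_def inj_on_def cong: image_cong_simp)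
  ultimately have "bij_betw ?\<phi> (?X \<union> - ?X) (?X \<union> - ?X)" by (rule bij_betw_combine) auto
  then have bij: "bij ?\<phi>" by simp
  have h\<phi>: "homeomorphic_map (mtop M) (mtop M) ?\<phi>"
    using h by (rule homeomorphic_map_eq) (simp add: extend_id_def)
  \<comment> \<open>Smoothness is given for \<open>inv_into ?X \<psi>\<close>; this identity passes
    it on to \<open>inv ?\<phi>\<close>.\<close>
  have inv: "inv ?\<phi> p = inv_into ?X \<psi> p" if p: "p \<in> ?X" for p
  proof (rule inv_f_eq[OF bij_is_inj[OF bij]])
    show "?\<phi> (inv_into ?X \<psi> p) = p"
      using p surj f_inv_into_f[of p \<psi> ?X] inv_into_into[of p \<psi> ?X] by (simp add: extend_id_def)
  qed
  obtain g where g: "homeomorphic_maps (mtop M) (mtop M) ?\<phi> g"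
    using h\<phi> homeomorphic_map_maps by blast
  have h_inv: "homeomorphic_map (mtop M) (mtop M) (inv ?\<phi>)"
  proof (rule homeomorphic_map_eq)
    show "homeomorphic_map (mtop M) (mtop M) g" using g homeomorphic_maps_map by blast
    show "g p = inv ?\<phi> p" if "p \<in> ?X" for p
    proof -
      have "?\<phi> (g p) = p" using g that by (simp add: homeomorphic_maps_def)
      then show ?thesis using inv_f_eq[OF bij_is_inj[OF bij]] by metis
    qed
  qed
  have sm\<phi>: "smooth_map M M ?\<phi>" by (rule smooth_map_cong[OF sm(1)]) (simp add: extend_id_def)
  have sm_inv: "smooth_map M M (inv ?\<phi>)" by (rule smooth_map_cong[OF sm(2) inv])
  show ?thesis
  proof
    show "bij ?\<phi>" "homeomorphic_map (mtop M) (mtop M) ?\<phi>" by (fact bij h\<phi>)+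
    fix c assume c: "c \<in> atlas M"
    show "push ?\<phi> c \<in> atlas M" by (rule push_in_atlas[OF bij h\<phi> h_inv sm\<phi> sm_inv c])
    show "push (inv ?\<phi>) c \<in> atlas M"
      using push_in_atlas[OF bij_imp_bij_inv[OF bij] h_inv _ sm_inv _ c] h\<phi> sm\<phi> by (simp add: inv_inv_eq[OF bij])
  qed
qed

text \<open>\<open>pullback\<close> uses an arbitrary chart \<open>c'\<close> at the image point.
  The derivative of \<open>\<psi>\<close> from \<open>c\<close> to \<open>c'\<close> equals that of
  the transition from the pushed chart to \<open>c'\<close>, so the transformation law of
  \<open>\<theta>\<close> removes the choice.\<close>

lemma pullback_push:
  assumes "diffeomorphism M M \<psi>" "one_form M \<theta>" "c \<in> atlas M" "x \<in> cimage c UNIV"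
  shows "pullback M \<psi> \<theta> c x = \<theta> (push (extend_id M \<psi>) c) x"
proof
  fix v
  interpret ext: atlas_auto M "extend_id M \<psi>" by (rule atlas_auto_extend_id[OF assms(1)])
  let ?\<phi> = "extend_id M \<psi>" and ?q = "pt c x"
  let ?c = "push ?\<phi> c"
  have \<phi>: "?\<phi> p = \<psi> p" if "p \<in> fst c" for p
    using that domain_subset[OF assms(3)] by (auto simp: extend_id_def)
  have q: "?q \<in> fst c" "snd c ?q = x" using pt_in[OF assms(4)] snd_pt[OF assms(4)] by auto
  define c' where "c' = (SOME c'. c' \<in> charts_at M (\<psi> ?q))"
  have "?\<phi> ?q \<in> topspace (mtop M)" using q(1) domain_subset[OF assms(3)] by auto
  then have "\<exists>c'. c' \<in> charts_at M (\<psi> ?q)" using chart_obtain \<phi>[OF q(1)] by metis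
  then have c': "c' \<in> charts_at M (\<psi> ?q)" unfolding c'_def by (rule someI_ex)
  have cc: "?c \<in> charts_at M (\<psi> ?q)" "snd ?c (\<psi> ?q) = x"
    using ext.charts_at_push[of c ?q] ext.push_simps(4)[of c ?q] \<phi>[OF q(1)] q assms(3) by (simp_all add: charts_at_def)
  have dom: "cimage ?c (id -` fst c') = cimage c (\<psi> -` fst c')"
  proof -
    have "cimage ?c (id -` fst c') = cimage ?c (?\<phi> ` inv ?\<phi> ` fst c')" by simp
    also have "\<dots> = cimage c (inv ?\<phi> ` fst c')" by (rule ext.cimage_push)
    also have "\<dots> = cimage c (\<psi> -` fst c')"
    proof -
      have "p \<in> inv ?\<phi> ` fst c' \<longleftrightarrow> \<psi> p \<in> fst c'" if "p \<in> fst c" for p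
        using ext.inv_simps(4)[of p "inv ?\<phi> ` fst c'"] \<phi>[OF that] by simp
      then show ?thesis by (auto simp: cimage_def)
    qed
    finally show ?thesis .
  qed
  have "dmap ?c c' id x = dmap c c' \<psi> x"
    unfolding dmap_def dom
  proof (rule frechet_derivative_within_cong[OF _ UNIV_I open_UNIV])
    show "x \<in> cimage c (\<psi> -` fst c')"
      using cimageI[OF q(1), of "\<psi> -` fst c'"] c' q(2) by (simp add: charts_at_def)
    fix y assume "y \<in> cimage c (\<psi> -` fst c') \<inter> UNIV"
    then have y: "y \<in> cimage c UNIV" using cimage_subset[of c "\<psi> -` fst c'"] by blast
    then show "(snd c' \<circ> id \<circ> pt ?c) y = (snd c' \<circ> \<psi> \<circ> pt c) y"
      using ext.pt_push[OF assms(3) y] \<phi>[OF pt_in[OF y]] by simp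
  qed
  moreover have "\<theta> ?c (snd ?c (\<psi> ?q)) v = \<theta> c' (snd c' (\<psi> ?q)) (dmap ?c c' id (snd ?c (\<psi> ?q)) v)"
    by (rule assms(2)[unfolded one_form_def, THEN conjunct2, rule_format, OF cc(1) c'])
  ultimately show "pullback M \<psi> \<theta> c x v = \<theta> ?c x v"
    by (simp add: pullback_def Let_def c'_def[symmetric] cc(2))
qed

text \<open>Continuity of the pullback is read off in the pushed chart, where its components are
  those of \<open>\<theta>\<close>; the chart chosen inside \<open>pullback\<close> may jump from
  point to point.\<close>

lemma pullback_eq_plus_dfun:
  assumes "diffeomorphism M M \<psi>" "one_form M \<theta>" "smooth_fun M f"
    and eq: "form_eq M (pullback M \<psi> \<theta>) (form_plus \<theta> (dfun f))"
    and c: "c \<in> atlas M" "x \<in> cimage c UNIV"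
  shows "pullback M \<psi> \<theta> c x = form_plus \<theta> (dfun f) c x"
proof
  fix v
  interpret ext: atlas_auto M "extend_id M \<psi>" by (rule atlas_auto_extend_id[OF assms(1)])
  note pull = pullback_push[OF assms(1,2) c(1)]
  have "\<theta> (ext.P c) x v = \<theta> c x v + dfun f c x v"
  proof (rule quadrant_dense_interior_eq[OF open_cimage[OF c(1)] c(2)])
    show "continuous_on (cimage c UNIV) (\<lambda>x. \<theta> (ext.P c) x v)"
      using smooth_on_imp_continuous_on[OF smooth_form[OF assms(2) ext.push_atlas[OF c(1)]]] by simp
    show "continuous_on (cimage c UNIV) (\<lambda>x. \<theta> c x v + dfun f c x v)"
      by (intro continuous_on_add smooth_on_imp_continuous_on smooth_form smooth_dfun assms c)
    fix y assume y: "y \<in> cimage c UNIV" "\<forall>b\<in>Basis. y \<bullet> b \<noteq> 0"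
    have "c \<in> charts_at M (pt c y)" "snd c (pt c y) = y"
      using c(1) pt_in[OF y(1)] snd_pt[OF y(1)] by (auto simp: charts_at_def)
    then have "pullback M \<psi> \<theta> c y v = form_plus \<theta> (dfun f) c y v"
      using eq y(2) unfolding form_eq_def by metis
    then show "\<theta> (ext.P c) y v = \<theta> c y v + dfun f c y v" by (simp add: pull[OF y(1)] form_plus_def)
  qed
  then show "pullback M \<psi> \<theta> c x v = form_plus \<theta> (dfun f) c x v"
    by (simp add: pull[OF c(2)] form_plus_def)
qed

text \<open>Off the closure of the set where \<open>f\<close> is nonzero, \<open>f\<close> vanishes
  on a whole neighbourhood, so its derivative is that of the zero function.\<close>

lemma dfun_outside_support:
  assumes "c \<in> atlas M" "x \<in> cimage c UNIV"
    and "pt c x \<notin> mtop M closure_of {p \<in> topspace (mtop M). f p \<noteq> 0}"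
  shows "dfun f c x v = 0"
proof -
  let ?K = "mtop M closure_of {p \<in> topspace (mtop M). f p \<noteq> 0}"
  have W: "openin (mtop M) (topspace (mtop M) - ?K)"
    by (rule openin_diff[OF openin_topspace closedin_closure_of])
  have q: "pt c x \<in> fst c" "snd c (pt c x) = x" using pt_in[OF assms(2)] snd_pt[OF assms(2)] by auto
  then have p: "pt c x \<in> topspace (mtop M) - ?K" using domain_subset[OF assms(1)] assms(3) by auto
  obtain U where U: "open U" "snd c (pt c x) \<in> U"
    "\<And>y. y \<in> cimage c UNIV \<Longrightarrow> y \<in> U \<Longrightarrow> pt c y \<in> topspace (mtop M) - ?K"
    using open_cimage_nbhd[OF assms(1) W q(1) p] by blast
  have zero: "f p = 0" if "p \<in> topspace (mtop M) - ?K" for p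
    using that closure_of_subset[of "{p \<in> topspace (mtop M). f p \<noteq> 0}" "mtop M"] by auto
  have "((f \<circ> pt c) has_derivative (\<lambda>_. 0)) (at x within cimage c UNIV) \<longleftrightarrow>
      ((\<lambda>_. 0 :: real) has_derivative (\<lambda>_. 0)) (at x within cimage c UNIV)"
  proof (rule has_derivative_within_cong[OF assms(2) _ U(1)])
    show "x \<in> U" using U(2) q(2) by simp
    fix y assume "y \<in> cimage c UNIV \<inter> U"
    then show "(f \<circ> pt c) y = 0" using U(3)[of y] zero by simp
  qed
  then have "dchart c (f \<circ> pt c) x = (\<lambda>_. 0)" by (intro dchart_eqI assms) simp
  then show ?thesis by (simp add: dfun_def)
qed

section \<open>Sums of functions and isomorphisms of sectors\<close>

lemma dfun_add:
  assumes "smooth_fun M f" "smooth_fun M g" "c \<in> atlas M" "x \<in> cimage c UNIV"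
  shows "dfun (\<lambda>p. f p + g p) c x v = dfun f c x v + dfun g c x v"
proof -
  have sm: "smooth_on (cimage c UNIV) (f \<circ> pt c)" "smooth_on (cimage c UNIV) (g \<circ> pt c)"
    using assms by (auto simp: smooth_fun_def)
  obtain D where D: "((f \<circ> pt c) has_derivative D) (at x within cimage c UNIV)"
    by (rule smooth_on_derivativeE[OF sm(1) assms(4)]) (use assms(4) in blast)
  obtain D' where D': "((g \<circ> pt c) has_derivative D') (at x within cimage c UNIV)"
    by (rule smooth_on_derivativeE[OF sm(2) assms(4)]) (use assms(4) in blast)
  show ?thesis
    using dchart_eqI[OF assms(3,4) D] dchart_eqI[OF assms(3,4) D']
      dchart_eqI[OF assms(3,4) has_derivative_add[OF D D']]
    by (simp add: dfun_def o_def)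
qed

lemma smooth_fun_add:
  assumes "smooth_fun M f" "smooth_fun M g"
  shows "smooth_fun M (\<lambda>p. f p + g p)"
  unfolding smooth_fun_def
proof
  fix c assume "c \<in> atlas M"
  then have "smooth_on (cimage c UNIV) (f \<circ> pt c)" "smooth_on (cimage c UNIV) (g \<circ> pt c)"
    using assms by (simp_all add: smooth_fun_def)
  from smooth_on_add[OF this] show "smooth_on (cimage c UNIV) ((\<lambda>p. f p + g p) \<circ> pt c)" by (simp add: o_def)
qed

lemma smooth_fun_uminus:
  assumes "smooth_fun M f"
  shows "smooth_fun M (\<lambda>p. - f p)"
  unfolding smooth_fun_def
proof
  fix c assume "c \<in> atlas M"
  then have "smooth_on (cimage c UNIV) (f \<circ> pt c)" using assms by (simp add: smooth_fun_def)
  from smooth_on_compose[OF this smooth_on_bounded_linear[OF bounded_linear_minus[OF bounded_linear_ident]] subset_UNIV]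
  show "smooth_on (cimage c UNIV) ((\<lambda>p. - f p) \<circ> pt c)" by (simp add: o_def)
qed

lemma compactly_supported_add:
  assumes "compactly_supported M f" "compactly_supported M g"
  shows "compactly_supported M (\<lambda>p. f p + g p)"
  unfolding compactly_supported_def
proof (rule closed_compactin[OF compactin_Un[OF assms[unfolded compactly_supported_def]] _ closedin_closure_of])
  show "mtop M closure_of {p \<in> topspace (mtop M). f p + g p \<noteq> 0}
      \<subseteq> mtop M closure_of {p \<in> topspace (mtop M). f p \<noteq> 0} \<union> mtop M closure_of {p \<in> topspace (mtop M). g p \<noteq> 0}"
    unfolding closure_of_Un[symmetric] by (rule closure_of_mono) auto
qed

text \<open>The same diffeomorphism serves, since its pullback of \<theta>' is \<alpha> + dg =
  \<beta> + d(f + g). Applied with \<open>f\<close> and with its negative, this shows that two forms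
  differing by \<open>df\<close> have the same isomorphism class.\<close>

lemma sector_isomorphic_change_form:
  assumes "sector_isomorphic M \<alpha> M' \<theta>'" "smooth_fun M f" "compactly_supported M f"
    and eq: "form_eq M \<alpha> (form_plus \<beta> (dfun f))"
  shows "sector_isomorphic M \<beta> M' \<theta>'"
proof -
  obtain \<phi> g where \<phi>: "diffeomorphism M M' \<phi>" and g: "smooth_fun M g" "compactly_supported M g"
    "form_eq M (pullback M' \<phi> \<theta>') (form_plus \<alpha> (dfun g))"
    using assms(1) unfolding sector_isomorphic_def by blast
  have "form_eq M (pullback M' \<phi> \<theta>') (form_plus \<beta> (dfun (\<lambda>p. f p + g p)))"
    unfolding form_eq_def
  proof (intro allI ballI impI)
    fix p c v assume c: "c \<in> charts_at M p" and v: "\<forall>b\<in>Basis. snd c p \<bullet> b = 0 \<longrightarrow> v \<bullet> b = 0"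
    have "c \<in> atlas M" "snd c p \<in> cimage c UNIV" using c by (auto simp: charts_at_def cimage_UNIV)
    note add = dfun_add[OF assms(2) g(1) this]
    have "pullback M' \<phi> \<theta>' c (snd c p) v = form_plus \<alpha> (dfun g) c (snd c p) v"
      by (rule g(3)[unfolded form_eq_def, rule_format, OF c]) (use v in blast)
    moreover have "\<alpha> c (snd c p) v = form_plus \<beta> (dfun f) c (snd c p) v"
      by (rule eq[unfolded form_eq_def, rule_format, OF c]) (use v in blast)
    ultimately show "pullback M' \<phi> \<theta>' c (snd c p) v = form_plus \<beta> (dfun (\<lambda>p. f p + g p)) c (snd c p) v"
      by (simp add: form_plus_def add)
  qed
  then show ?thesis
    using \<phi> smooth_fun_add[OF assms(2) g(1)] compactly_supported_add[OF assms(3) g(2)]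
    unfolding sector_isomorphic_def by blast
qed

text \<open>Serves to pass from images under the extended map to images under \<open>\<psi>\<close>.
  The two agree for subsets of the manifold, and only the members with index below \<open>m\<close>
  are known to be such.\<close>

lemma transverse_coisotropic_cong:
  assumes "transverse_coisotropic M \<theta> m H" "\<And>i. i < m \<Longrightarrow> H i = H' i"
  shows "transverse_coisotropic M \<theta> m H'"
proof -
  have "dim (\<Inter>i\<in>I. tspace (H' i) c p) + card I = DIM('e)"
    if I: "I \<subseteq> {..<m}" and p: "p \<in> topspace (mtop M) \<inter> (\<Inter>i\<in>I. H' i)" and c: "c \<in> charts_at M p" for I p c
  proof -
    have H': "H' i = H i" if "i \<in> I" for i using assms(2) that I by auto
    then have "(\<Inter>i\<in>I. H' i) = (\<Inter>i\<in>I. H i)" "(\<Inter>i\<in>I. tspace (H' i) c p) = (\<Inter>i\<in>I. tspace (H i) c p)"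
      by simp_all
    then show ?thesis using assms(1) I p c unfolding transverse_coisotropic_def by simp
  qed
  then show ?thesis using assms unfolding transverse_coisotropic_def by simp
qed

end

theorem theorem7p8:
  fixes M :: "('a, 'e::euclidean_space) cmfd" and \<theta> :: "('a, 'e) form1"
    and \<psi> :: "'a \<Rightarrow> 'a" and f :: "'a \<Rightarrow> real"
  assumes "sigma_sector M \<theta>"
    and "diffeomorphism M M \<psi>"
    and "smooth_fun M f" and "compactly_supported M f"
    and "form_eq M (pullback M \<psi> \<theta>) (form_plus \<theta> (dfun f))"
  shows "sector_automorphism M \<theta> \<psi>"
proof -
  let ?\<mu> = "pullback M \<psi> \<theta>" and ?K = "mtop M closure_of {p \<in> topspace (mtop M). f p \<noteq> 0}"
    and ?\<phi> = "extend_id M \<psi>"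
  have lm: "manifold_with_corners M" "one_form M \<theta>"
    using assms(1) by (auto simp: sigma_sector_def liouville_manifold_def)
  interpret corner_manifold M by unfold_locales (rule lm(1))
  interpret ext: atlas_auto M ?\<phi> by (rule atlas_auto_extend_id[OF assms(2)])
  interpret fp: form_push M ?\<phi> \<theta> ?\<mu>
    by unfold_locales (rule pullback_push[OF assms(2) lm(2), symmetric])
  \<comment> \<open>Read along the inverse, transport leads from \<theta> to its pullback; this is
    how the pullback is seen to define a sector.\<close>
  interpret inverse: form_push M "inv ?\<phi>" ?\<mu> \<theta> by (rule fp.form_inverse)
  note \<mu> = pullback_eq_plus_dfun[OF assms(2) lm(2) assms(3,5)]
  interpret pert: compact_perturbation M \<theta> ?\<mu> ?K
  proof
    show "compactin (mtop M) ?K" using assms(4) by (simp add: compactly_supported_def)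
    fix c x assume c: "c \<in> atlas M" "x \<in> cimage c UNIV"
    show "dform ?\<mu> c x = dform \<theta> c x"
    proof -
      have "dform ?\<mu> c x = dform (form_plus \<theta> (dfun f)) c x"
        by (rule dform_cong[OF c]) (rule \<mu>[OF c(1)])
      then show ?thesis using dform_plus_dfun[OF lm(2) assms(3) c] by simp
    qed
    assume "pt c x \<notin> ?K"
    then show "?\<mu> c x = \<theta> c x"
      using \<mu>[OF c] dfun_outside_support[OF c] by (simp add: form_plus_def)
  qed
  have im: "?\<phi> ` H = \<psi> ` H" if "H \<subseteq> topspace (mtop M)" for H
    using that by (intro image_cong) (auto simp: extend_id_def)
  have sectorial: "sigma_sectorial M \<theta> (\<psi> ` H)" if H: "sigma_sectorial M ?\<mu> H" for H
  proof -
    have "H \<subseteq> topspace (mtop M)"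
      using H by (simp add: sigma_sectorial_def proper_hypersurface_def submanifold_def)
    then show ?thesis using fp.sigma_sectorial_push[OF H] im by simp
  qed
  have transverse: "transverse_coisotropic M \<theta> m (\<lambda>i. \<psi> ` H i)"
    if H: "transverse_coisotropic M ?\<mu> m H" for m H
  proof (rule transverse_coisotropic_cong[OF fp.transverse_coisotropic_push[OF H]])
    fix i assume "i < m"
    then have "H i \<subseteq> topspace (mtop M)" using H by (simp add: transverse_coisotropic_def submanifold_def)
    then show "?\<phi> ` H i = \<psi> ` H i" by (rule im)
  qed
  have corner: "sectorial_corner M \<theta> m (\<lambda>i. \<psi> ` H i) (\<psi> ` C)"
    if H: "sectorial_corner M ?\<mu> m H C" for m H C
  proof -
    have m: "m \<ge> 1" and C: "C = (\<Inter>i<m. H i)" and s: "\<And>i. i < m \<Longrightarrow> sigma_sectorial M ?\<mu> (H i)"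
      and t: "transverse_coisotropic M ?\<mu> m H" using H by (auto simp: sectorial_corner_def)
    have top: "H i \<subseteq> topspace (mtop M)" if "i < m" for i
      using s[OF that] by (simp add: sigma_sectorial_def proper_hypersurface_def submanifold_def)
    \<comment> \<open>As \<open>m\<close> is positive, \<open>C\<close> lies in a member of the
      collection and thus in the manifold, where \<open>\<psi>\<close> and its extension
      agree.\<close>
    have "C \<subseteq> H 0" using m C by auto
    then have "C \<subseteq> topspace (mtop M)" using top[of 0] m by auto
    then have \<psi>C: "?\<phi> ` C = \<psi> ` C" by (rule im)
    have \<psi>H: "?\<phi> ` H i = \<psi> ` H i" if "i < m" for i using im[OF top[OF that]] .
    have push: "sectorial_corner M \<theta> m (\<lambda>i. ?\<phi> ` H i) (?\<phi> ` C)"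
      by (rule fp.sectorial_corner_push[OF H])
    then have "\<psi> ` C = (\<Inter>i<m. ?\<phi> ` H i)" unfolding \<psi>C sectorial_corner_def by blast
    then have "\<psi> ` C = (\<Inter>i<m. \<psi> ` H i)" using \<psi>H by (simp cong: INF_cong_simp)
    then show ?thesis
      using push transverse[OF t] sectorial[OF s] unfolding \<psi>C sectorial_corner_def by blast
  qed
  \<comment> \<open>The comparison in the reverse direction, for the other inclusion of isomorphism
    classes. The differential of \<open>- f\<close> is found from the sum with \<open>f\<close>,
    which is zero and has empty support.\<close>
  have eq': "form_eq M \<theta> (form_plus ?\<mu> (dfun (\<lambda>p. - f p)))"
    unfolding form_eq_def
  proof (intro allI ballI impI)
    fix p c v assume c: "c \<in> charts_at M p"
    then have c': "c \<in> atlas M" "snd c p \<in> cimage c UNIV" by (auto simp: charts_at_def cimage_UNIV)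
    have "dfun f c (snd c p) v + dfun (\<lambda>p. - f p) c (snd c p) v = dfun (\<lambda>p. 0) c (snd c p) v"
      using dfun_add[OF assms(3) smooth_fun_uminus[OF assms(3)] c', of v] by simp
    also have "\<dots> = 0" by (rule dfun_outside_support[OF c']) simp
    finally show "\<theta> c (snd c p) v = form_plus ?\<mu> (dfun (\<lambda>p. - f p)) c (snd c p) v"
      using \<mu>[OF c'] by (simp add: form_plus_def)
  qed
  have cs: "compactly_supported M (\<lambda>p. - f p)" using assms(4) by (simp add: compactly_supported_def)
  have "sector_structure M ?\<mu> = sector_structure M \<theta>"
    unfolding sector_structure_def
    using sector_isomorphic_change_form[OF _ assms(3-5)]
      sector_isomorphic_change_form[OF _ smooth_fun_uminus[OF assms(3)] cs eq'] by blast
  moreover have "sigma_sector M ?\<mu>" by (rule inverse.sigma_sector_push[OF assms(1)])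
  \<comment> \<open>For data of the pullback the three conclusions are the transport statements
    above. Data of \<theta> are first turned into data of the pullback by the perturbation lemmas
    and then transported.\<close>
  ultimately show ?thesis
    unfolding sector_automorphism_def
    using assms(2) sectorial transverse corner pert.sigma_sectorial_perturb
      pert.transverse_coisotropic_perturb pert.sectorial_corner_perturb by blast
qed

end
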